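(* Let $(M,\omega)$ be a symplectic manifold and let $G$ be a Lie group acting smoothly on $M$ from the left (the action is not assumed to preserve $\omega$). For $a\in\mathrm{Lie}(G)$ let $\tilde X_a$ denote the infinitesimal generator of the action associated to $a$. Suppose that $$\omega=\omega_i+\Delta\omega,$$ where $\omega_i$ is a $G$-invariant symplectic form on $M$ and $\Delta\omega$ is a closed 2-form on $M$ (not necessarily non-degenerate) such that $L_{\tilde X_a}\omega=L_{\tilde X_a}\Delta\omega$ for all $a\in\mathrm{Lie}(G)$. Suppose that the symplectic action of $G$ on $(M,\omega_i)$ admits momentum maps $J_a\in C^\infty(M)$, $a\in\mathrm{Lie}(G)$, depending linearly on $a$, i.e. $dJ_a=i_{\tilde X_a}\omega_i$ for all $a\in\mathrm{Lie}(G)$. Let $X_{J_a}$ be the Hamiltonian vector field of $J_a$ with respect to $\omega$, and set $\Delta X_a=\tilde X_a-X_{J_a}$. Assume that $$\omega(\Delta X_a,\Delta X_b)=0\qquad\text{for all } a,b\in\mathrm{Lie}(G).$$ Then, as $C^\infty(M)$-valued two-cocycles on $\mathrm{Lie}(G)$, $$\{J_a,J_b\}-J_{[a,b]}\simeq\Omega(b,a),$$ where $\Omega(a,b)=\omega(\tilde X_a,\tilde X_b)$, $\{\cdot,\cdot\}$ is the Poisson bracket associated to $\omega$, and $\simeq$ means cohomologous, i.e. the two cocycles (as functions of $(a,b)$) differ by $\delta\beta$ for some $C^\infty(M)$-valued 1-cochain $\beta$ on $\mathrm{Lie}(G)$.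
   Context: The infinitesimal generator is $\tilde X_a(x)=\frac{d}{dt}\big|_{t=0}\exp(ta)\cdot x$. The group $G$ acts on $C^\infty(M)$ by $(g\cdot f)(x)=f(g^{-1}\cdot x)$, and the derivative of this action makes $C^\infty(M)$ a $\mathrm{Lie}(G)$-module via $a\cdot f=-L_{\tilde X_a}f$, where $L$ is the Lie derivative. The Hamiltonian vector field $X_f$ of $f\in C^\infty(M)$ with respect to $\omega$ is defined by $i_{X_f}\omega=df$ (where $i_X\omega=\omega(X,\cdot)$), and the Poisson bracket associated to $\omega$ is $\{f,g\}=\omega(X_f,X_g)$. An $n$-cochain on $\mathrm{Lie}(G)$ with values in $C^\infty(M)$ is an alternating $n$-multilinear map $\alpha:\mathrm{Lie}(G)^n\to C^\infty(M)$. The coboundary operator is $$(\delta\alpha)(a_1,\dots,a_{n+1})=\sum_{i=1}^{n+1}(-1)^{i+1}a_i\cdot\alpha(a_1,\dots,\hat a_i,\dots,a_{n+1})+\sum_{i<j}(-1)^{i+j}\alpha([a_i,a_j],a_1,\dots,\hat a_i,\dots,\hat a_j,\dots,a_{n+1}),$$ where a hat means that the variable is deleted. In particular, for a 1-cochain $\beta$, $(\delta\beta)(a,b)=a\cdot\beta(b)-b\cdot\beta(a)-\beta([a,b])$. An $n$-cocycle is an $n$-cochain $\alpha$ with $\delta\alpha=0$. The map $(a,b)\mapsto\Omega(a,b)=\omega(\tilde X_a,\tilde X_b)\in C^\infty(M)$ is a two-cocycle, called the canonical cocycle associated to the action of $G$ on $(M,\omega)$. *)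

theory Defs
  imports "HOL-Analysis.Analysis" "HOL-Algebra.Group_Action"
begin

section \<open>Smooth functions between Euclidean spaces\<close>

(* Meant for open S. All iterated directional derivatives exist as Frechet derivatives
   and are continuous. *)
primrec Ck_on :: "nat \<Rightarrow> ('a::euclidean_space \<Rightarrow> 'b::euclidean_space) \<Rightarrow> 'a set \<Rightarrow> bool" where
  "Ck_on 0 f S \<longleftrightarrow> continuous_on S f"
| "Ck_on (Suc k) f S \<longleftrightarrow>
     (\<forall>x\<in>S. f differentiable (at x)) \<and>
     (\<forall>v. Ck_on k (\<lambda>x. frechet_derivative f (at x) v) S)"

definition smooth_on :: "('a::euclidean_space \<Rightarrow> 'b::euclidean_space) \<Rightarrow> 'a set \<Rightarrow> bool" where
  "smooth_on f S \<longleftrightarrow> (\<forall>k. Ck_on k f S)"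


section \<open>Smooth manifolds\<close>

(* A manifold is a Hausdorff, second countable type 'm with a smooth atlas modelled on a
   Euclidean space 'e. The atlas need not be maximal. *)
type_synonym ('m, 'e) chart = "'m set \<times> ('m \<Rightarrow> 'e)"

definition is_chart :: "('m::topological_space, 'e::euclidean_space) chart \<Rightarrow> bool" where
  "is_chart = (\<lambda>(U, \<phi>). open U \<and> open (\<phi> ` U) \<and> homeomorphism U (\<phi> ` U) \<phi> (inv_into U \<phi>))"

definition smooth_atlas ::
  "('m::{t2_space,second_countable_topology}, 'e::euclidean_space) chart set \<Rightarrow> bool" where
  "smooth_atlas A \<longleftrightarrow>
     (\<forall>c\<in>A. is_chart c) \<and> (\<Union>c\<in>A. fst c) = UNIV \<and>
     (\<forall>(U, \<phi>)\<in>A. \<forall>(V, \<psi>)\<in>A. smooth_on (\<psi> \<circ> inv_into U \<phi>) (\<phi> ` (U \<inter> V)))"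

definition smooth_map ::
  "('m::topological_space, 'e::euclidean_space) chart set \<Rightarrow>
   ('n::topological_space, 'd::euclidean_space) chart set \<Rightarrow> ('m \<Rightarrow> 'n) \<Rightarrow> bool" where
  "smooth_map A B F \<longleftrightarrow>
     continuous_on UNIV F \<and>
     (\<forall>(U, \<phi>)\<in>A. \<forall>(V, \<psi>)\<in>B. smooth_on (\<psi> \<circ> F \<circ> inv_into U \<phi>) (\<phi> ` (U \<inter> F -` V)))"

definition euclidean_atlas :: "('e::euclidean_space, 'e) chart set" where
  "euclidean_atlas = {(UNIV, \<lambda>x. x)}"

definition prod_atlas ::
  "('m, 'e) chart set \<Rightarrow> ('n, 'd) chart set \<Rightarrow> ('m \<times> 'n, 'e \<times> 'd) chart set" where
  "prod_atlas A B = {(U \<times> V, map_prod \<phi> \<psi>) | U \<phi> V \<psi>. (U, \<phi>) \<in> A \<and> (V, \<psi>) \<in> B}"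

definition smooth_functions ::
  "('m::topological_space, 'e::euclidean_space) chart set \<Rightarrow> ('m \<Rightarrow> real) set" where
  "smooth_functions A = {f. smooth_map A (euclidean_atlas :: (real, real) chart set) f}"


section \<open>Tangent vectors and vector fields\<close>

(* Tangent vectors are derivations of the algebra of smooth functions, with linear structure
   taken pointwise. They are normalised to vanish off the smooth functions, so that equality
   of tangent vectors is HOL equality. *)
type_synonym 'm tvec = "('m \<Rightarrow> real) \<Rightarrow> real"

definition on_smooth ::
  "('m::topological_space, 'e::euclidean_space) chart set \<Rightarrow> 'm tvec \<Rightarrow> 'm tvec" where
  "on_smooth A v = (\<lambda>f. if f \<in> smooth_functions A then v f else 0)"

definition tangent_space ::
  "('m::topological_space, 'e::euclidean_space) chart set \<Rightarrow> 'm \<Rightarrow> 'm tvec set" where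
  "tangent_space A p =
     {v. (\<forall>f\<in>smooth_functions A. \<forall>g\<in>smooth_functions A.
            (\<forall>c. v (\<lambda>x. c * f x + g x) = c * v f + v g) \<and>
            v (\<lambda>x. f x * g x) = f p * v g + g p * v f) \<and>
         (\<forall>f. f \<notin> smooth_functions A \<longrightarrow> v f = 0)}"

definition differential :: "('m \<Rightarrow> real) \<Rightarrow> 'm \<Rightarrow> 'm tvec \<Rightarrow> real" where
  "differential f p v = v f"

definition tangent_map ::
  "('n::topological_space, 'd::euclidean_space) chart set \<Rightarrow> ('m \<Rightarrow> 'n) \<Rightarrow> 'm tvec \<Rightarrow> 'n tvec" where
  "tangent_map B F v = on_smooth B (\<lambda>f. v (f \<circ> F))"

definition velocity ::
  "('m::topological_space, 'e::euclidean_space) chart set \<Rightarrow> (real \<Rightarrow> 'm) \<Rightarrow> real \<Rightarrow> 'm tvec" where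
  "velocity A \<gamma> t = on_smooth A (\<lambda>f. deriv (f \<circ> \<gamma>) t)"

definition lie_derivative_fun :: "('m \<Rightarrow> 'm tvec) \<Rightarrow> ('m \<Rightarrow> real) \<Rightarrow> 'm \<Rightarrow> real" where
  "lie_derivative_fun X f = (\<lambda>p. X p f)"

definition smooth_vector_field ::
  "('m::topological_space, 'e::euclidean_space) chart set \<Rightarrow> ('m \<Rightarrow> 'm tvec) \<Rightarrow> bool" where
  "smooth_vector_field A X \<longleftrightarrow>
     (\<forall>p. X p \<in> tangent_space A p) \<and>
     (\<forall>f\<in>smooth_functions A. lie_derivative_fun X f \<in> smooth_functions A)"

definition vf_bracket ::
  "('m::topological_space, 'e::euclidean_space) chart set \<Rightarrow>
   ('m \<Rightarrow> 'm tvec) \<Rightarrow> ('m \<Rightarrow> 'm tvec) \<Rightarrow> 'm \<Rightarrow> 'm tvec" where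
  "vf_bracket A X Y p =
     on_smooth A (\<lambda>f. X p (lie_derivative_fun Y f) - Y p (lie_derivative_fun X f))"


section \<open>Two-forms and symplectic forms\<close>

(* Only the values of a form on the tangent spaces matter. *)
type_synonym 'm form2 = "'m \<Rightarrow> 'm tvec \<Rightarrow> 'm tvec \<Rightarrow> real"

definition two_form ::
  "('m::topological_space, 'e::euclidean_space) chart set \<Rightarrow> 'm form2 \<Rightarrow> bool" where
  "two_form A \<omega> \<longleftrightarrow>
     (\<forall>p. \<forall>u\<in>tangent_space A p. \<omega> p u u = 0) \<and>
     (\<forall>p. \<forall>u\<in>tangent_space A p. \<forall>v\<in>tangent_space A p. \<forall>w\<in>tangent_space A p. \<forall>c.
        \<omega> p (\<lambda>f. c * u f + v f) w = c * \<omega> p u w + \<omega> p v w \<and>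
        \<omega> p w (\<lambda>f. c * u f + v f) = c * \<omega> p w u + \<omega> p w v) \<and>
     (\<forall>X Y. smooth_vector_field A X \<longrightarrow> smooth_vector_field A Y \<longrightarrow>
        (\<lambda>p. \<omega> p (X p) (Y p)) \<in> smooth_functions A)"

(* Koszul's invariant formula, evaluated on smooth vector fields. *)
definition exterior_derivative ::
  "('m::topological_space, 'e::euclidean_space) chart set \<Rightarrow> 'm form2 \<Rightarrow>
   ('m \<Rightarrow> 'm tvec) \<Rightarrow> ('m \<Rightarrow> 'm tvec) \<Rightarrow> ('m \<Rightarrow> 'm tvec) \<Rightarrow> 'm \<Rightarrow> real" where
  "exterior_derivative A \<omega> X Y Z p =
     X p (\<lambda>q. \<omega> q (Y q) (Z q)) - Y p (\<lambda>q. \<omega> q (X q) (Z q)) + Z p (\<lambda>q. \<omega> q (X q) (Y q))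
     - \<omega> p (vf_bracket A X Y p) (Z p) + \<omega> p (vf_bracket A X Z p) (Y p)
     - \<omega> p (vf_bracket A Y Z p) (X p)"

definition closed_form ::
  "('m::topological_space, 'e::euclidean_space) chart set \<Rightarrow> 'm form2 \<Rightarrow> bool" where
  "closed_form A \<omega> \<longleftrightarrow>
     (\<forall>X Y Z. smooth_vector_field A X \<longrightarrow> smooth_vector_field A Y \<longrightarrow> smooth_vector_field A Z \<longrightarrow>
        (\<forall>p. exterior_derivative A \<omega> X Y Z p = 0))"

definition nondegenerate ::
  "('m::topological_space, 'e::euclidean_space) chart set \<Rightarrow> 'm form2 \<Rightarrow> bool" where
  "nondegenerate A \<omega> \<longleftrightarrow>
     (\<forall>p. \<forall>u\<in>tangent_space A p. (\<forall>v\<in>tangent_space A p. \<omega> p u v = 0) \<longrightarrow> u = (\<lambda>_. 0))"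

definition symplectic_form ::
  "('m::topological_space, 'e::euclidean_space) chart set \<Rightarrow> 'm form2 \<Rightarrow> bool" where
  "symplectic_form A \<omega> \<longleftrightarrow> two_form A \<omega> \<and> closed_form A \<omega> \<and> nondegenerate A \<omega>"

(* The function obtained by evaluating the 2-form L_X \<omega> on vector fields Y and Z. *)
definition lie_derivative_form ::
  "('m::topological_space, 'e::euclidean_space) chart set \<Rightarrow> ('m \<Rightarrow> 'm tvec) \<Rightarrow> 'm form2 \<Rightarrow>
   ('m \<Rightarrow> 'm tvec) \<Rightarrow> ('m \<Rightarrow> 'm tvec) \<Rightarrow> 'm \<Rightarrow> real" where
  "lie_derivative_form A X \<omega> Y Z p =
     X p (\<lambda>q. \<omega> q (Y q) (Z q))
     - \<omega> p (vf_bracket A X Y p) (Z p) - \<omega> p (Y p) (vf_bracket A X Z p)"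

definition hamiltonian_vf ::
  "('m::topological_space, 'e::euclidean_space) chart set \<Rightarrow> 'm form2 \<Rightarrow> ('m \<Rightarrow> real) \<Rightarrow>
   'm \<Rightarrow> 'm tvec" where
  "hamiltonian_vf A \<omega> f p =
     (THE u. u \<in> tangent_space A p \<and> (\<forall>v\<in>tangent_space A p. \<omega> p u v = differential f p v))"

definition poisson_bracket ::
  "('m::topological_space, 'e::euclidean_space) chart set \<Rightarrow> 'm form2 \<Rightarrow>
   ('m \<Rightarrow> real) \<Rightarrow> ('m \<Rightarrow> real) \<Rightarrow> 'm \<Rightarrow> real" where
  "poisson_bracket A \<omega> f g p = \<omega> p (hamiltonian_vf A \<omega> f p) (hamiltonian_vf A \<omega> g p)"


section \<open>Lie groups\<close>

record ('g, 'd) lie_group = "'g monoid" +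
  atlas :: "('g, 'd) chart set"

definition is_lie_group ::
  "('g::{t2_space,second_countable_topology}, 'd::euclidean_space) lie_group \<Rightarrow> bool" where
  "is_lie_group G \<longleftrightarrow>
     group G \<and> carrier G = UNIV \<and> smooth_atlas (atlas G) \<and>
     smooth_map (prod_atlas (atlas G) (atlas G)) (atlas G) (\<lambda>(g, h). g \<otimes>\<^bsub>G\<^esub> h) \<and>
     smooth_map (atlas G) (atlas G) (\<lambda>g. inv\<^bsub>G\<^esub> g)"

definition Lie :: "('g::topological_space, 'd::euclidean_space) lie_group \<Rightarrow> 'g tvec set" where
  "Lie G = tangent_space (atlas G) \<one>\<^bsub>G\<^esub>"

definition left_invariant_field ::
  "('g::topological_space, 'd::euclidean_space) lie_group \<Rightarrow> 'g tvec \<Rightarrow> 'g \<Rightarrow> 'g tvec" where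
  "left_invariant_field G a g = tangent_map (atlas G) (\<lambda>h. g \<otimes>\<^bsub>G\<^esub> h) a"

(* Convention: the Lie algebra is the tangent space at the identity, with the bracket of
   left-invariant vector fields. *)
definition lie_bracket ::
  "('g::topological_space, 'd::euclidean_space) lie_group \<Rightarrow> 'g tvec \<Rightarrow> 'g tvec \<Rightarrow> 'g tvec" where
  "lie_bracket G a b =
     vf_bracket (atlas G) (left_invariant_field G a) (left_invariant_field G b) \<one>\<^bsub>G\<^esub>"

definition one_parameter_subgroup ::
  "('g::topological_space, 'd::euclidean_space) lie_group \<Rightarrow> (real \<Rightarrow> 'g) \<Rightarrow> bool" where
  "one_parameter_subgroup G \<gamma> \<longleftrightarrow>
     smooth_map (euclidean_atlas :: (real, real) chart set) (atlas G) \<gamma> \<and>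
     (\<forall>s t. \<gamma> (s + t) = \<gamma> s \<otimes>\<^bsub>G\<^esub> \<gamma> t)"

(* The exponential of a is the value at time 1 of the one-parameter subgroup with initial
   velocity a. *)
definition exp_map ::
  "('g::topological_space, 'd::euclidean_space) lie_group \<Rightarrow> 'g tvec \<Rightarrow> 'g" where
  "exp_map G a = (THE \<gamma>. one_parameter_subgroup G \<gamma> \<and> velocity (atlas G) \<gamma> 0 = a) 1"


section \<open>Smooth actions\<close>

definition smooth_action ::
  "('g::topological_space, 'd::euclidean_space) lie_group \<Rightarrow>
   ('m::topological_space, 'e::euclidean_space) chart set \<Rightarrow> ('g \<Rightarrow> 'm \<Rightarrow> 'm) \<Rightarrow> bool" where
  "smooth_action G A act \<longleftrightarrow>
     group_action G UNIV act \<and> smooth_map (prod_atlas (atlas G) A) A (\<lambda>(g, x). act g x)"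

definition generator ::
  "('g::topological_space, 'd::euclidean_space) lie_group \<Rightarrow>
   ('m::topological_space, 'e::euclidean_space) chart set \<Rightarrow> ('g \<Rightarrow> 'm \<Rightarrow> 'm) \<Rightarrow>
   'g tvec \<Rightarrow> 'm \<Rightarrow> 'm tvec" where
  "generator G A act a x = velocity A (\<lambda>t. act (exp_map G (\<lambda>f. t * a f)) x) 0"

definition invariant_form ::
  "('g::topological_space, 'd::euclidean_space) lie_group \<Rightarrow>
   ('m::topological_space, 'e::euclidean_space) chart set \<Rightarrow> ('g \<Rightarrow> 'm \<Rightarrow> 'm) \<Rightarrow>
   'm form2 \<Rightarrow> bool" where
  "invariant_form G A act \<omega> \<longleftrightarrow>
     (\<forall>g\<in>carrier G. \<forall>x. \<forall>u\<in>tangent_space A x. \<forall>v\<in>tangent_space A x.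
        \<omega> (act g x) (tangent_map A (act g) u) (tangent_map A (act g) v) = \<omega> x u v)"

(* The derivative of the action (g . f) x = f (act (inv g) x) on smooth functions. *)
definition module_action ::
  "('g::topological_space, 'd::euclidean_space) lie_group \<Rightarrow>
   ('m::topological_space, 'e::euclidean_space) chart set \<Rightarrow> ('g \<Rightarrow> 'm \<Rightarrow> 'm) \<Rightarrow>
   'g tvec \<Rightarrow> ('m \<Rightarrow> real) \<Rightarrow> 'm \<Rightarrow> real" where
  "module_action G A act a f = (\<lambda>x. - lie_derivative_fun (generator G A act a) f x)"

definition canonical_cocycle ::
  "('g::topological_space, 'd::euclidean_space) lie_group \<Rightarrow>
   ('m::topological_space, 'e::euclidean_space) chart set \<Rightarrow> ('g \<Rightarrow> 'm \<Rightarrow> 'm) \<Rightarrow>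
   'm form2 \<Rightarrow> 'g tvec \<Rightarrow> 'g tvec \<Rightarrow> 'm \<Rightarrow> real" where
  "canonical_cocycle G A act \<omega> a b x = \<omega> x (generator G A act a x) (generator G A act b x)"


section \<open>Lie algebra cochains with values in the smooth functions\<close>

(* An n-cochain takes a list of n arguments; only lists of elements of the Lie algebra matter. *)
definition arguments ::
  "('g::topological_space, 'd::euclidean_space) lie_group \<Rightarrow> nat \<Rightarrow> 'g tvec list set" where
  "arguments G n = {as. length as = n \<and> set as \<subseteq> Lie G}"

definition cochain ::
  "('g::topological_space, 'd::euclidean_space) lie_group \<Rightarrow>
   ('m::topological_space, 'e::euclidean_space) chart set \<Rightarrow> nat \<Rightarrow>
   ('g tvec list \<Rightarrow> 'm \<Rightarrow> real) \<Rightarrow> bool" where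
  "cochain G A n \<alpha> \<longleftrightarrow>
     (\<forall>as\<in>arguments G n.
        \<alpha> as \<in> smooth_functions A \<and>
        (\<forall>i<n. \<forall>a\<in>Lie G. \<forall>b\<in>Lie G. \<forall>c.
           \<alpha> (as[i := (\<lambda>f. c * a f + b f)]) = (\<lambda>x. c * \<alpha> (as[i := a]) x + \<alpha> (as[i := b]) x)) \<and>
        (\<forall>i j. i < j \<longrightarrow> j < n \<longrightarrow> as ! i = as ! j \<longrightarrow> \<alpha> as = (\<lambda>_. 0)))"

definition delete_nth :: "nat \<Rightarrow> 'a list \<Rightarrow> 'a list" where
  "delete_nth i as = take i as @ drop (Suc i) as"

(* Positions are counted from 0, so the sign of the i-th term of the first sum is (-1)^i;
   in the second sum the parity of i + j is unaffected by the shift. *)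
definition coboundary ::
  "('g::topological_space, 'd::euclidean_space) lie_group \<Rightarrow>
   ('m::topological_space, 'e::euclidean_space) chart set \<Rightarrow> ('g \<Rightarrow> 'm \<Rightarrow> 'm) \<Rightarrow>
   ('g tvec list \<Rightarrow> 'm \<Rightarrow> real) \<Rightarrow> 'g tvec list \<Rightarrow> 'm \<Rightarrow> real" where
  "coboundary G A act \<alpha> as x =
     (\<Sum>i<length as. (-1) ^ i * module_action G A act (as ! i) (\<alpha> (delete_nth i as)) x) +
     (\<Sum>j<length as. \<Sum>i<j. (-1) ^ (i + j) *
        \<alpha> (lie_bracket G (as ! i) (as ! j) # delete_nth i (delete_nth j as)) x)"

definition cocycle ::
  "('g::topological_space, 'd::euclidean_space) lie_group \<Rightarrow>
   ('m::topological_space, 'e::euclidean_space) chart set \<Rightarrow> ('g \<Rightarrow> 'm \<Rightarrow> 'm) \<Rightarrow> nat \<Rightarrow>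
   ('g tvec list \<Rightarrow> 'm \<Rightarrow> real) \<Rightarrow> bool" where
  "cocycle G A act n \<alpha> \<longleftrightarrow>
     cochain G A n \<alpha> \<and> (\<forall>as\<in>arguments G (Suc n). coboundary G A act \<alpha> as = (\<lambda>_. 0))"

(* Meant for n > 0. *)
definition cohomologous ::
  "('g::topological_space, 'd::euclidean_space) lie_group \<Rightarrow>
   ('m::topological_space, 'e::euclidean_space) chart set \<Rightarrow> ('g \<Rightarrow> 'm \<Rightarrow> 'm) \<Rightarrow> nat \<Rightarrow>
   ('g tvec list \<Rightarrow> 'm \<Rightarrow> real) \<Rightarrow> ('g tvec list \<Rightarrow> 'm \<Rightarrow> real) \<Rightarrow> bool" where
  "cohomologous G A act n \<alpha> \<alpha>' \<longleftrightarrow>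
     cocycle G A act n \<alpha> \<and> cocycle G A act n \<alpha>' \<and>
     (\<exists>\<beta>. cochain G A (n - 1) \<beta> \<and>
        (\<forall>as\<in>arguments G n. (\<lambda>x. \<alpha> as x - \<alpha>' as x) = coboundary G A act \<beta> as))"

end

theory Submission
  imports Defs
begin

text \<open>
  Write \<open>X\<^sub>a\<close> for the infinitesimal generators and \<open>H\<^sub>a\<close> for the Hamiltonian vector field of \<open>J\<^sub>a\<close> with
  respect to \<open>\<omega>\<close>. Since \<open>\<omega>(H\<^sub>a, v) = v(J\<^sub>a)\<close>, expanding \<open>0 = \<omega>(X\<^sub>a - H\<^sub>a, X\<^sub>b - H\<^sub>b)\<close> gives
  \<open>{J\<^sub>a, J\<^sub>b} = \<Omega>(b, a) + a \<cdot> J\<^sub>b - b \<cdot> J\<^sub>a\<close> at every point. Subtracting \<open>J\<close> of the bracket turns the last two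
  terms into \<open>\<delta>J\<close>, so \<open>J\<close> itself is the one-cochain that relates the two sides. The function \<open>\<Omega>\<close> is a
  cocycle because Koszul's formula for \<open>d\<omega>\<close>, evaluated on generators, is minus the coboundary of \<open>\<Omega>\<close>
  (\<open>cocycle2_canonical\<close>); the left-hand side is then a cocycle because \<open>\<delta>\<delta> = 0\<close> (\<open>cocycle2_coboundary\<close>).

  This computation uses that generators are smooth vector fields depending linearly on \<open>a\<close>, and that
  \<open>[X\<^sub>a, X\<^sub>b]\<close> is minus the generator of \<open>[a, b]\<close>. All of it follows from one formula: the generator is
  the image of \<open>a\<close> under the differential of the orbit map, \<open>X\<^sub>a(x) f = a (g \<mapsto> f (g x))\<close> (\<open>generator_eq\<close>).
  Because the exponential map is described by one-parameter subgroups, the formula requires that for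
  every \<open>a\<close> there is exactly one such subgroup with initial velocity \<open>a\<close>. Existence near \<open>0\<close> and
  uniqueness come from the ordinary differential equation of the left-invariant field in a chart;
  the local solution is a local homomorphism by uniqueness, and extends to the line by taking powers.

  Tangent vectors are derivations of the global smooth functions. By Hadamard's lemma and cutoff
  functions each of them is a directional derivative in a chart (\<open>tangent_space_chart_derivative\<close>).
  This is what allows the differential equation to be written down; it also makes derivations acting on
  different variables commute (\<open>tangent_commute\<close>), which gives the bracket of generators, and it makes
  tangent spaces finite-dimensional, so that nondegeneracy of \<open>\<omega>\<close> yields the fields \<open>H\<^sub>a\<close>
  (\<open>hamiltonian_vf\<close>).
\<close>

section \<open>Functions of class \<open>C\<^sup>k\<close> on open sets\<close>

lemma Ck_on_has_derivative:
  "Ck_on (Suc k) f S \<Longrightarrow> x \<in> S \<Longrightarrow> (f has_derivative frechet_derivative f (at x)) (at x)"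
  by (simp flip: frechet_derivative_works)

text \<open>Congruence of \<open>Ck_on k\<close> is a hypothesis because it is proved by induction on \<open>k\<close> with the help of
  this rule; \<open>Ck_on_Suc_derivative\<close> below is the rule without it.\<close>

lemma Ck_on_SucI:
  fixes f :: "'a::euclidean_space \<Rightarrow> 'b::euclidean_space"
  assumes "open S" "\<And>x. x \<in> S \<Longrightarrow> (f has_derivative f' x) (at x)"
    and "\<And>v. Ck_on k (\<lambda>x. f' x v) S"
    and cong: "\<And>f g :: 'a \<Rightarrow> 'b. (\<And>x. x \<in> S \<Longrightarrow> f x = g x) \<Longrightarrow> Ck_on k f S \<Longrightarrow> Ck_on k g S"
  shows "Ck_on (Suc k) f S"
proof -
  have "f' x v = frechet_derivative f (at x) v" if "x \<in> S" for x v
    using frechet_derivative_at[OF assms(2)[OF that]] by simp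
  then have "Ck_on k (\<lambda>x. frechet_derivative f (at x) v) S" for v
    by (intro cong[OF _ assms(3)[of v]]) auto
  then show ?thesis
    using assms(2) by (auto simp: differentiable_def)
qed

lemma Ck_on_cong:
  assumes "open S" "\<And>x. x \<in> S \<Longrightarrow> f x = g x" "Ck_on k f S"
  shows "Ck_on k g S"
  using assms(2,3)
proof (induction k arbitrary: f g)
  case 0
  then show ?case by (auto cong: continuous_on_cong)
next
  case (Suc k)
  then have "(f has_derivative frechet_derivative f (at x)) (at x)" if "x \<in> S" for x
    using that by (intro Ck_on_has_derivative)
  then have D: "(g has_derivative frechet_derivative f (at x)) (at x)" if "x \<in> S" for x
    using has_derivative_transform_within_open[OF _ assms(1)] that Suc.prems(1) by blast
  show ?case
    using Suc.prems(2) by (intro Ck_on_SucI[OF assms(1) D _ Suc.IH]) auto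
qed

lemma Ck_on_Suc_derivative:
  assumes "open S" "\<And>x. x \<in> S \<Longrightarrow> (f has_derivative f' x) (at x)"
    and "\<And>v. Ck_on k (\<lambda>x. f' x v) S"
  shows "Ck_on (Suc k) f S"
  using Ck_on_SucI[OF assms] Ck_on_cong[OF assms(1)] by blast

lemma Ck_on_subset: "Ck_on k f S \<Longrightarrow> T \<subseteq> S \<Longrightarrow> Ck_on k f T"
  by (induction k arbitrary: f) (auto intro: continuous_on_subset)

lemma Ck_on_continuous:
  "Ck_on k f S \<Longrightarrow> continuous_on S f"
proof (cases k)
  case (Suc j)
  assume "Ck_on k f S"
  then show ?thesis
    using Suc by (auto intro!: continuous_at_imp_continuous_on differentiable_imp_continuous_within)
qed auto

lemma Ck_on_SucD: "Ck_on (Suc k) f S \<Longrightarrow> Ck_on k f S"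
proof (induction k arbitrary: f)
  case 0
  then show ?case using Ck_on_continuous[OF 0] by simp
qed auto

lemma Ck_on_local:
  assumes "\<And>x. x \<in> S \<Longrightarrow> \<exists>T. open T \<and> x \<in> T \<and> Ck_on k f T"
  shows "Ck_on k f S"
  using assms
proof (induction k arbitrary: f)
  case 0
  have "continuous (at x) f" if x: "x \<in> S" for x
  proof -
    obtain T where "open T" "x \<in> T" "continuous_on T f" using 0[OF x] by auto
    then show ?thesis using continuous_on_eq_continuous_at by blast
  qed
  then show ?case by (simp add: continuous_at_imp_continuous_on)
next
  case (Suc k)
  have "Ck_on k (\<lambda>x. frechet_derivative f (at x) v) S" for v
    using Suc.prems by (intro Suc.IH) (metis Ck_on.simps(2))
  moreover have "f differentiable (at x)" if "x \<in> S" for x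
    using Suc.prems[OF that] by auto
  ultimately show ?case by simp
qed

lemma Ck_on_const: "Ck_on k (\<lambda>x. c) S"
  by (induction k arbitrary: c) auto

lemma Ck_on_bounded_linear:
  assumes "open S" "bounded_linear f"
  shows "Ck_on k f S"
proof (cases k)
  case 0
  then show ?thesis using assms(2) by (simp add: linear_continuous_on)
next
  case (Suc j)
  show ?thesis unfolding Suc
    by (rule Ck_on_Suc_derivative[where f'="\<lambda>x. f"])
      (use assms in \<open>auto intro: bounded_linear_imp_has_derivative Ck_on_const\<close>)
qed

lemma Ck_on_add:
  assumes "open S" "Ck_on k f S" "Ck_on k g S"
  shows "Ck_on k (\<lambda>x. f x + g x) S"
  using assms(2,3)
proof (induction k arbitrary: f g)
  case 0
  then show ?case by (auto intro: continuous_intros)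
next
  case (Suc k)
  show ?case
    by (rule Ck_on_Suc_derivative[OF assms(1) has_derivative_add[OF
          Ck_on_has_derivative[OF Suc.prems(1)] Ck_on_has_derivative[OF Suc.prems(2)]]])
      (use Suc in auto)
qed

lemma Ck_on_sum:
  assumes "open S" "finite I" "\<And>i. i \<in> I \<Longrightarrow> Ck_on k (f i) S"
  shows "Ck_on k (\<lambda>x. \<Sum>i\<in>I. f i x) S"
  using assms(2,3) by (induction I) (auto intro: Ck_on_const Ck_on_add[OF assms(1)])

lemma Ck_on_bilinear:
  assumes "bounded_bilinear pr" "open S" "Ck_on k f S" "Ck_on k g S"
  shows "Ck_on k (\<lambda>x. pr (f x) (g x)) S"
  using assms(3,4)
proof (induction k arbitrary: f g)
  case 0
  then show ?case by (auto intro: bounded_bilinear.continuous_on[OF assms(1)])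
next
  case (Suc k)
  show ?case
  proof (rule Ck_on_Suc_derivative[OF assms(2) bounded_bilinear.FDERIV[OF assms(1)
          Ck_on_has_derivative[OF Suc.prems(1)] Ck_on_has_derivative[OF Suc.prems(2)]]])
    fix v
    have "Ck_on k (\<lambda>x. frechet_derivative f (at x) v) S" "Ck_on k (\<lambda>x. frechet_derivative g (at x) v) S"
      using Suc.prems by simp_all
    then show "Ck_on k (\<lambda>x. pr (f x) (frechet_derivative g (at x) v) +
        pr (frechet_derivative f (at x) v) (g x)) S"
      using Ck_on_SucD[OF Suc.prems(1)] Ck_on_SucD[OF Suc.prems(2)]
      by (intro Ck_on_add[OF assms(2)] Suc.IH)
  qed
qed

text \<open>The directional derivative of \<open>g \<circ> f\<close> is a sum over a basis of products of components of
  the derivative of \<open>f\<close> with partial derivatives of \<open>g\<close> along \<open>f\<close>; the latter are covered by the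
  induction hypothesis.\<close>

lemma Ck_on_compose:
  assumes "open S" "open T" "f ` S \<subseteq> T" "Ck_on k f S" "Ck_on k g T"
  shows "Ck_on k (\<lambda>x. g (f x)) S"
  using assms(4,5)
proof (induction k arbitrary: g)
  case 0
  then show ?case using assms(3) by (simp add: continuous_on_compose2)
next
  case (Suc k)
  note f = Ck_on_has_derivative[OF Suc.prems(1)] and g = Ck_on_has_derivative[OF Suc.prems(2)]
  have D: "((\<lambda>x. g (f x)) has_derivative
      (\<lambda>v. \<Sum>b\<in>Basis. (frechet_derivative f (at x) v \<bullet> b) *\<^sub>R frechet_derivative g (at (f x)) b)) (at x)"
    if x: "x \<in> S" for x
  proof -
    have fx: "f x \<in> T" using x assms(3) by auto
    have chain: "((\<lambda>x. g (f x)) has_derivative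
        (\<lambda>v. frechet_derivative g (at (f x)) (frechet_derivative f (at x) v))) (at x)"
      by (rule has_derivative_compose[OF f[OF x] g[OF fx]])
    have rep: "frechet_derivative g (at (f x)) w =
        (\<Sum>b\<in>Basis. (w \<bullet> b) *\<^sub>R frechet_derivative g (at (f x)) b)" for w
    proof -
      have l: "linear (frechet_derivative g (at (f x)))"
        using has_derivative_linear[OF g[OF fx]] .
      have "frechet_derivative g (at (f x)) w =
          frechet_derivative g (at (f x)) (\<Sum>b\<in>Basis. (w \<bullet> b) *\<^sub>R b)"
        by (simp only: euclidean_representation)
      also have "\<dots> = (\<Sum>b\<in>Basis. (w \<bullet> b) *\<^sub>R frechet_derivative g (at (f x)) b)"
        by (simp only: linear_sum[OF l] linear_cmul[OF l])
      finally show ?thesis .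
    qed
    show ?thesis
      by (rule has_derivative_eq_rhs[OF chain]) (rule ext, rule rep)
  qed
  show ?case
  proof (rule Ck_on_Suc_derivative[OF assms(1) D])
    fix v
    show "Ck_on k (\<lambda>x. \<Sum>b\<in>Basis. (frechet_derivative f (at x) v \<bullet> b) *\<^sub>R
        frechet_derivative g (at (f x)) b) S"
    proof (intro Ck_on_sum Ck_on_bilinear[OF bounded_bilinear_scaleR] assms(1))
      fix b :: 'b
      have "Ck_on k (\<lambda>x. frechet_derivative f (at x) v) S" using Suc.prems by simp
      then show "Ck_on k (\<lambda>x. frechet_derivative f (at x) v \<bullet> b) S"
        by (intro Ck_on_bilinear[OF bounded_bilinear_inner] Ck_on_const assms(1))
      show "Ck_on k (\<lambda>x. frechet_derivative g (at (f x)) b) S"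
        by (rule Suc.IH[OF Ck_on_SucD[OF Suc.prems(1)]]) (use Suc.prems(2) in simp)
    qed auto
  qed auto
qed

lemma smooth_on_has_derivative:
  "smooth_on f S \<Longrightarrow> x \<in> S \<Longrightarrow> (f has_derivative frechet_derivative f (at x)) (at x)"
  unfolding smooth_on_def by (rule Ck_on_has_derivative) auto

lemma smooth_on_frechet_derivative:
  "smooth_on f S \<Longrightarrow> smooth_on (\<lambda>x. frechet_derivative f (at x) v) S"
  unfolding smooth_on_def by (metis Ck_on.simps(2))

lemma smooth_on_continuous: "smooth_on f S \<Longrightarrow> continuous_on S f"
  unfolding smooth_on_def using Ck_on_continuous by blast

lemma smooth_on_cong:
  "open S \<Longrightarrow> (\<And>x. x \<in> S \<Longrightarrow> f x = g x) \<Longrightarrow> smooth_on f S \<Longrightarrow> smooth_on g S"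
  unfolding smooth_on_def using Ck_on_cong by blast

lemma smooth_on_subset: "smooth_on f S \<Longrightarrow> T \<subseteq> S \<Longrightarrow> smooth_on f T"
  unfolding smooth_on_def using Ck_on_subset by blast

lemma smooth_on_local:
  assumes "\<And>x. x \<in> S \<Longrightarrow> \<exists>T. open T \<and> x \<in> T \<and> smooth_on f T"
  shows "smooth_on f S"
  unfolding smooth_on_def
proof
  fix k show "Ck_on k f S"
    using assms unfolding smooth_on_def by (intro Ck_on_local) meson
qed

lemma smooth_on_const: "smooth_on (\<lambda>x. c) S"
  unfolding smooth_on_def using Ck_on_const by blast

lemma smooth_on_bounded_linear: "open S \<Longrightarrow> bounded_linear f \<Longrightarrow> smooth_on f S"
  unfolding smooth_on_def using Ck_on_bounded_linear by blast

lemma smooth_on_id: "open S \<Longrightarrow> smooth_on (\<lambda>x. x) S"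
  by (intro smooth_on_bounded_linear bounded_linear_ident)

lemma smooth_on_add:
  "open S \<Longrightarrow> smooth_on f S \<Longrightarrow> smooth_on g S \<Longrightarrow> smooth_on (\<lambda>x. f x + g x) S"
  unfolding smooth_on_def using Ck_on_add by blast

lemma smooth_on_bilinear:
  "bounded_bilinear pr \<Longrightarrow> open S \<Longrightarrow> smooth_on f S \<Longrightarrow> smooth_on g S \<Longrightarrow>
    smooth_on (\<lambda>x. pr (f x) (g x)) S"
  unfolding smooth_on_def using Ck_on_bilinear by blast

lemmas smooth_on_mult = smooth_on_bilinear[OF bounded_bilinear_mult]
lemmas smooth_on_inner = smooth_on_bilinear[OF bounded_bilinear_inner]

lemma smooth_on_compose:
  "open S \<Longrightarrow> open T \<Longrightarrow> f ` S \<subseteq> T \<Longrightarrow> smooth_on f S \<Longrightarrow> smooth_on g T \<Longrightarrow>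
    smooth_on (\<lambda>x. g (f x)) S"
  unfolding smooth_on_def using Ck_on_compose by blast

lemma smooth_on_bounded_linear_compose:
  "open S \<Longrightarrow> bounded_linear h \<Longrightarrow> smooth_on f S \<Longrightarrow> smooth_on (\<lambda>x. h (f x)) S"
  using smooth_on_compose[of S UNIV f h] smooth_on_bounded_linear[of UNIV h] by auto

lemma smooth_on_diff:
  assumes "open S" "smooth_on f S" "smooth_on g S" shows "smooth_on (\<lambda>x. f x - g x) S"
proof -
  have "smooth_on (\<lambda>x. - g x) S"
    by (intro smooth_on_bounded_linear_compose[OF _ bounded_linear_minus[OF bounded_linear_ident]] assms)
  from smooth_on_add[OF assms(1,2) this] show ?thesis by simp
qed

lemma smooth_on_Pair:
  assumes "open S" "smooth_on f S" "smooth_on g S" shows "smooth_on (\<lambda>x. (f x, g x)) S"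
proof -
  have "bounded_linear (\<lambda>y::'b. (y, 0::'c))" "bounded_linear (\<lambda>y::'c. (0::'b, y))"
    by (intro bounded_linear_Pair bounded_linear_ident bounded_linear_zero)+
  then have "smooth_on (\<lambda>x. (f x, 0) + (0, g x)) S"
    using assms by (intro smooth_on_add smooth_on_bounded_linear_compose[of _ "\<lambda>y. (y, 0)"]
      smooth_on_bounded_linear_compose[of _ "\<lambda>y. (0, y)"])
  then show ?thesis by simp
qed

text \<open>The derivative of the inverse is a polynomial in the inverse, so its order of differentiability
  can be raised step by step.\<close>

lemma smooth_on_inverse:
  fixes f :: "'a::euclidean_space \<Rightarrow> real"
  assumes "open S" "smooth_on f S" "\<And>x. x \<in> S \<Longrightarrow> f x \<noteq> 0"
  shows "smooth_on (\<lambda>x. inverse (f x)) S"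
proof -
  have o: "open (- {0::real})" by auto
  have "Ck_on k (inverse :: real \<Rightarrow> real) (- {0})" for k
  proof (induction k)
    case 0
    then show ?case by (auto intro!: continuous_intros)
  next
    case (Suc k)
    show ?case
    proof (rule Ck_on_Suc_derivative[OF o])
      fix x :: real assume "x \<in> - {0}"
      then show "(inverse has_derivative (\<lambda>h. inverse x * inverse x * (- h))) (at x)"
        using has_derivative_inverse'[of x UNIV] by (simp add: algebra_simps)
    next
      show "Ck_on k (\<lambda>x. inverse x * inverse x * (- v)) (- {0})" for v :: real
        by (intro Ck_on_bilinear[OF bounded_bilinear_mult] o Suc Ck_on_const)
    qed
  qed
  then have "smooth_on (inverse :: real \<Rightarrow> real) (- {0})" by (simp add: smooth_on_def)
  then show ?thesis
    using assms by (intro smooth_on_compose[of S "- {0}" f inverse]) auto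
qed

section \<open>Smooth cutoff functions\<close>

text \<open>The members \<open>x\<^sup>-\<^sup>k exp (- 1 / x)\<close> of this family differ from the usual flat function only by a power,
  and the derivative of each is a combination of two others; this makes all of them smooth at once.\<close>

definition flat_exp :: "nat \<Rightarrow> real \<Rightarrow> real" where
  "flat_exp k x = (if x \<le> 0 then 0 else exp (- (1 / x)) / x ^ k)"

lemma flat_exp_tendsto_0: "(flat_exp k \<longlongrightarrow> 0) (at 0)"
  unfolding filterlim_at_split
proof
  have "\<forall>\<^sub>F x in at_left 0. flat_exp k x = 0"
    by (simp add: eventually_at_filter flat_exp_def)
  then show "(flat_exp k \<longlongrightarrow> 0) (at_left 0)" by (rule tendsto_eventually)
  have "((\<lambda>x. inverse x ^ k / exp (inverse x)) \<longlongrightarrow> 0) (at_right (0::real))"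
    by (rule filterlim_compose[OF tendsto_power_div_exp_0 filterlim_inverse_at_top_right])
  moreover have "\<forall>\<^sub>F x in at_right 0. inverse x ^ k / exp (inverse x) = flat_exp k x"
    using eventually_at_right_less
    by eventually_elim (simp add: flat_exp_def exp_minus field_simps)
  ultimately show "(flat_exp k \<longlongrightarrow> 0) (at_right 0)" by (rule Lim_transform_eventually)
qed

lemma flat_exp_derivative:
  "(flat_exp k has_real_derivative flat_exp (k + 2) x - real k * flat_exp (k + 1) x) (at x)"
proof -
  consider "x < 0" | "x = 0" | "x > 0" by linarith
  then show ?thesis
  proof cases
    case 1
    have "((\<lambda>x. 0) has_real_derivative 0) (at x)" by simp
    then have "(flat_exp k has_real_derivative 0) (at x)"
      by (rule has_field_derivative_transform_within[where d="- x"]) (use 1 in \<open>auto simp: flat_exp_def dist_real_def\<close>)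
    then show ?thesis using 1 by (simp add: flat_exp_def)
  next
    case 2
    \<comment> \<open>at 0 the difference quotient is the next member of the family\<close>
    have "\<forall>\<^sub>F h in at 0. flat_exp (k + 1) h = (flat_exp k (0 + h) - flat_exp k 0) / h"
      by (rule always_eventually) (simp add: flat_exp_def)
    then have "(flat_exp k has_real_derivative 0) (at 0)"
      unfolding DERIV_def using flat_exp_tendsto_0 by (rule Lim_transform_eventually[rotated])
    then show ?thesis using 2 by (simp add: flat_exp_def)
  next
    case 3
    have "((\<lambda>x. exp (- (1 / x)) / x ^ k) has_real_derivative
        (exp (- (1 / x)) * (1 / x ^ 2) * x ^ k - exp (- (1 / x)) * (real k * x ^ (k - 1))) / (x ^ k * x ^ k)) (at x)"
      using 3 by (auto intro!: derivative_eq_intros simp: power2_eq_square)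
    moreover have "(exp (- (1 / x)) * (1 / x ^ 2) * x ^ k - exp (- (1 / x)) * (real k * x ^ (k - 1))) / (x ^ k * x ^ k)
        = flat_exp (k + 2) x - real k * flat_exp (k + 1) x"
      using 3 by (cases k) (auto simp: flat_exp_def field_simps power2_eq_square)
    ultimately have "((\<lambda>x. exp (- (1 / x)) / x ^ k) has_real_derivative
        flat_exp (k + 2) x - real k * flat_exp (k + 1) x) (at x)" by simp
    then show ?thesis
      by (rule has_field_derivative_transform_within[where d=x]) (use 3 in \<open>auto simp: flat_exp_def dist_real_def\<close>)
  qed
qed

lemma smooth_on_flat_exp: "smooth_on (flat_exp k) UNIV"
proof -
  have "Ck_on n (flat_exp k) UNIV" for n
  proof (induction n arbitrary: k)
    case 0
    then show ?case
      using flat_exp_derivative by (auto intro!: DERIV_continuous_on)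
  next
    case (Suc n)
    show ?case
    proof (rule Ck_on_Suc_derivative)
      show "(flat_exp k has_derivative (\<lambda>v. (flat_exp (k + 2) x + - real k * flat_exp (k + 1) x) * v)) (at x)" for x
        using flat_exp_derivative[of k x] by (simp add: has_field_derivative_def)
      show "Ck_on n (\<lambda>x. (flat_exp (k + 2) x + - real k * flat_exp (k + 1) x) * v) UNIV" for v
        by (intro Ck_on_bilinear[OF bounded_bilinear_mult] Ck_on_add Suc Ck_on_const open_UNIV)
    qed simp
  qed
  then show ?thesis by (simp add: smooth_on_def)
qed

lemma flat_exp_pos: "0 < x \<Longrightarrow> 0 < flat_exp k x"
  and flat_exp_nonneg: "0 \<le> flat_exp k x"
  by (auto simp: flat_exp_def)

text \<open>The function \<open>f / (f + g)\<close>, where \<open>f\<close> is positive exactly on the large ball and \<open>g\<close> vanishes exactly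
  on the closed small one, so that they have no common zero.\<close>

lemma smooth_cutoff:
  fixes p :: "'a::euclidean_space"
  assumes "0 < r"
  obtains c :: "'a \<Rightarrow> real" where "smooth_on c UNIV"
    "\<And>x. x \<in> ball p (r / 2) \<Longrightarrow> c x = 1" "\<And>x. x \<notin> ball p r \<Longrightarrow> c x = 0"
proof
  let ?n = "\<lambda>x. (x - p) \<bullet> (x - p)"
  let ?f = "\<lambda>x. flat_exp 0 (r\<^sup>2 - ?n x)" and ?g = "\<lambda>x. flat_exp 0 (?n x - (r / 2)\<^sup>2)"
  have n: "?n x = (dist p x)\<^sup>2" for x
    by (metis dist_commute dist_norm power2_norm_eq_inner)
  have sn: "smooth_on ?n UNIV"
    by (intro smooth_on_inner smooth_on_diff smooth_on_id smooth_on_const open_UNIV)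
  have sf: "smooth_on ?f UNIV" "smooth_on ?g UNIV"
    by (rule smooth_on_compose[OF _ _ _ _ smooth_on_flat_exp];
        intro smooth_on_diff sn smooth_on_const open_UNIV subset_UNIV)+
  have pos: "?f x + ?g x > 0" for x
  proof (cases "?n x < r\<^sup>2")
    case True
    then show ?thesis using flat_exp_pos[of "r\<^sup>2 - ?n x" 0] flat_exp_nonneg[of 0 "?n x - (r / 2)\<^sup>2"] by simp
  next
    case False
    then have "?n x > (r / 2)\<^sup>2" using assms by (simp add: power2_eq_square)
      (smt (verit) mult_pos_pos)
    then show ?thesis using flat_exp_pos[of "?n x - (r / 2)\<^sup>2" 0] flat_exp_nonneg[of 0 "r\<^sup>2 - ?n x"] by simp
  qed
  show "smooth_on (\<lambda>x. ?f x * inverse (?f x + ?g x)) UNIV"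
    by (intro smooth_on_mult smooth_on_inverse smooth_on_add sf open_UNIV)
      (use pos in \<open>auto simp: less_le\<close>)
  show "?f x * inverse (?f x + ?g x) = 1" if "x \<in> ball p (r / 2)" for x
  proof -
    have "?n x \<le> (r / 2)\<^sup>2" unfolding n using that by (intro power_mono) auto
    then have "?g x = 0" by (simp add: flat_exp_def)
    then show ?thesis using pos[of x] by simp
  qed
  show "?f x * inverse (?f x + ?g x) = 0" if "x \<notin> ball p r" for x
  proof -
    have "r\<^sup>2 \<le> ?n x" unfolding n using that assms by (intro power_mono) auto
    then show ?thesis by (simp add: flat_exp_def)
  qed
qed

section \<open>Hadamard's lemma and the symmetry of second derivatives\<close>

lemma segment_in_ball:
  fixes p x :: "'a::real_normed_vector"
  assumes "x \<in> ball p r" "t \<in> {0..1}"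
  shows "p + t *\<^sub>R (x - p) \<in> ball p r"
proof -
  have "norm (t *\<^sub>R (x - p)) \<le> norm (x - p)" using assms by (simp add: mult_left_le_one_le)
  then show ?thesis using assms by (simp add: dist_norm norm_minus_commute)
qed

text \<open>Differentiation under the integral sign raises the power of \<open>t\<close> by one; carrying an
  arbitrary power therefore makes the family of these averages closed under differentiation.\<close>

lemma Ck_on_segment_average:
  fixes f :: "'a::euclidean_space \<Rightarrow> real"
  assumes "Ck_on k f (ball p r)"
  shows "Ck_on k (\<lambda>x. integral {0..1} (\<lambda>t. t ^ m * f (p + t *\<^sub>R (x - p)))) (ball p r)"
  using assms
proof (induction k arbitrary: f m)
  note seg = segment_in_ball[of _ p r]
  have cont: "continuous_on (ball p r \<times> {0..1}) (\<lambda>(x, t). t ^ m * f (p + t *\<^sub>R (x - p)))"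
    if "continuous_on (ball p r) f" for f :: "'a \<Rightarrow> real" and m
    unfolding split_beta
    by (intro continuous_intros continuous_on_compose2[OF that]) (use seg in auto)
  {
    case 0
    have "continuous_on (ball p r) f" using 0 by simp
    then show ?case
      using integral_continuous_on_param[of "ball p r" 0 1 "\<lambda>x t. t ^ m * f (p + t *\<^sub>R (x - p))"]
        cont[of f m] by (simp add: cbox_interval)
  next
    case (Suc k)
    define D where "D = (\<lambda>x. frechet_derivative f (at x))"
    have D: "(f has_derivative D x) (at x)" if "x \<in> ball p r" for x
      using Ck_on_has_derivative[OF Suc.prems that] by (simp add: D_def)
    have CD: "Ck_on k (\<lambda>x. D x v) (ball p r)" for v using Suc.prems by (simp add: D_def)
    have bl: "bounded_linear (\<lambda>v. t ^ Suc m * D (p + t *\<^sub>R (x - p)) v)"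
      if "x \<in> ball p r" "t \<in> {0..1}" for x t
      using has_derivative_bounded_linear[OF D[OF seg[OF that]]]
      by (rule bounded_linear_const_mult)
    define B where "B = (\<lambda>x t. Blinfun (\<lambda>v. t ^ Suc m * D (p + t *\<^sub>R (x - p)) v))"
    have B: "blinfun_apply (B x t) = (\<lambda>v. t ^ Suc m * D (p + t *\<^sub>R (x - p)) v)"
      if "x \<in> ball p r" "t \<in> {0..1}" for x t
      using bounded_linear_Blinfun_apply[OF bl[OF that]] by (simp add: B_def)
    have contB: "continuous_on (ball p r \<times> {0..1}) (\<lambda>(x, t). B x t)"
    proof (rule continuous_on_blinfun_componentwise)
      fix i :: 'a
      have "continuous_on (ball p r \<times> {0..1}) (\<lambda>(x, t). t ^ Suc m * D (p + t *\<^sub>R (x - p)) i)"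
        by (rule cont) (rule Ck_on_continuous[OF CD])
      then show "continuous_on (ball p r \<times> {0..1}) (\<lambda>z. blinfun_apply (case z of (x, t) \<Rightarrow> B x t) i)"
        by (rule continuous_on_eq) (auto simp: B)
    qed
    have dB: "((\<lambda>x. t ^ m * f (p + t *\<^sub>R (x - p))) has_derivative blinfun_apply (B y t)) (at y)"
      if y: "y \<in> ball p r" and t: "t \<in> {0..1}" for y t
    proof -
      have 1: "((\<lambda>x. p + t *\<^sub>R (x - p)) has_derivative (\<lambda>v. t *\<^sub>R v)) (at y)"
        by (auto intro!: derivative_eq_intros)
      have 2: "((\<lambda>x. t ^ m * f (p + t *\<^sub>R (x - p))) has_derivative
          (\<lambda>v. t ^ m * D (p + t *\<^sub>R (y - p)) (t *\<^sub>R v))) (at y)"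
        by (rule has_derivative_mult_right[OF has_derivative_compose[OF 1 D[OF seg[OF y t]]]])
      have "t ^ m * D (p + t *\<^sub>R (y - p)) (t *\<^sub>R v) = t ^ Suc m * D (p + t *\<^sub>R (y - p)) v" for v
        using linear_cmul[OF has_derivative_linear[OF D[OF seg[OF y t]]], of t v] by simp
      then show ?thesis
        unfolding B[OF y t] by (intro has_derivative_eq_rhs[OF 2] ext)
    qed
    have int: "(\<lambda>t. t ^ m * f (p + t *\<^sub>R (y - p))) integrable_on cbox 0 1" if y: "y \<in> ball p r" for y
    proof -
      have "continuous_on (cbox 0 1) (\<lambda>t. t ^ m * f (p + t *\<^sub>R (y - p)))"
        using y seg by (intro continuous_intros continuous_on_compose2[OF Ck_on_continuous[OF Suc.prems]]) auto
      then show ?thesis by (rule integrable_continuous)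
    qed
    have dB': "((\<lambda>x. t ^ m * f (p + t *\<^sub>R (x - p))) has_derivative blinfun_apply (B y t)) (at y within ball p r)"
      if "y \<in> ball p r" "t \<in> cbox 0 1" for y t
      by (rule has_derivative_at_withinI[OF dB]) (use that in auto)
    have contB': "continuous_on (ball p r \<times> cbox 0 1) (\<lambda>(x, t). B x t)"
      using contB by simp
    have L: "((\<lambda>x. integral (cbox 0 1) (\<lambda>t. t ^ m * f (p + t *\<^sub>R (x - p)))) has_derivative
        blinfun_apply (integral (cbox 0 1) (B x))) (at x within ball p r)" if x: "x \<in> ball p r" for x
      by (rule leibniz_rule[where f="\<lambda>x t. t ^ m * f (p + t *\<^sub>R (x - p))",
            OF dB' int contB' x convex_ball])
    have R: "blinfun_apply (integral (cbox 0 1) (B x)) v =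
        integral {0..1} (\<lambda>t. t ^ Suc m * D (p + t *\<^sub>R (x - p)) v)" if x: "x \<in> ball p r" for x v
    proof -
      have "continuous_on {0..1} (\<lambda>t. case (x, t) of (x, t) \<Rightarrow> B x t)"
        by (rule continuous_on_compose2[OF contB]) (use x in \<open>auto intro!: continuous_intros\<close>)
      then have "continuous_on {0..1} (B x)" by simp
      then have "B x integrable_on cbox 0 1" using integrable_continuous[of 0 1 "B x"] by simp
      then have "blinfun_apply (integral (cbox 0 1) (B x)) v = integral (cbox 0 1) (\<lambda>t. blinfun_apply (B x t) v)"
        by (rule blinfun_apply_integral)
      also have "\<dots> = integral {0..1} (\<lambda>t. t ^ Suc m * D (p + t *\<^sub>R (x - p)) v)"
        by (auto intro!: integral_cong simp: B[OF x])
      finally show ?thesis .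
    qed
    have "((\<lambda>x. integral {0..1} (\<lambda>t. t ^ m * f (p + t *\<^sub>R (x - p)))) has_derivative
        (\<lambda>v. integral {0..1} (\<lambda>t. t ^ Suc m * D (p + t *\<^sub>R (x - p)) v))) (at x)" if x: "x \<in> ball p r" for x
      by (rule has_derivative_eq_rhs[OF L[OF x, unfolded at_within_open[OF x open_ball] cbox_interval]])
        (rule ext, rule R[OF x, unfolded cbox_interval])
    note deriv = this
    show ?case
      by (rule Ck_on_Suc_derivative[OF open_ball deriv Suc.IH[OF CD]])
  }
qed

text \<open>Integrate the derivative of \<open>f\<close> along the segment from \<open>p\<close> to \<open>x\<close>: the factor \<open>g b\<close> is the average of
  the partial derivative in direction \<open>b\<close> over that segment.\<close>

lemma hadamard:
  fixes f :: "'a::euclidean_space \<Rightarrow> real"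
  assumes "smooth_on f (ball p r)" "0 < r"
  obtains g :: "'a \<Rightarrow> 'a \<Rightarrow> real" where "\<And>b. smooth_on (g b) (ball p r)"
    "\<And>b. g b p = frechet_derivative f (at p) b"
    "\<And>x. x \<in> ball p r \<Longrightarrow> f x = f p + (\<Sum>b\<in>Basis. ((x - p) \<bullet> b) * g b x)"
proof
  define D where "D = (\<lambda>x. frechet_derivative f (at x))"
  have D: "(f has_derivative D x) (at x)" if "x \<in> ball p r" for x
    using smooth_on_has_derivative[OF assms(1) that] by (simp add: D_def)
  let ?g = "\<lambda>b x. integral {0..1} (\<lambda>t. t ^ 0 * D (p + t *\<^sub>R (x - p)) b)"
  have sD: "smooth_on (\<lambda>x. D x b) (ball p r)" for b
    unfolding D_def by (rule smooth_on_frechet_derivative[OF assms(1)])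
  show "smooth_on (?g b) (ball p r)" for b
    using sD[of b] Ck_on_segment_average unfolding smooth_on_def by blast
  show "?g b p = frechet_derivative f (at p) b" for b
    by (simp add: D_def)
  fix x assume x: "x \<in> ball p r"
  note seg = segment_in_ball[OF x]
  have "((\<lambda>t. D (p + t *\<^sub>R (x - p)) (x - p)) has_integral f (p + 1 *\<^sub>R (x - p)) - f (p + 0 *\<^sub>R (x - p))) {0..1}"
  proof (rule fundamental_theorem_of_calculus)
    fix t :: real assume t: "t \<in> {0..1}"
    have "((\<lambda>t. f (p + t *\<^sub>R (x - p))) has_derivative (\<lambda>s. D (p + t *\<^sub>R (x - p)) (s *\<^sub>R (x - p)))) (at t within {0..1})"
      by (rule has_derivative_compose[where f="\<lambda>t. p + t *\<^sub>R (x - p)", OF _ D[OF seg[OF t]]]) (auto intro!: derivative_eq_intros)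
    then show "((\<lambda>t. f (p + t *\<^sub>R (x - p))) has_vector_derivative D (p + t *\<^sub>R (x - p)) (x - p)) (at t within {0..1})"
      unfolding has_vector_derivative_def
      using linear_cmul[OF has_derivative_linear[OF D[OF seg[OF t]]]] by simp
  qed simp
  then have "f x - f p = integral {0..1} (\<lambda>t. D (p + t *\<^sub>R (x - p)) (x - p))"
    by (simp add: integral_unique)
  also have "\<dots> = integral {0..1} (\<lambda>t. \<Sum>b\<in>Basis. ((x - p) \<bullet> b) * D (p + t *\<^sub>R (x - p)) b)"
  proof (rule integral_cong)
    fix t :: real assume t: "t \<in> {0..1}"
    note l = has_derivative_linear[OF D[OF seg[OF t]]]
    have "D (p + t *\<^sub>R (x - p)) (x - p) = D (p + t *\<^sub>R (x - p)) (\<Sum>b\<in>Basis. ((x - p) \<bullet> b) *\<^sub>R b)"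
      by (simp only: euclidean_representation)
    also have "\<dots> = (\<Sum>b\<in>Basis. ((x - p) \<bullet> b) * D (p + t *\<^sub>R (x - p)) b)"
      by (simp only: linear_sum[OF l] linear_cmul[OF l] real_scaleR_def)
    finally show "D (p + t *\<^sub>R (x - p)) (x - p) = (\<Sum>b\<in>Basis. ((x - p) \<bullet> b) * D (p + t *\<^sub>R (x - p)) b)" .
  qed
  also have "\<dots> = (\<Sum>b\<in>Basis. integral {0..1} (\<lambda>t. ((x - p) \<bullet> b) * D (p + t *\<^sub>R (x - p)) b))"
  proof (rule integral_sum)
    fix b :: 'a
    have "continuous_on {0..1} (\<lambda>t. ((x - p) \<bullet> b) * D (p + t *\<^sub>R (x - p)) b)"
      using seg by (intro continuous_intros continuous_on_compose2[OF smooth_on_continuous[OF sD]]) auto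
    then show "(\<lambda>t. ((x - p) \<bullet> b) * D (p + t *\<^sub>R (x - p)) b) integrable_on {0..1}"
      by (rule integrable_continuous_real)
  qed simp
  finally show "f x = f p + (\<Sum>b\<in>Basis. ((x - p) \<bullet> b) * ?g b x)"
    by simp
qed

text \<open>Symmetry of second derivatives: integrate \<open>\<partial>\<^sub>v f\<close> in the direction \<open>v\<close>, differentiate under the
  integral in the direction \<open>w\<close>, and differentiate the result in the direction \<open>v\<close> again.\<close>

lemma smooth_on_derivative_commute:
  fixes f :: "'a::euclidean_space \<Rightarrow> real"
  assumes "smooth_on f S" "open S" "x \<in> S"
  shows "frechet_derivative (\<lambda>y. frechet_derivative f (at y) v) (at x) w =
    frechet_derivative (\<lambda>y. frechet_derivative f (at y) w) (at x) v"
proof -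
  define D where "D = (\<lambda>h y u. frechet_derivative (h :: 'a \<Rightarrow> real) (at y) u)"
  let ?A = "\<lambda>y. D f y v" and ?B = "\<lambda>y. D f y w"
  have sm: "smooth_on (\<lambda>y. D h y u) S" if "smooth_on h S" for h u
    unfolding D_def by (rule smooth_on_frechet_derivative[OF that])
  have dl: "((\<lambda>s. h (z + s *\<^sub>R u)) has_vector_derivative D h (z + s *\<^sub>R u) u) (at s within X)"
    if "smooth_on h S" "z + s *\<^sub>R u \<in> S" for h z s u X
  proof -
    note d = smooth_on_has_derivative[OF that]
    have "((\<lambda>s. h (z + s *\<^sub>R u)) has_derivative
        (\<lambda>r. frechet_derivative h (at (z + s *\<^sub>R u)) (r *\<^sub>R u))) (at s within X)"
      by (rule has_derivative_compose[where f="\<lambda>s. z + s *\<^sub>R u", OF _ d]) (auto intro!: derivative_eq_intros)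
    then show ?thesis unfolding has_vector_derivative_def D_def
      using linear_cmul[OF has_derivative_linear[OF d]] by simp
  qed
  obtain e where e: "0 < e" "ball x e \<subseteq> S" using assms(2,3) open_contains_ball by blast
  define r where "r = e / (2 * (norm v + norm w + 1))"
  have nn: "0 < norm v + norm w + 1" by (smt (verit) norm_ge_zero)
  have r: "0 < r" using e nn by (simp add: r_def)
  have inS: "x + t *\<^sub>R w + s *\<^sub>R v \<in> S" if "s \<in> {-r..r}" "t \<in> {-r..r}" for s t
  proof -
    have "norm (t *\<^sub>R w + s *\<^sub>R v) \<le> \<bar>t\<bar> * norm w + \<bar>s\<bar> * norm v"
      using norm_triangle_ineq[of "t *\<^sub>R w" "s *\<^sub>R v"] by simp
    also have "\<dots> \<le> r * norm w + r * norm v"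
      using that by (intro add_mono mult_right_mono) auto
    also have "\<dots> = r * (norm v + norm w)" by (simp add: algebra_simps)
    also have "\<dots> < r * (2 * (norm v + norm w + 1))"
      using r nn by (intro mult_strict_left_mono) auto
    also have "\<dots> = e" using nn by (simp add: r_def)
    finally have "dist (x + (t *\<^sub>R w + s *\<^sub>R v)) x < e" by (simp add: dist_norm)
    then have "dist x (x + t *\<^sub>R w + s *\<^sub>R v) < e" by (simp add: dist_commute add.assoc)
    then show ?thesis using e by auto
  qed
  have inS0: "x + s *\<^sub>R v \<in> S" if "s \<in> {-r..r}" for s using inS[OF that, of 0] r by simp
  \<comment> \<open>the increment of \<open>\<partial>\<^sub>w f\<close> along \<open>v\<close>, obtained by differentiating that of \<open>f\<close> in direction \<open>w\<close>\<close>
  have key: "?B (x + s *\<^sub>R v) - ?B x = integral {0..s} (\<lambda>\<sigma>. D ?A (x + \<sigma> *\<^sub>R v) w)" if s: "s \<in> {0..r}" for s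
  proof -
    have i: "integral {0..s} (\<lambda>\<sigma>. ?A (x + t *\<^sub>R w + \<sigma> *\<^sub>R v)) = f (x + s *\<^sub>R v + t *\<^sub>R w) - f (x + t *\<^sub>R w)"
      if t: "t \<in> {-r..r}" for t
    proof -
      have "((\<lambda>\<sigma>. ?A (x + t *\<^sub>R w + \<sigma> *\<^sub>R v)) has_integral f (x + t *\<^sub>R w + s *\<^sub>R v) - f (x + t *\<^sub>R w + 0 *\<^sub>R v)) {0..s}"
        using s by (intro fundamental_theorem_of_calculus dl[OF assms(1)] inS t) auto
      then show ?thesis by (simp add: integral_unique add_ac)
    qed
    have dA: "((\<lambda>t. ?A (x + t *\<^sub>R w + \<sigma> *\<^sub>R v)) has_vector_derivative
        D ?A (x + t *\<^sub>R w + \<sigma> *\<^sub>R v) w) (at t within {-r..r})"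
      if "t \<in> {-r..r}" "\<sigma> \<in> cbox 0 s" for t \<sigma>
    proof -
      have sw: "x + t *\<^sub>R w + \<sigma> *\<^sub>R v = x + \<sigma> *\<^sub>R v + t *\<^sub>R w" for t by simp
      have "x + \<sigma> *\<^sub>R v + t *\<^sub>R w \<in> S" using inS[of \<sigma> t] s that by (simp add: sw)
      from dl[OF sm[OF assms(1)] this] show ?thesis by (simp only: sw)
    qed
    have intA: "(\<lambda>\<sigma>. ?A (x + t *\<^sub>R w + \<sigma> *\<^sub>R v)) integrable_on cbox 0 s" if "t \<in> {-r..r}" for t
    proof -
      have "continuous_on (cbox 0 s) (\<lambda>\<sigma>. ?A (x + t *\<^sub>R w + \<sigma> *\<^sub>R v))"
        by (rule continuous_on_compose2[OF smooth_on_continuous[OF sm[OF assms(1)]]])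
          (use s that in \<open>auto intro!: inS continuous_intros\<close>)
      then show ?thesis by (rule integrable_continuous)
    qed
    have contA: "continuous_on ({-r..r} \<times> cbox 0 s) (\<lambda>(t, \<sigma>). D ?A (x + t *\<^sub>R w + \<sigma> *\<^sub>R v) w)"
      unfolding split_beta
      by (rule continuous_on_compose2[OF smooth_on_continuous[OF sm[OF sm[OF assms(1)]]]])
        (use s in \<open>auto intro!: inS continuous_intros\<close>)
    have "0 \<in> {-r..r}" using r by simp
    from leibniz_rule_vector_derivative[where f="\<lambda>t \<sigma>. ?A (x + t *\<^sub>R w + \<sigma> *\<^sub>R v)",
        OF dA intA contA this convex_real_interval(5)]
    have "((\<lambda>t. integral (cbox 0 s) (\<lambda>\<sigma>. ?A (x + t *\<^sub>R w + \<sigma> *\<^sub>R v))) has_vector_derivative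
        integral (cbox 0 s) (\<lambda>\<sigma>. D ?A (x + 0 *\<^sub>R w + \<sigma> *\<^sub>R v) w)) (at 0 within {-r..r})" .
    then have "((\<lambda>t. integral {0..s} (\<lambda>\<sigma>. ?A (x + t *\<^sub>R w + \<sigma> *\<^sub>R v))) has_vector_derivative
        integral {0..s} (\<lambda>\<sigma>. D ?A (x + \<sigma> *\<^sub>R v) w)) (at 0 within {-r..r})"
      by (simp add: cbox_interval)
    then have 1: "((\<lambda>t. f (x + s *\<^sub>R v + t *\<^sub>R w) - f (x + t *\<^sub>R w)) has_vector_derivative
        integral {0..s} (\<lambda>\<sigma>. D ?A (x + \<sigma> *\<^sub>R v) w)) (at 0 within {-r..r})"
      by (rule has_vector_derivative_transform[rotated 2])
        (use r in \<open>simp_all add: i del: scaleR_zero_left\<close>)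
    have 2: "((\<lambda>t. f (x + s *\<^sub>R v + t *\<^sub>R w) - f (x + t *\<^sub>R w)) has_vector_derivative
        ?B (x + s *\<^sub>R v + 0 *\<^sub>R w) - ?B (x + 0 *\<^sub>R w)) (at 0 within {-r..r})"
      using s inS0[of s] assms(3) by (intro has_vector_derivative_diff dl assms(1)) auto
    have "at 0 within {-r..r} \<noteq> bot" using r by (simp add: at_within_Icc_at)
    from vector_derivative_unique_within[OF this 2 1] show ?thesis by simp
  qed
  have cD: "continuous_on {0..r} (\<lambda>\<sigma>. D ?A (x + \<sigma> *\<^sub>R v) w)"
    by (rule continuous_on_compose2[OF smooth_on_continuous[OF sm[OF sm[OF assms(1)]]]])
      (auto intro!: inS0 continuous_intros)
  have "((\<lambda>s. integral {0..s} (\<lambda>\<sigma>. D ?A (x + \<sigma> *\<^sub>R v) w)) has_vector_derivative D ?A (x + 0 *\<^sub>R v) w) (at 0 within {0..r})"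
    using r by (intro integral_has_vector_derivative cD) auto
  then have "((\<lambda>s. integral {0..s} (\<lambda>\<sigma>. D ?A (x + \<sigma> *\<^sub>R v) w)) has_vector_derivative D ?A x w) (at 0 within {0..r})"
    by simp
  then have 1: "((\<lambda>s. ?B (x + s *\<^sub>R v) - ?B x) has_vector_derivative D ?A x w) (at 0 within {0..r})"
    by (rule has_vector_derivative_transform[rotated 2]) (use r in \<open>simp_all add: key\<close>)
  have 2: "((\<lambda>s. ?B (x + s *\<^sub>R v) - ?B x) has_vector_derivative D ?B (x + 0 *\<^sub>R v) v - 0) (at 0 within {0..r})"
    using assms(3) by (intro has_vector_derivative_diff dl sm assms(1) has_vector_derivative_const) auto
  have "at 0 within {0..r} \<noteq> bot" using r by (simp add: at_within_Icc_at_right)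
  from vector_derivative_unique_within[OF this 1 2] show ?thesis by (simp add: D_def)
qed

section \<open>Ordinary differential equations\<close>

text \<open>The partial derivatives are bounded on a compact ball, and the mean value inequality applies because
  the ball is convex.\<close>

lemma smooth_on_imp_lipschitz:
  fixes X :: "'a::euclidean_space \<Rightarrow> 'b::euclidean_space"
  assumes "smooth_on X S" "open S" "p \<in> S"
  obtains r L where "0 < r" "cball p r \<subseteq> S" "L-lipschitz_on (cball p r) X"
proof -
  obtain r where r: "0 < r" "cball p r \<subseteq> S" using assms(2,3) open_contains_cball by blast
  define D where "D = (\<lambda>x. frechet_derivative X (at x))"
  have D: "(X has_derivative D x) (at x)" if "x \<in> cball p r" for x
    using smooth_on_has_derivative[OF assms(1)] that r by (auto simp: D_def)
  have "\<exists>M. \<forall>x\<in>cball p r. norm (D x b) \<le> M" for b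
  proof -
    have "continuous_on (cball p r) (\<lambda>x. D x b)"
      using continuous_on_subset[OF smooth_on_continuous[OF smooth_on_frechet_derivative[OF assms(1)]] r(2)]
      by (simp add: D_def)
    then have "bounded ((\<lambda>x. D x b) ` cball p r)"
      by (intro compact_imp_bounded compact_continuous_image compact_cball)
    then show ?thesis by (auto simp: bounded_iff)
  qed
  then obtain M where M: "\<And>b x. x \<in> cball p r \<Longrightarrow> norm (D x b) \<le> M b" by metis
  define L where "L = (\<Sum>b\<in>Basis. M b)"
  have M0: "0 \<le> M b" for b
    by (rule order_trans[OF norm_ge_zero M[of p]]) (use r in simp)
  have on: "onorm (D x) \<le> L" if x: "x \<in> cball p r" for x
  proof (rule onorm_le)
    fix h
    note l = has_derivative_linear[OF D[OF x]]
    have "D x h = D x (\<Sum>b\<in>Basis. (h \<bullet> b) *\<^sub>R b)" by (simp only: euclidean_representation)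
    also have "\<dots> = (\<Sum>b\<in>Basis. (h \<bullet> b) *\<^sub>R D x b)" by (simp only: linear_sum[OF l] linear_cmul[OF l])
    also have "norm \<dots> \<le> (\<Sum>b\<in>Basis. norm h * M b)"
    proof (rule sum_norm_le)
      fix b :: 'a assume "b \<in> Basis"
      then show "norm ((h \<bullet> b) *\<^sub>R D x b) \<le> norm h * M b"
        using M[OF x, of b] Basis_le_norm[of b h] by (auto intro: mult_mono)
    qed
    finally show "norm (D x h) \<le> L * norm h"
      by (simp add: L_def sum_distrib_left mult.commute)
  qed
  have "L-lipschitz_on (cball p r) X"
  proof (rule lipschitz_onI)
    fix x y assume xy: "x \<in> cball p r" "y \<in> cball p r"
    have "(X has_derivative D z) (at z within cball p r)" if "z \<in> cball p r" for z
      by (rule has_derivative_at_withinI[OF D[OF that]])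
    from differentiable_bound[OF convex_cball this on xy]
    show "dist (X x) (X y) \<le> L * dist x y" by (simp add: dist_norm)
  qed (simp add: L_def sum_nonneg M0)
  with r show ?thesis using that by blast
qed

text \<open>The field is extended from the ball to a Lipschitz field on the whole space by precomposing
  with the nearest point retraction; then Picard's operator on bounded continuous curves, frozen
  outside \<open>[-c, c]\<close>, is a contraction for small \<open>c\<close>.\<close>

lemma ode_local_solution:
  fixes X :: "'a::euclidean_space \<Rightarrow> 'a"
  assumes "0 < r" "L-lipschitz_on (cball p r) X"
  obtains e u where "0 < e" "u 0 = p"
    "\<And>t. t \<in> {-e<..<e} \<Longrightarrow> u t \<in> ball p r \<and> (u has_vector_derivative X (u t)) (at t)"
proof -
  have L0: "0 \<le> L" using assms(2) by (rule lipschitz_on_nonneg)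
  define V where "V = (\<lambda>x. X (closest_point (cball p r) x))"
  have cb: "cball p r \<noteq> {}" using assms(1) by simp
  have cp: "closest_point (cball p r) x \<in> cball p r" for x
    using closest_point_in_set[OF closed_cball cb] .
  have V: "dist (V x) (V y) \<le> L * dist x y" for x y
  proof -
    have "dist (V x) (V y) \<le> L * dist (closest_point (cball p r) x) (closest_point (cball p r) y)"
      unfolding V_def using assms(2) cp cp by (rule lipschitz_onD)
    also have "\<dots> \<le> L * dist x y"
      using closest_point_lipschitz[OF convex_cball closed_cball cb] L0 by (rule mult_left_mono)
    finally show ?thesis .
  qed
  have "L-lipschitz_on UNIV V" using V L0 by (intro lipschitz_onI) auto
  then have Vc: "continuous_on UNIV V" by (rule lipschitz_on_continuous_on)
  \<comment> \<open>\<open>P\<close> below contains two integrals over intervals of length at most \<open>2 c\<close>, each contributing \<open>2 c L\<close>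
    to the Lipschitz constant\<close>
  define c where "c = 1 / (8 * (L + 1))"
  have c: "0 < c" "4 * c * L \<le> 1 / 2" using L0 by (auto simp: c_def field_simps)
  define I where "I = (\<lambda>u t. integral {-c..t} (\<lambda>s. V (apply_bcontfun u s)))"
  have Vu: "continuous_on T (\<lambda>s. V (apply_bcontfun u s))" for T and u :: "real \<Rightarrow>\<^sub>C 'a"
    by (rule continuous_on_compose2[OF Vc]) auto
  have Ic: "continuous_on {-c..c} (I u)" for u
    unfolding I_def by (intro indefinite_integral_continuous_1 integrable_continuous_real Vu)
  define cl where "cl = (\<lambda>t::real. max (-c) (min c t))"
  have cl: "cl t \<in> {-c..c}" for t using c by (auto simp: cl_def)
  have clc: "continuous_on UNIV cl" unfolding cl_def by (intro continuous_intros)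
  define P where "P = (\<lambda>u t. p + I u (cl t) - I u 0)"
  have Pb: "P u \<in> bcontfun" for u
  proof -
    have "continuous_on UNIV (P u)"
      unfolding P_def using cl by (intro continuous_intros continuous_on_compose2[OF Ic clc]) auto
    moreover have "bounded (range (P u))"
    proof -
      have "bounded ((\<lambda>t. p + I u t - I u 0) ` {-c..c})"
        by (intro compact_imp_bounded compact_continuous_image continuous_intros Ic compact_Icc)
      then show ?thesis by (rule bounded_subset) (use cl in \<open>auto simp: P_def\<close>)
    qed
    ultimately show ?thesis by (simp add: bcontfun_def)
  qed
  have Id: "norm (I u t - I w t) \<le> 2 * c * L * dist u w" if t: "t \<in> {-c..c}" for u w t
  proof -
    have "I u t - I w t = integral {-c..t} (\<lambda>s. V (apply_bcontfun u s) - V (apply_bcontfun w s))"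
      unfolding I_def by (intro integral_diff[symmetric] integrable_continuous_real Vu)
    also have "norm \<dots> \<le> (L * dist u w) * (t - - c)"
    proof (rule integral_bound)
      fix s
      have "norm (V (apply_bcontfun u s) - V (apply_bcontfun w s)) \<le> L * dist (apply_bcontfun u s) (apply_bcontfun w s)"
        using V by (simp add: dist_norm)
      also have "\<dots> \<le> L * dist u w" using dist_bounded L0 by (rule mult_left_mono)
      finally show "norm (V (apply_bcontfun u s) - V (apply_bcontfun w s)) \<le> L * dist u w" .
    qed (use t in \<open>auto intro!: continuous_intros Vu\<close>)
    also have "\<dots> \<le> (L * dist u w) * (2 * c)"
      using t L0 by (intro mult_left_mono) auto
    finally show ?thesis by (simp add: mult_ac)
  qed
  have "\<exists>!u. Bcontfun (P u) = u"
  proof (rule banach_fix_type[where c="1/2"], simp, simp, intro allI)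
    fix u w
    show "dist (Bcontfun (P u)) (Bcontfun (P w)) \<le> 1 / 2 * dist u w"
    proof (rule dist_bound)
      fix t
      have "dist (apply_bcontfun (Bcontfun (P u)) t) (apply_bcontfun (Bcontfun (P w)) t)
          = norm ((I u (cl t) - I w (cl t)) - (I u 0 - I w 0))"
        by (simp only: Bcontfun_inverse[OF Pb] dist_norm) (simp add: P_def algebra_simps)
      also have "\<dots> \<le> 2 * c * L * dist u w + 2 * c * L * dist u w"
        using c by (intro norm_triangle_le_diff add_mono Id cl) auto
      also have "\<dots> = (4 * c * L) * dist u w" by simp
      also have "\<dots> \<le> 1 / 2 * dist u w" using c(2) by (rule mult_right_mono) simp
      finally show "dist (apply_bcontfun (Bcontfun (P u)) t) (apply_bcontfun (Bcontfun (P w)) t) \<le> 1 / 2 * dist u w" .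
    qed
  qed
  then obtain u where "Bcontfun (P u) = u" by auto
  then have u: "apply_bcontfun u = P u" by (metis Bcontfun_inverse Pb)
  have u0: "apply_bcontfun u 0 = p" using c by (simp add: u P_def cl_def)
  have du: "(apply_bcontfun u has_vector_derivative V (apply_bcontfun u t)) (at t)" if t: "t \<in> {-c<..<c}" for t
  proof -
    have "(I u has_vector_derivative V (apply_bcontfun u t)) (at t within {-c..c})"
      unfolding I_def by (rule integral_has_vector_derivative[OF Vu]) (use t in auto)
    then have "(I u has_vector_derivative V (apply_bcontfun u t)) (at t)"
      using t by (simp add: at_within_Icc_at)
    then have "((\<lambda>t. p + I u t - I u 0) has_vector_derivative V (apply_bcontfun u t)) (at t)"
      by (auto intro!: derivative_eq_intros)
    then show ?thesis
      by (rule has_vector_derivative_transform_within_open[OF _ open_greaterThanLessThan t])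
        (auto simp: u P_def cl_def)
  qed
  have "open (apply_bcontfun u -` ball p r)"
    by (intro open_vimage open_ball continuous_on_apply_bcontfun)
  moreover have "0 \<in> apply_bcontfun u -` ball p r" using u0 assms(1) by simp
  ultimately obtain e where e: "0 < e" "ball 0 e \<subseteq> apply_bcontfun u -` ball p r"
    using open_contains_ball by blast
  show ?thesis
  proof
    show "0 < min e c" using e c by simp
    show "apply_bcontfun u 0 = p" by (rule u0)
    fix t assume t: "t \<in> {- min e c<..<min e c}"
    then have "t \<in> ball 0 e" by auto
    then have b: "apply_bcontfun u t \<in> ball p r" using e(2) by auto
    then have "V (apply_bcontfun u t) = X (apply_bcontfun u t)"
      unfolding V_def using closest_point_self[of "apply_bcontfun u t" "cball p r"] by (auto simp: less_imp_le)
    then show "apply_bcontfun u t \<in> ball p r \<and> (apply_bcontfun u has_vector_derivative X (apply_bcontfun u t)) (at t)"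
      using du[of t] t b by auto
  qed
qed

text \<open>Gronwall's argument: the squared distance of two solutions grows at most at the rate \<open>2 L\<close>, so
  multiplied by \<open>exp (- 2 L s)\<close> it does not increase.\<close>

lemma ode_unique_forward:
  fixes X :: "'a::euclidean_space \<Rightarrow> 'a"
  assumes L: "L-lipschitz_on B X" and init: "u 0 = w 0" and t: "0 \<le> t"
    and u: "\<And>s. s \<in> {0..t} \<Longrightarrow> u s \<in> B \<and> (u has_vector_derivative X (u s)) (at s)"
    and w: "\<And>s. s \<in> {0..t} \<Longrightarrow> w s \<in> B \<and> (w has_vector_derivative X (w s)) (at s)"
  shows "u t = w t"
proof -
  define g where "g = (\<lambda>s. exp (- (2 * L * s)) * ((u s - w s) \<bullet> (u s - w s)))"
  have "g t \<le> g 0"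
  proof (rule DERIV_nonpos_imp_nonincreasing[OF t])
    fix s assume "0 \<le> s" "s \<le> t"
    then have s: "s \<in> {0..t}" by simp
    let ?d = "u s - w s" and ?e = "X (u s) - X (w s)"
    have "((\<lambda>s. u s - w s) has_vector_derivative ?e) (at s)"
      using u[OF s] w[OF s] by (intro has_vector_derivative_diff) auto
    then have d: "((\<lambda>s. u s - w s) has_derivative (\<lambda>h. h *\<^sub>R ?e)) (at s)"
      by (simp add: has_vector_derivative_def)
    have "((\<lambda>s. (u s - w s) \<bullet> (u s - w s)) has_derivative (\<lambda>h. ?d \<bullet> (h *\<^sub>R ?e) + (h *\<^sub>R ?e) \<bullet> ?d)) (at s)"
      by (rule has_derivative_inner[OF d d])
    moreover have "(\<lambda>h. ?d \<bullet> (h *\<^sub>R ?e) + (h *\<^sub>R ?e) \<bullet> ?d) = (*) (2 * (?d \<bullet> ?e))"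
      by (auto simp: inner_commute)
    ultimately have 1: "((\<lambda>s. (u s - w s) \<bullet> (u s - w s)) has_real_derivative 2 * (?d \<bullet> ?e)) (at s)"
      by (simp add: has_field_derivative_def)
    have 2: "((\<lambda>s. exp (- (2 * L * s))) has_real_derivative exp (- (2 * L * s)) * (- (2 * L))) (at s)"
      by (auto intro!: derivative_eq_intros)
    have "(g has_real_derivative exp (- (2 * L * s)) * (- (2 * L)) * (?d \<bullet> ?d) + 2 * (?d \<bullet> ?e) * exp (- (2 * L * s))) (at s)"
      unfolding g_def by (rule DERIV_mult[OF 2 1])
    moreover have "exp (- (2 * L * s)) * (- (2 * L)) * (?d \<bullet> ?d) + 2 * (?d \<bullet> ?e) * exp (- (2 * L * s)) \<le> 0"
    proof -
      have "?d \<bullet> ?e \<le> norm ?d * norm ?e" by (rule norm_cauchy_schwarz)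
      also have "\<dots> \<le> norm ?d * (L * norm ?d)"
        using lipschitz_onD[OF L, of "u s" "w s"] u[OF s] w[OF s]
        by (intro mult_left_mono) (auto simp: dist_norm)
      also have "\<dots> = L * (?d \<bullet> ?d)" by (simp add: power2_norm_eq_inner[symmetric] power2_eq_square)
      finally have "exp (- (2 * L * s)) * 2 * (?d \<bullet> ?e) \<le> exp (- (2 * L * s)) * 2 * (L * (?d \<bullet> ?d))"
        by (intro mult_left_mono) auto
      then show ?thesis by (simp add: algebra_simps)
    qed
    ultimately show "\<exists>y. (g has_real_derivative y) (at s) \<and> y \<le> 0" by blast
  qed
  then have "exp (- (2 * L * t)) * ((u t - w t) \<bullet> (u t - w t)) \<le> 0" by (simp add: g_def init)
  then have "(u t - w t) \<bullet> (u t - w t) \<le> 0"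
    by (metis exp_gt_zero mult_le_0_iff not_less)
  then have "(u t - w t) \<bullet> (u t - w t) = 0" by (meson antisym inner_ge_zero)
  then show ?thesis by simp
qed

text \<open>Negative times are reduced to positive ones by reversing time and the sign of the field.\<close>

lemma ode_unique:
  fixes X :: "'a::euclidean_space \<Rightarrow> 'a"
  assumes L: "L-lipschitz_on B X" and init: "u 0 = w 0" and t: "t \<in> {-e<..<e}"
    and u: "\<And>s. s \<in> {-e<..<e} \<Longrightarrow> u s \<in> B \<and> (u has_vector_derivative X (u s)) (at s)"
    and w: "\<And>s. s \<in> {-e<..<e} \<Longrightarrow> w s \<in> B \<and> (w has_vector_derivative X (w s)) (at s)"
  shows "u t = w t"
proof (cases "0 \<le> t")
  case True
  with t show ?thesis by (intro ode_unique_forward[where u=u and w=w, OF L init True] u w) auto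
next
  case False
  have L': "L-lipschitz_on B (\<lambda>x. - X x)"
    using L by (auto simp: lipschitz_on_def dist_norm norm_minus_commute)
  have rev: "((\<lambda>s. h (- s)) has_vector_derivative - X (h (- s))) (at s)"
    if "(h has_vector_derivative X (h (- s))) (at (- s))" for h s
  proof -
    have "((h \<circ> uminus) has_vector_derivative (- 1) *\<^sub>R X (h (- s))) (at s)"
      by (rule vector_diff_chain_at) (auto intro!: derivative_eq_intros that)
    then show ?thesis by (simp add: o_def)
  qed
  have "(\<lambda>s. u (- s)) (- t) = (\<lambda>s. w (- s)) (- t)"
    by (rule ode_unique_forward[where u="\<lambda>s. u (- s)" and w="\<lambda>s. w (- s)", OF L']) (use False t u w init in \<open>auto intro!: rev\<close>)
  then show ?thesis by simp
qed

text \<open>A solution inherits the smoothness of the field, since its derivative is the field along it.\<close>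

lemma ode_solution_smooth:
  fixes X :: "'a::euclidean_space \<Rightarrow> 'a"
  assumes "smooth_on X S" "open S" "open I"
    and u: "\<And>t. t \<in> I \<Longrightarrow> u t \<in> S \<and> (u has_vector_derivative X (u t)) (at t)"
  shows "smooth_on u I"
proof -
  have "Ck_on k u I" for k
  proof (induction k)
    case 0
    have "continuous_on I u"
      using u by (intro continuous_at_imp_continuous_on) (blast intro: has_vector_derivative_continuous)
    then show ?case by simp
  next
    case (Suc k)
    show ?case
    proof (rule Ck_on_Suc_derivative[OF assms(3)])
      show "(u has_derivative (\<lambda>h. h *\<^sub>R X (u t))) (at t)" if "t \<in> I" for t
        using u[OF that] by (simp add: has_vector_derivative_def)
      have "Ck_on k (\<lambda>t. X (u t)) I"
        using u assms(1) by (intro Ck_on_compose[OF assms(3,2) _ Suc]) (auto simp: smooth_on_def)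
      then show "Ck_on k (\<lambda>t. v *\<^sub>R X (u t)) I" for v :: real
        by (intro Ck_on_bilinear[OF bounded_bilinear_scaleR] Ck_on_const assms(3))
    qed
  qed
  then show ?thesis by (simp add: smooth_on_def)
qed

section \<open>Smooth functions on manifolds\<close>

lemma chart_simps:
  assumes "is_chart (U, \<phi>)"
  shows "open U" "open (\<phi> ` U)" "continuous_on U \<phi>" "continuous_on (\<phi> ` U) (inv_into U \<phi>)"
    "x \<in> U \<Longrightarrow> inv_into U \<phi> (\<phi> x) = x"
    "y \<in> \<phi> ` U \<Longrightarrow> \<phi> (inv_into U \<phi> y) = y" "y \<in> \<phi> ` U \<Longrightarrow> inv_into U \<phi> y \<in> U"
    "inj_on \<phi> U"
proof -
  have h: "open U" "open (\<phi> ` U)" "homeomorphism U (\<phi> ` U) \<phi> (inv_into U \<phi>)"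
    using assms by (auto simp: is_chart_def)
  show "open U" "open (\<phi> ` U)" by (fact h)+
  show "continuous_on U \<phi>" "continuous_on (\<phi> ` U) (inv_into U \<phi>)"
    "x \<in> U \<Longrightarrow> inv_into U \<phi> (\<phi> x) = x"
    "y \<in> \<phi> ` U \<Longrightarrow> \<phi> (inv_into U \<phi> y) = y" "y \<in> \<phi> ` U \<Longrightarrow> inv_into U \<phi> y \<in> U"
    using h(3) by (auto simp: homeomorphism_def)
  show "inj_on \<phi> U" using h(3) by (metis homeomorphism_apply1 inj_on_inverseI)
qed

lemma open_chart_image:
  assumes "is_chart (U, \<phi>)" "open W" "W \<subseteq> U"
  shows "open (\<phi> ` W)"
proof -
  note c = chart_simps[OF assms(1)]
  have "\<phi> ` W = inv_into U \<phi> -` W \<inter> \<phi> ` U"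
    using assms(3) c(5,6,7) by (auto 0 3 intro: rev_image_eqI)
  then show ?thesis
    using continuous_on_open_vimage[OF c(2), of "inv_into U \<phi>"] c(4) assms(2) by auto
qed

lemma atlas_chart: "smooth_atlas A \<Longrightarrow> (U, \<phi>) \<in> A \<Longrightarrow> is_chart (U, \<phi>)"
  by (auto simp: smooth_atlas_def)

lemma atlas_cover:
  assumes "smooth_atlas A"
  obtains U \<phi> where "(U, \<phi>) \<in> A" "p \<in> U"
proof -
  have "p \<in> (\<Union>c\<in>A. fst c)" using assms by (simp add: smooth_atlas_def)
  then show ?thesis using that by force
qed

lemma atlas_transition:
  assumes "smooth_atlas A" "(U, \<phi>) \<in> A" "(V, \<psi>) \<in> A"
  shows "smooth_on (\<lambda>y. \<psi> (inv_into U \<phi> y)) (\<phi> ` (U \<inter> V))"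
  using assms by (force simp: smooth_atlas_def o_def)

text \<open>Smoothness of a function need only be tested in one chart around each point.\<close>

lemma smooth_functionsI:
  assumes A: "smooth_atlas A"
    and loc: "\<And>p. \<exists>U \<phi> W. (U, \<phi>) \<in> A \<and> open W \<and> p \<in> W \<and> W \<subseteq> U \<and> smooth_on (\<lambda>y. f (inv_into U \<phi> y)) (\<phi> ` W)"
  shows "f \<in> smooth_functions A"
proof -
  have "continuous (at p) f" for p
  proof -
    obtain U \<phi> W where W: "(U, \<phi>) \<in> A" "open W" "p \<in> W" "W \<subseteq> U" "smooth_on (\<lambda>y. f (inv_into U \<phi> y)) (\<phi> ` W)"
      using loc by blast
    note c = chart_simps[OF atlas_chart[OF A W(1)]]
    have "continuous_on W (\<lambda>x. f (inv_into U \<phi> (\<phi> x)))"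
      by (rule continuous_on_compose2[OF smooth_on_continuous[OF W(5)]])
        (use continuous_on_subset[OF c(3) W(4)] in auto)
    then have "continuous_on W f"
      by (rule continuous_on_eq) (use c(5) W(4) in auto)
    then show ?thesis using W(2,3) continuous_on_eq_continuous_at by blast
  qed
  moreover have "smooth_on (\<lambda>y. f (inv_into V \<psi> y)) (\<psi> ` V)" if V: "(V, \<psi>) \<in> A" for V \<psi>
  proof (rule smooth_on_local)
    fix y assume y: "y \<in> \<psi> ` V"
    note cV = chart_simps[OF atlas_chart[OF A V]]
    obtain U \<phi> W where W: "(U, \<phi>) \<in> A" "open W" "inv_into V \<psi> y \<in> W" "W \<subseteq> U"
      "smooth_on (\<lambda>y. f (inv_into U \<phi> y)) (\<phi> ` W)"
      using loc by blast
    note cU = chart_simps[OF atlas_chart[OF A W(1)]]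
    have o: "open (\<psi> ` (V \<inter> W))"
      using open_chart_image[OF atlas_chart[OF A V]] cV(1) W(2) by auto
    have "smooth_on (\<lambda>z. f (inv_into U \<phi> (\<phi> (inv_into V \<psi> z)))) (\<psi> ` (V \<inter> W))"
    proof (rule smooth_on_compose[OF o open_chart_image[OF atlas_chart[OF A W(1)] W(2,4)] _ _ W(5)])
      show "smooth_on (\<lambda>z. \<phi> (inv_into V \<psi> z)) (\<psi> ` (V \<inter> W))"
        by (rule smooth_on_subset[OF atlas_transition[OF A V W(1)]]) (use W(4) in auto)
    qed (use cV(5) in auto)
    then have "smooth_on (\<lambda>z. f (inv_into V \<psi> z)) (\<psi> ` (V \<inter> W))"
      by (rule smooth_on_cong[OF o, rotated]) (use cU(5) cV(5) W(4) in auto)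
    moreover have "y \<in> \<psi> ` (V \<inter> W)" using y W(3) cV(6,7) by (metis IntI image_eqI)
    ultimately show "\<exists>T. open T \<and> y \<in> T \<and> smooth_on (\<lambda>y. f (inv_into V \<psi> y)) T" using o by blast
  qed
  ultimately show ?thesis
    by (auto simp: smooth_functions_def smooth_map_def euclidean_atlas_def o_def
        continuous_at_imp_continuous_on)
qed

lemma smooth_functions_chart:
  assumes "f \<in> smooth_functions A" "(U, \<phi>) \<in> A"
  shows "smooth_on (\<lambda>y. f (inv_into U \<phi> y)) (\<phi> ` U)"
  using assms by (auto simp: smooth_functions_def smooth_map_def euclidean_atlas_def o_def)

lemma smooth_functionsI_charts:
  assumes A: "smooth_atlas A"
    and "\<And>U \<phi>. (U, \<phi>) \<in> A \<Longrightarrow> smooth_on (\<lambda>y. f (inv_into U \<phi> y)) (\<phi> ` U)"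
  shows "f \<in> smooth_functions A"
proof (rule smooth_functionsI[OF A])
  fix p
  obtain U \<phi> where U: "(U, \<phi>) \<in> A" "p \<in> U" using atlas_cover[OF A] .
  then show "\<exists>U \<phi> W. (U, \<phi>) \<in> A \<and> open W \<and> p \<in> W \<and> W \<subseteq> U \<and> smooth_on (\<lambda>y. f (inv_into U \<phi> y)) (\<phi> ` W)"
    using chart_simps(1)[OF atlas_chart[OF A U(1)]] assms(2)[OF U(1)] by blast
qed

lemma smooth_functions_const: "smooth_atlas A \<Longrightarrow> (\<lambda>x. c) \<in> smooth_functions A"
  by (rule smooth_functionsI_charts) (auto intro: smooth_on_const)

lemma smooth_functions_add:
  "smooth_atlas A \<Longrightarrow> f \<in> smooth_functions A \<Longrightarrow> g \<in> smooth_functions A \<Longrightarrow> (\<lambda>x. f x + g x) \<in> smooth_functions A"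
  by (rule smooth_functionsI_charts, assumption)
    (rule smooth_on_add; blast intro: smooth_functions_chart chart_simps(2) atlas_chart)

lemma smooth_functions_mult:
  "smooth_atlas A \<Longrightarrow> f \<in> smooth_functions A \<Longrightarrow> g \<in> smooth_functions A \<Longrightarrow> (\<lambda>x. f x * g x) \<in> smooth_functions A"
  by (rule smooth_functionsI_charts, assumption)
    (rule smooth_on_mult; blast intro: smooth_functions_chart chart_simps(2) atlas_chart)

lemma smooth_functions_cmult:
  "smooth_atlas A \<Longrightarrow> f \<in> smooth_functions A \<Longrightarrow> (\<lambda>x. c * f x) \<in> smooth_functions A"
  using smooth_functions_mult[OF _ smooth_functions_const] by blast

lemma smooth_functions_minus:
  "smooth_atlas A \<Longrightarrow> f \<in> smooth_functions A \<Longrightarrow> (\<lambda>x. - f x) \<in> smooth_functions A"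
  using smooth_functions_cmult[of A f "- 1"] by simp

lemma smooth_functions_diff:
  "smooth_atlas A \<Longrightarrow> f \<in> smooth_functions A \<Longrightarrow> g \<in> smooth_functions A \<Longrightarrow> (\<lambda>x. f x - g x) \<in> smooth_functions A"
  using smooth_functions_add[OF _ _ smooth_functions_minus] by fastforce

lemma smooth_functions_sum:
  "smooth_atlas A \<Longrightarrow> finite I \<Longrightarrow> (\<And>i. i \<in> I \<Longrightarrow> f i \<in> smooth_functions A) \<Longrightarrow>
    (\<lambda>x. \<Sum>i\<in>I. f i x) \<in> smooth_functions A"
  by (induction I rule: infinite_finite_induct)
    (auto intro: smooth_functions_const smooth_functions_add)

text \<open>Every germ of a smooth function in a chart is the germ of a global one. The extension by zero
  is continuous because the support of the cutoff is compact in the chart domain, hence closed in the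
  Hausdorff space.\<close>

lemma smooth_extension:
  fixes A :: "('m::{t2_space,second_countable_topology}, 'e::euclidean_space) chart set"
    and F :: "'e \<Rightarrow> real"
  assumes A: "smooth_atlas A" and U: "(U, \<phi>) \<in> A" "p \<in> U"
    and F: "smooth_on F S" "open S" "\<phi> p \<in> S"
  obtains f W where "f \<in> smooth_functions A" "open W" "p \<in> W" "W \<subseteq> U"
    "\<And>x. x \<in> W \<Longrightarrow> f x = F (\<phi> x)" "\<And>x. f x \<noteq> 0 \<Longrightarrow> x \<in> U \<and> \<phi> x \<in> S"
proof -
  note c = chart_simps[OF atlas_chart[OF A U(1)]]
  have "open (S \<inter> \<phi> ` U)" "\<phi> p \<in> S \<inter> \<phi> ` U" using F U c(2) by auto
  then obtain r where r: "0 < r" "cball (\<phi> p) r \<subseteq> S \<inter> \<phi> ` U"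
    using open_contains_cball by blast
  obtain \<theta> :: "'e \<Rightarrow> real" where \<theta>: "smooth_on \<theta> UNIV"
    "\<And>x. x \<in> ball (\<phi> p) (r / 2) \<Longrightarrow> \<theta> x = 1" "\<And>x. x \<notin> ball (\<phi> p) r \<Longrightarrow> \<theta> x = 0"
    using smooth_cutoff[OF r(1)] by blast
  define f where "f = (\<lambda>x. if x \<in> U then \<theta> (\<phi> x) * F (\<phi> x) else 0)"
  define K where "K = inv_into U \<phi> ` cball (\<phi> p) r"
  have "compact K" unfolding K_def
    using r(2) by (intro compact_continuous_image compact_cball continuous_on_subset[OF c(4)]) auto
  then have K: "closed K" by (rule compact_imp_closed)
  have KU: "K \<subseteq> U" using r(2) c(7) by (auto simp: K_def)
  have f0: "f x = 0" if "x \<notin> K" for x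
  proof (cases "x \<in> U")
    case True
    have "\<phi> x \<notin> cball (\<phi> p) r" using that c(5)[OF True] by (auto simp: K_def intro: rev_image_eqI)
    then have "\<theta> (\<phi> x) = 0" by (intro \<theta>(3)) auto
    then show ?thesis by (simp add: f_def)
  qed (simp add: f_def)
  have "f \<in> smooth_functions A"
  proof (rule smooth_functionsI[OF A])
    fix q
    show "\<exists>V \<psi> W. (V, \<psi>) \<in> A \<and> open W \<and> q \<in> W \<and> W \<subseteq> V \<and> smooth_on (\<lambda>y. f (inv_into V \<psi> y)) (\<psi> ` W)"
    proof (cases "q \<in> K")
      case True
      define W where "W = U \<inter> \<phi> -` S"
      have W: "open W" unfolding W_def using continuous_open_preimage[OF c(3,1) F(2)] by simp
      obtain y where y: "y \<in> cball (\<phi> p) r" "q = inv_into U \<phi> y" using True by (auto simp: K_def)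
      then have "y \<in> S" "y \<in> \<phi> ` U" using r(2) by blast+
      then have "q \<in> W" using c(6,7)[of y] y(2) by (simp add: W_def)
      have o: "open (\<phi> ` W)" by (rule open_chart_image[OF atlas_chart[OF A U(1)] W]) (auto simp: W_def)
      have "smooth_on (\<lambda>y. \<theta> y * F y) (\<phi> ` W)"
        by (intro smooth_on_mult o smooth_on_subset[OF \<theta>(1)] smooth_on_subset[OF F(1)]) (auto simp: W_def)
      then have "smooth_on (\<lambda>y. f (inv_into U \<phi> y)) (\<phi> ` W)"
        by (rule smooth_on_cong[OF o, rotated]) (use c(5) in \<open>auto simp: f_def W_def\<close>)
      with \<open>q \<in> W\<close> W U(1) show ?thesis by (auto simp: W_def)
    next
      case False
      obtain V \<psi> where V: "(V, \<psi>) \<in> A" "q \<in> V" using atlas_cover[OF A] .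
      note cV = chart_simps[OF atlas_chart[OF A V(1)]]
      have W: "open (V - K)" using cV(1) K by auto
      have o: "open (\<psi> ` (V - K))" by (rule open_chart_image[OF atlas_chart[OF A V(1)] W]) auto
      have "smooth_on (\<lambda>y. f (inv_into V \<psi> y)) (\<psi> ` (V - K))"
        by (rule smooth_on_cong[OF o _ smooth_on_const[of 0]]) (use cV(5) f0 in auto)
      with W V False show ?thesis by blast
    qed
  qed
  moreover have "open (U \<inter> \<phi> -` ball (\<phi> p) (r / 2))"
    using continuous_open_preimage[OF c(3,1) open_ball] by simp
  ultimately show ?thesis
  proof (rule that)
    show "x \<in> U \<and> \<phi> x \<in> S" if "f x \<noteq> 0" for x
    proof -
      have "x \<in> U" "\<phi> x \<in> ball (\<phi> p) r" using that \<theta>(3) by (auto simp: f_def split: if_splits)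
      then show ?thesis using r(2) by auto
    qed
  qed (use r(1) U(2) \<theta>(2) in \<open>auto simp: f_def\<close>)
qed

section \<open>Tangent vectors\<close>

lemma tangent_linear:
  "v \<in> tangent_space A p \<Longrightarrow> f \<in> smooth_functions A \<Longrightarrow> g \<in> smooth_functions A \<Longrightarrow>
    v (\<lambda>x. c * f x + g x) = c * v f + v g"
  by (simp add: tangent_space_def)

lemma tangent_mult:
  "v \<in> tangent_space A p \<Longrightarrow> f \<in> smooth_functions A \<Longrightarrow> g \<in> smooth_functions A \<Longrightarrow>
    v (\<lambda>x. f x * g x) = f p * v g + g p * v f"
  by (simp add: tangent_space_def)

lemma tangent_not_smooth: "v \<in> tangent_space A p \<Longrightarrow> f \<notin> smooth_functions A \<Longrightarrow> v f = 0"
  by (simp add: tangent_space_def)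

lemma tangent_add:
  "v \<in> tangent_space A p \<Longrightarrow> f \<in> smooth_functions A \<Longrightarrow> g \<in> smooth_functions A \<Longrightarrow>
    v (\<lambda>x. f x + g x) = v f + v g"
  using tangent_linear[of v A p f g 1] by simp

lemma tangent_zero: "smooth_atlas A \<Longrightarrow> v \<in> tangent_space A p \<Longrightarrow> v (\<lambda>x. 0) = 0"
  using tangent_add[of v A p "\<lambda>x. 0" "\<lambda>x. 0"] smooth_functions_const[of A 0] by simp

lemma tangent_cmult:
  "smooth_atlas A \<Longrightarrow> v \<in> tangent_space A p \<Longrightarrow> f \<in> smooth_functions A \<Longrightarrow> v (\<lambda>x. c * f x) = c * v f"
  using tangent_linear[of v A p f "\<lambda>x. 0" c] smooth_functions_const[of A 0] tangent_zero[of A v p] by simp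

lemma tangent_diff:
  assumes "smooth_atlas A" "v \<in> tangent_space A p" "f \<in> smooth_functions A" "g \<in> smooth_functions A"
  shows "v (\<lambda>x. f x - g x) = v f - v g"
  using tangent_linear[OF assms(2,4,3), of "- 1"] by simp

lemma tangent_const:
  assumes "smooth_atlas A" "v \<in> tangent_space A p" shows "v (\<lambda>x. c) = 0"
proof -
  have "v (\<lambda>x. 1 * 1) = 1 * v (\<lambda>x. 1) + 1 * v (\<lambda>x. 1)"
    by (rule tangent_mult[OF assms(2)]) (rule smooth_functions_const[OF assms(1)])+
  then have "v (\<lambda>x. 1) = 0" by simp
  then show ?thesis
    using tangent_cmult[OF assms smooth_functions_const[OF assms(1), of 1], of c] by simp
qed

lemma tangent_sum:
  assumes "smooth_atlas A" "v \<in> tangent_space A p" "\<And>i. i \<in> I \<Longrightarrow> f i \<in> smooth_functions A" "finite I"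
  shows "v (\<lambda>x. \<Sum>i\<in>I. f i x) = (\<Sum>i\<in>I. v (f i))"
  using assms(4,3)
proof (induction I)
  case empty
  then show ?case using tangent_zero[OF assms(1,2)] by simp
next
  case (insert i I)
  then show ?case
    using tangent_add[OF assms(2), of "f i" "\<lambda>x. \<Sum>i\<in>I. f i x"]
      smooth_functions_sum[OF assms(1), of I f] by simp
qed

text \<open>Multiply \<open>f - g\<close> by a function that equals 1 at \<open>p\<close> and vanishes off \<open>W\<close>. The product is zero, and by
  the product rule \<open>v\<close> maps it to \<open>v f - v g\<close>.\<close>

lemma tangent_local:
  fixes A :: "('m::{t2_space,second_countable_topology}, 'e::euclidean_space) chart set"
  assumes A: "smooth_atlas A" and v: "v \<in> tangent_space A p"
    and fg: "f \<in> smooth_functions A" "g \<in> smooth_functions A"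
    and W: "open W" "p \<in> W" "\<And>x. x \<in> W \<Longrightarrow> f x = g x"
  shows "v f = v g"
proof -
  obtain U \<phi> where U: "(U, \<phi>) \<in> A" "p \<in> U" using atlas_cover[OF A] .
  note c = chart_simps[OF atlas_chart[OF A U(1)]]
  define S where "S = \<phi> ` (U \<inter> W)"
  have S: "open S" unfolding S_def
    by (rule open_chart_image[OF atlas_chart[OF A U(1)]]) (use c(1) W(1) in auto)
  have "\<phi> p \<in> S" using U(2) W(2) by (auto simp: S_def)
  then obtain b W' where b: "b \<in> smooth_functions A" "p \<in> W'" "\<And>x. x \<in> W' \<Longrightarrow> b x = 1"
    "\<And>x. b x \<noteq> 0 \<Longrightarrow> x \<in> U \<and> \<phi> x \<in> S"
    using smooth_extension[OF A U smooth_on_const[of 1 S] S] by metis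
  have bW: "b x = 0" if "x \<notin> W" for x
    using b(4)[of x] that inj_onD[OF c(8)] unfolding S_def by blast
  define h where "h = (\<lambda>x. f x - g x)"
  have h: "h \<in> smooth_functions A" unfolding h_def by (intro smooth_functions_diff A fg)
  have "b x * h x = 0" for x using bW[of x] W(3)[of x] by (cases "x \<in> W") (auto simp: h_def)
  then have "0 = v (\<lambda>x. b x * h x)" using tangent_zero[OF A v] by (simp only:)
  also have "\<dots> = v h"
    using tangent_mult[OF v b(1) h] b(2,3) W(2,3) by (simp add: h_def)
  also have "\<dots> = v f - v g" unfolding h_def by (rule tangent_diff[OF A v fg])
  finally show ?thesis by simp
qed

definition chart_derivative ::
  "'m set \<Rightarrow> ('m \<Rightarrow> 'e::euclidean_space) \<Rightarrow> 'm \<Rightarrow> 'e \<Rightarrow> ('m \<Rightarrow> real) \<Rightarrow> real" where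
  "chart_derivative U \<phi> p w f = frechet_derivative (\<lambda>y. f (inv_into U \<phi> y)) (at (\<phi> p)) w"

lemma chart_derivative:
  assumes "smooth_atlas A" "(U, \<phi>) \<in> A" "p \<in> U" "f \<in> smooth_functions A"
  shows "((\<lambda>y. f (inv_into U \<phi> y)) has_derivative (\<lambda>w. chart_derivative U \<phi> p w f)) (at (\<phi> p))"
  unfolding chart_derivative_def
  by (rule smooth_on_has_derivative[OF smooth_functions_chart[OF assms(4,2)]]) (use assms(3) in auto)

lemma chart_derivative_germ:
  assumes A: "smooth_atlas A" "(U, \<phi>) \<in> A" "p \<in> U" and W: "open W" "p \<in> W" "W \<subseteq> U"
    and fF: "\<And>x. x \<in> W \<Longrightarrow> f x = F (\<phi> x)" and F: "(F has_derivative D) (at (\<phi> p))"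
  shows "chart_derivative U \<phi> p w f = D w"
proof -
  note c = chart_simps[OF atlas_chart[OF A(1,2)]]
  have o: "open (\<phi> ` W)" by (rule open_chart_image[OF atlas_chart[OF A(1,2)] W(1,3)])
  have "((\<lambda>y. f (inv_into U \<phi> y)) has_derivative D) (at (\<phi> p))"
    by (rule has_derivative_transform_within_open[OF F o]) (use W fF c(5) in auto)
  then show ?thesis unfolding chart_derivative_def using frechet_derivative_at by metis
qed

text \<open>By Hadamard's lemma a smooth function agrees near \<open>p\<close> with a constant plus a combination of
  products of coordinates vanishing at \<open>p\<close> with smooth functions whose values at \<open>p\<close> are the partial
  derivatives; a derivation therefore only sees the partial derivatives.\<close>

lemma tangent_space_chart_derivative:
  fixes A :: "('m::{t2_space,second_countable_topology}, 'e::euclidean_space) chart set"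
  assumes A: "smooth_atlas A" and v: "v \<in> tangent_space A p" and U: "(U, \<phi>) \<in> A" "p \<in> U"
  obtains w where "\<And>f. f \<in> smooth_functions A \<Longrightarrow> v f = chart_derivative U \<phi> p w f"
proof -
  note c = chart_simps[OF atlas_chart[OF A U(1)]]
  obtain r where r: "0 < r" "ball (\<phi> p) r \<subseteq> \<phi> ` U"
    using c(2) U(2) open_contains_ball by blast
  have "\<exists>f W. f \<in> smooth_functions A \<and> open W \<and> p \<in> W \<and> W \<subseteq> U \<and> (\<forall>x\<in>W. f x = F (\<phi> x))"
    if "smooth_on F (ball (\<phi> p) r)" for F
    using smooth_extension[OF A U that open_ball] r(1) by (metis centre_in_ball)
  then obtain E N where E: "\<And>F. smooth_on F (ball (\<phi> p) r) \<Longrightarrow>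
      E F \<in> smooth_functions A \<and> open (N F) \<and> p \<in> N F \<and> N F \<subseteq> U \<and> (\<forall>x\<in>N F. E F x = F (\<phi> x))"
    by metis
  define \<xi> where "\<xi> = (\<lambda>b y. (y - \<phi> p) \<bullet> b)"
  have \<xi>: "smooth_on (\<xi> b) (ball (\<phi> p) r)" for b unfolding \<xi>_def
    by (intro smooth_on_inner smooth_on_diff smooth_on_id smooth_on_const open_ball)
  define w where "w = (\<Sum>b\<in>Basis. v (E (\<xi> b)) *\<^sub>R b)"
  show ?thesis
  proof (rule that)
    fix f assume f: "f \<in> smooth_functions A"
    have fr: "smooth_on (\<lambda>y. f (inv_into U \<phi> y)) (ball (\<phi> p) r)"
      by (rule smooth_on_subset[OF smooth_functions_chart[OF f U(1)] r(2)])
    obtain g where g: "\<And>b. smooth_on (g b) (ball (\<phi> p) r)"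
      "\<And>b. g b (\<phi> p) = frechet_derivative (\<lambda>y. f (inv_into U \<phi> y)) (at (\<phi> p)) b"
      "\<And>x. x \<in> ball (\<phi> p) r \<Longrightarrow> f (inv_into U \<phi> x) = f (inv_into U \<phi> (\<phi> p)) + (\<Sum>b\<in>Basis. ((x - \<phi> p) \<bullet> b) * g b x)"
      by (rule hadamard[OF fr r(1)]) (rule that)
    define h where "h = (\<lambda>x. \<Sum>b\<in>Basis. E (\<xi> b) x * E (g b) x)"
    have Eh: "(\<lambda>x. E (\<xi> b) x * E (g b) x) \<in> smooth_functions A" for b
      using E[OF \<xi>] E[OF g(1)] by (intro smooth_functions_mult A) auto
    have h: "h \<in> smooth_functions A"
      unfolding h_def by (rule smooth_functions_sum[OF A finite_Basis Eh])
    define W where "W = (\<Inter>b\<in>Basis. N (\<xi> b) \<inter> N (g b)) \<inter> (U \<inter> \<phi> -` ball (\<phi> p) r)"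
    have "open (U \<inter> \<phi> -` ball (\<phi> p) r)" using continuous_open_preimage[OF c(3,1) open_ball] .
    moreover have "open (\<Inter>b\<in>Basis. N (\<xi> b) \<inter> N (g b))"
      using E[OF \<xi>] E[OF g(1)] by (intro open_INT) auto
    ultimately have W: "open W" unfolding W_def by blast
    have pW: "p \<in> W" unfolding W_def using E[OF \<xi>] E[OF g(1)] U(2) r(1) by auto
    have "v f = v (\<lambda>x. f p + h x)"
    proof (rule tangent_local[OF A v f _ W pW])
      show "(\<lambda>x. f p + h x) \<in> smooth_functions A"
        by (intro smooth_functions_add A smooth_functions_const h)
      fix x assume x: "x \<in> W"
      then have "x \<in> U" "\<phi> x \<in> ball (\<phi> p) r" by (auto simp: W_def)
      then have "f x = f p + (\<Sum>b\<in>Basis. \<xi> b (\<phi> x) * g b (\<phi> x))"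
        using g(3)[of "\<phi> x"] c(5) U(2) by (simp add: \<xi>_def)
      also have "(\<Sum>b\<in>Basis. \<xi> b (\<phi> x) * g b (\<phi> x)) = h x"
        unfolding h_def using x E[OF \<xi>] E[OF g(1)] by (intro sum.cong) (auto simp: W_def)
      finally show "f x = f p + h x" .
    qed
    also have "\<dots> = v h"
      using tangent_add[OF v smooth_functions_const[OF A] h] tangent_const[OF A v] by simp
    also have "\<dots> = (\<Sum>b\<in>Basis. v (\<lambda>x. E (\<xi> b) x * E (g b) x))"
      unfolding h_def by (rule tangent_sum[OF A v Eh finite_Basis])
    also have "\<dots> = (\<Sum>b\<in>Basis. v (E (\<xi> b)) * chart_derivative U \<phi> p b f)"
    proof (rule sum.cong[OF refl])
      fix b :: 'e
      have "E (\<xi> b) p = 0" using E[OF \<xi>] by (auto simp: \<xi>_def)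
      moreover have "E (g b) p = chart_derivative U \<phi> p b f"
        using E[OF g(1)] g(2) by (simp add: chart_derivative_def)
      ultimately show "v (\<lambda>x. E (\<xi> b) x * E (g b) x) = v (E (\<xi> b)) * chart_derivative U \<phi> p b f"
        using tangent_mult[OF v, of "E (\<xi> b)" "E (g b)"] E[OF \<xi>] E[OF g(1)] by simp
    qed
    also have "\<dots> = chart_derivative U \<phi> p w f"
      unfolding w_def
      by (simp add: linear_sum[OF has_derivative_linear[OF chart_derivative[OF A U f]]]
          linear_cmul[OF has_derivative_linear[OF chart_derivative[OF A U f]]])
    finally show "v f = chart_derivative U \<phi> p w f" .
  qed
qed

lemma chart_derivative_in_tangent_space:
  assumes A: "smooth_atlas A" and U: "(U, \<phi>) \<in> A" "p \<in> U"
  shows "on_smooth A (chart_derivative U \<phi> p w) \<in> tangent_space A p"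
proof -
  note c = chart_simps[OF atlas_chart[OF A U(1)]]
  have lin: "chart_derivative U \<phi> p w (\<lambda>x. k * f x + g x) = k * chart_derivative U \<phi> p w f + chart_derivative U \<phi> p w g"
    if fg: "f \<in> smooth_functions A" "g \<in> smooth_functions A" for f g k
  proof -
    have "((\<lambda>y. k * f (inv_into U \<phi> y) + g (inv_into U \<phi> y)) has_derivative
        (\<lambda>w. k * chart_derivative U \<phi> p w f + chart_derivative U \<phi> p w g)) (at (\<phi> p))"
      by (intro has_derivative_add has_derivative_mult_right chart_derivative[OF A U] fg)
    from fun_cong[OF frechet_derivative_at[OF this], of w] show ?thesis
      by (simp add: chart_derivative_def)
  qed
  have prod: "chart_derivative U \<phi> p w (\<lambda>x. f x * g x) = f p * chart_derivative U \<phi> p w g + g p * chart_derivative U \<phi> p w f"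
    if fg: "f \<in> smooth_functions A" "g \<in> smooth_functions A" for f g
  proof -
    have "((\<lambda>y. f (inv_into U \<phi> y) * g (inv_into U \<phi> y)) has_derivative
        (\<lambda>w. f (inv_into U \<phi> (\<phi> p)) * chart_derivative U \<phi> p w g + chart_derivative U \<phi> p w f * g (inv_into U \<phi> (\<phi> p)))) (at (\<phi> p))"
      by (intro has_derivative_mult chart_derivative[OF A U] fg)
    from fun_cong[OF frechet_derivative_at[OF this], of w] show ?thesis
      using c(5)[OF U(2)] by (simp add: chart_derivative_def mult.commute)
  qed
  show ?thesis
    by (simp add: tangent_space_def on_smooth_def lin prod smooth_functions_add smooth_functions_cmult
        smooth_functions_mult A)
qed

text \<open>Components are recovered by testing on extensions of the coordinates.\<close>

lemma chart_derivative_injective: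
  fixes A :: "('m::{t2_space,second_countable_topology}, 'e::euclidean_space) chart set"
  assumes A: "smooth_atlas A" and U: "(U, \<phi>) \<in> A" "p \<in> U"
    and eq: "\<And>f. f \<in> smooth_functions A \<Longrightarrow> chart_derivative U \<phi> p w f = chart_derivative U \<phi> p w' f"
  shows "w = w'"
proof (rule euclidean_eqI)
  fix b :: 'e
  have "smooth_on (\<lambda>y. y \<bullet> b) UNIV"
    by (intro smooth_on_inner smooth_on_id smooth_on_const open_UNIV)
  from smooth_extension[OF A U this open_UNIV UNIV_I]
  obtain f W where f: "f \<in> smooth_functions A" "open W" "p \<in> W" "W \<subseteq> U" "\<And>x. x \<in> W \<Longrightarrow> f x = \<phi> x \<bullet> b"
    by metis
  have "((\<lambda>y. y \<bullet> b) has_derivative (\<lambda>w. w \<bullet> b)) (at (\<phi> p))"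
    by (auto intro!: derivative_eq_intros)
  from chart_derivative_germ[OF A U f(2,3,4) f(5) this] eq[OF f(1)]
  show "w \<bullet> b = w' \<bullet> b" by simp
qed

section \<open>Products of manifolds\<close>

lemma inv_into_map_prod:
  assumes "is_chart (U, \<phi>)" "is_chart (V, \<psi>)" "y \<in> \<phi> ` U" "z \<in> \<psi> ` V"
  shows "inv_into (U \<times> V) (map_prod \<phi> \<psi>) (y, z) = (inv_into U \<phi> y, inv_into V \<psi> z)"
proof (rule inv_into_f_eq)
  show "inj_on (map_prod \<phi> \<psi>) (U \<times> V)"
    using chart_simps(8)[OF assms(1)] chart_simps(8)[OF assms(2)] by (rule map_prod_inj_on)
  show "(inv_into U \<phi> y, inv_into V \<psi> z) \<in> U \<times> V"
    using chart_simps(7)[OF assms(1,3)] chart_simps(7)[OF assms(2,4)] by simp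
  show "map_prod \<phi> \<psi> (inv_into U \<phi> y, inv_into V \<psi> z) = (y, z)"
    using chart_simps(6)[OF assms(1,3)] chart_simps(6)[OF assms(2,4)] by simp
qed

lemma is_chart_prod:
  assumes U: "is_chart (U, \<phi>)" and V: "is_chart (V, \<psi>)"
  shows "is_chart (U \<times> V, map_prod \<phi> \<psi>)"
proof -
  note cU = chart_simps[OF U] and cV = chart_simps[OF V]
  have im: "map_prod \<phi> \<psi> ` (U \<times> V) = \<phi> ` U \<times> \<psi> ` V" by (rule map_prod_surj_on) auto
  have "continuous_on (U \<times> V) (\<lambda>x. (\<phi> (fst x), \<psi> (snd x)))"
    by (intro continuous_on_Pair continuous_on_compose2[OF cU(3)] continuous_on_compose2[OF cV(3)])
      (auto intro: continuous_intros)
  then have 1: "continuous_on (U \<times> V) (map_prod \<phi> \<psi>)"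
    by (rule continuous_on_eq) auto
  have "continuous_on (\<phi> ` U \<times> \<psi> ` V) (\<lambda>x. (inv_into U \<phi> (fst x), inv_into V \<psi> (snd x)))"
    by (intro continuous_on_Pair continuous_on_compose2[OF cU(4)] continuous_on_compose2[OF cV(4)])
      (auto intro: continuous_intros)
  then have 2: "continuous_on (\<phi> ` U \<times> \<psi> ` V) (inv_into (U \<times> V) (map_prod \<phi> \<psi>))"
    by (rule continuous_on_eq) (auto simp: inv_into_map_prod[OF U V])
  have "homeomorphism (U \<times> V) (\<phi> ` U \<times> \<psi> ` V) (map_prod \<phi> \<psi>) (inv_into (U \<times> V) (map_prod \<phi> \<psi>))"
    by (rule homeomorphismI[OF 1 2]) (use cU cV in \<open>auto simp: inv_into_map_prod[OF U V]\<close>)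
  then show ?thesis
    unfolding is_chart_def using cU(1,2) cV(1,2) by (simp add: im open_Times)
qed

lemma smooth_atlas_prod:
  assumes A: "smooth_atlas A" and B: "smooth_atlas B"
  shows "smooth_atlas (prod_atlas A B)"
  unfolding smooth_atlas_def
proof (intro conjI)
  show "\<forall>c\<in>prod_atlas A B. is_chart c"
    unfolding prod_atlas_def using is_chart_prod[OF atlas_chart[OF A] atlas_chart[OF B]] by blast
  have "\<exists>c\<in>prod_atlas A B. x \<in> fst c" for x
  proof -
    obtain U \<phi> where "(U, \<phi>) \<in> A" "fst x \<in> U" using atlas_cover[OF A] .
    moreover obtain V \<psi> where "(V, \<psi>) \<in> B" "snd x \<in> V" using atlas_cover[OF B] .
    ultimately have "(U \<times> V, map_prod \<phi> \<psi>) \<in> prod_atlas A B" "x \<in> U \<times> V"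
      by (auto simp: prod_atlas_def mem_Times_iff)
    then show ?thesis by force
  qed
  then show "(\<Union>c\<in>prod_atlas A B. fst c) = UNIV" by blast
  have "smooth_on (map_prod \<phi>' \<psi>' \<circ> inv_into (U \<times> V) (map_prod \<phi> \<psi>)) (map_prod \<phi> \<psi> ` ((U \<times> V) \<inter> (U' \<times> V')))"
    if "(U, \<phi>) \<in> A" "(V, \<psi>) \<in> B" "(U', \<phi>') \<in> A" "(V', \<psi>') \<in> B" for U \<phi> V \<psi> U' \<phi>' V' \<psi>'
  proof -
    note U = atlas_chart[OF A that(1)] and V = atlas_chart[OF B that(2)]
    note U' = atlas_chart[OF A that(3)] and V' = atlas_chart[OF B that(4)]
    let ?S = "\<phi> ` (U \<inter> U')" and ?T = "\<psi> ` (V \<inter> V')"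
    have im: "map_prod \<phi> \<psi> ` ((U \<times> V) \<inter> (U' \<times> V')) = ?S \<times> ?T" by (auto simp: image_iff)
    have oS: "open ?S" using U chart_simps(1)[OF U] chart_simps(1)[OF U'] by (intro open_chart_image[OF U]) auto
    have oT: "open ?T" using V chart_simps(1)[OF V] chart_simps(1)[OF V'] by (intro open_chart_image[OF V]) auto
    have o: "open (?S \<times> ?T)" using oS oT by (rule open_Times)
    have "smooth_on (\<lambda>x. \<phi>' (inv_into U \<phi> (fst x))) (?S \<times> ?T)"
      by (rule smooth_on_compose[OF o oS _ smooth_on_bounded_linear[OF o bounded_linear_fst] atlas_transition[OF A that(1,3)]]) auto
    moreover have "smooth_on (\<lambda>x. \<psi>' (inv_into V \<psi> (snd x))) (?S \<times> ?T)"
      by (rule smooth_on_compose[OF o oT _ smooth_on_bounded_linear[OF o bounded_linear_snd] atlas_transition[OF B that(2,4)]]) auto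
    ultimately have "smooth_on (\<lambda>x. (\<phi>' (inv_into U \<phi> (fst x)), \<psi>' (inv_into V \<psi> (snd x)))) (?S \<times> ?T)"
      by (rule smooth_on_Pair[OF o])
    then show ?thesis unfolding im
      by (rule smooth_on_cong[OF o, rotated]) (use inv_into_map_prod[OF U V] in \<open>auto simp: o_def\<close>)
  qed
  then show "\<forall>(U, \<phi>)\<in>prod_atlas A B. \<forall>(V, \<psi>)\<in>prod_atlas A B.
      smooth_on (\<psi> \<circ> inv_into U \<phi>) (\<phi> ` (U \<inter> V))"
    by (auto simp: prod_atlas_def)
qed

lemma smooth_atlas_euclidean: "smooth_atlas (euclidean_atlas :: ('e::euclidean_space, 'e) chart set)"
  by (auto simp: smooth_atlas_def euclidean_atlas_def is_chart_def o_def smooth_on_id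
      homeomorphism_def)

lemma smooth_functions_euclidean:
  "f \<in> smooth_functions (euclidean_atlas :: ('e::euclidean_space, 'e) chart set) \<longleftrightarrow> smooth_on f UNIV"
  by (auto simp: smooth_functions_def smooth_map_def euclidean_atlas_def o_def smooth_on_continuous)

lemma smooth_functions_compose:
  assumes A: "smooth_atlas A" and B: "smooth_atlas B" and F: "smooth_map A B F" and f: "f \<in> smooth_functions B"
  shows "(\<lambda>x. f (F x)) \<in> smooth_functions A"
proof (rule smooth_functionsI[OF A])
  fix p
  obtain U \<phi> where U: "(U, \<phi>) \<in> A" "p \<in> U" using atlas_cover[OF A] .
  obtain V \<psi> where V: "(V, \<psi>) \<in> B" "F p \<in> V" using atlas_cover[OF B] .
  note cU = chart_simps[OF atlas_chart[OF A U(1)]] and cV = chart_simps[OF atlas_chart[OF B V(1)]]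
  have W: "open (U \<inter> F -` V)"
    using F cU(1) cV(1) by (auto simp: smooth_map_def intro: open_vimage)
  have o: "open (\<phi> ` (U \<inter> F -` V))" by (rule open_chart_image[OF atlas_chart[OF A U(1)] W]) auto
  have "smooth_on (\<lambda>y. \<psi> (F (inv_into U \<phi> y))) (\<phi> ` (U \<inter> F -` V))"
    using F U(1) V(1) by (force simp: smooth_map_def o_def)
  then have "smooth_on (\<lambda>y. f (inv_into V \<psi> (\<psi> (F (inv_into U \<phi> y))))) (\<phi> ` (U \<inter> F -` V))"
    by (intro smooth_on_compose[OF o cV(2) _ _ smooth_functions_chart[OF f V(1)]]) (use cU(5) in auto)
  then have "smooth_on (\<lambda>y. f (F (inv_into U \<phi> y))) (\<phi> ` (U \<inter> F -` V))"
    by (rule smooth_on_cong[OF o, rotated]) (use cU(5) cV(5) in auto)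
  then show "\<exists>U \<phi> W. (U, \<phi>) \<in> A \<and> open W \<and> p \<in> W \<and> W \<subseteq> U \<and> smooth_on (\<lambda>y. f (F (inv_into U \<phi> y))) (\<phi> ` W)"
    using U V(2) W by blast
qed

lemma smooth_map_prod_chart:
  assumes A: "smooth_atlas A" and B: "smooth_atlas B" and C: "smooth_atlas C"
    and F: "smooth_map (prod_atlas A B) C F"
    and U: "(U, \<phi>) \<in> A" and V: "(V, \<psi>) \<in> B" and W: "(W, \<kappa>) \<in> C"
  shows "open (map_prod \<phi> \<psi> ` ((U \<times> V) \<inter> F -` W))"
    "smooth_on (\<lambda>(y, z). \<kappa> (F (inv_into U \<phi> y, inv_into V \<psi> z))) (map_prod \<phi> \<psi> ` ((U \<times> V) \<inter> F -` W))"
proof -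
  note cU = chart_simps[OF atlas_chart[OF A U]] and cV = chart_simps[OF atlas_chart[OF B V]]
  have UV: "(U \<times> V, map_prod \<phi> \<psi>) \<in> prod_atlas A B" using U V by (auto simp: prod_atlas_def)
  have "open (F -` W)" using F chart_simps(1)[OF atlas_chart[OF C W]]
    by (auto simp: smooth_map_def intro: open_vimage)
  then show o: "open (map_prod \<phi> \<psi> ` ((U \<times> V) \<inter> F -` W))"
    using cU(1) cV(1)
    by (intro open_chart_image[OF atlas_chart[OF smooth_atlas_prod[OF A B] UV]]) (auto intro: open_Times)
  have "smooth_on (\<kappa> \<circ> F \<circ> inv_into (U \<times> V) (map_prod \<phi> \<psi>)) (map_prod \<phi> \<psi> ` ((U \<times> V) \<inter> F -` W))"
    using F UV W unfolding smooth_map_def by blast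
  then show "smooth_on (\<lambda>(y, z). \<kappa> (F (inv_into U \<phi> y, inv_into V \<psi> z))) (map_prod \<phi> \<psi> ` ((U \<times> V) \<inter> F -` W))"
    by (rule smooth_on_cong[OF o, rotated])
      (auto simp: inv_into_map_prod[OF atlas_chart[OF A U] atlas_chart[OF B V]])
qed

lemma smooth_functions_prod_chart:
  assumes A: "smooth_atlas A" and B: "smooth_atlas B" and \<Phi>: "\<Phi> \<in> smooth_functions (prod_atlas A B)"
    and U: "(U, \<phi>) \<in> A" and V: "(V, \<psi>) \<in> B"
  shows "smooth_on (\<lambda>x. \<Phi> (inv_into U \<phi> (fst x), inv_into V \<psi> (snd x))) (\<phi> ` U \<times> \<psi> ` V)"
proof -
  have "map_prod \<phi> \<psi> ` ((U \<times> V) \<inter> \<Phi> -` UNIV) = \<phi> ` U \<times> \<psi> ` V"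
    using map_prod_surj_on[of \<phi> U _ \<psi> V] by simp
  then show ?thesis
    using smooth_map_prod_chart(2)[OF A B smooth_atlas_euclidean _ U V, of \<Phi> UNIV "\<lambda>x. x"] \<Phi>
    by (simp add: smooth_functions_def split_beta' euclidean_atlas_def)
qed

lemma smooth_functions_swap:
  assumes A: "smooth_atlas A" and B: "smooth_atlas B" and \<Phi>: "\<Phi> \<in> smooth_functions (prod_atlas A B)"
  shows "(\<lambda>x. \<Phi> (snd x, fst x)) \<in> smooth_functions (prod_atlas B A)"
proof (rule smooth_functionsI_charts[OF smooth_atlas_prod[OF B A]])
  fix W \<kappa> assume "(W, \<kappa>) \<in> prod_atlas B A"
  then obtain V \<psi> U \<phi> where W: "W = V \<times> U" "\<kappa> = map_prod \<psi> \<phi>" and V: "(V, \<psi>) \<in> B" and U: "(U, \<phi>) \<in> A"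
    by (auto simp: prod_atlas_def)
  note cU = atlas_chart[OF A U] and cV = atlas_chart[OF B V]
  have im: "\<kappa> ` W = \<psi> ` V \<times> \<phi> ` U" unfolding W by (rule map_prod_surj_on) auto
  have o: "open (\<psi> ` V \<times> \<phi> ` U)" "open (\<phi> ` U \<times> \<psi> ` V)"
    using chart_simps(2)[OF cU] chart_simps(2)[OF cV] by (auto intro: open_Times)
  have "smooth_on (\<lambda>x. \<Phi> (inv_into U \<phi> (fst (snd x, fst x)), inv_into V \<psi> (snd (snd x, fst x)))) (\<psi> ` V \<times> \<phi> ` U)"
    by (rule smooth_on_compose[OF o _ _ smooth_functions_prod_chart[OF A B \<Phi> U V]])
      (auto intro!: smooth_on_bounded_linear o bounded_linear_Pair bounded_linear_fst bounded_linear_snd)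
  then show "smooth_on (\<lambda>y. \<Phi> (snd (inv_into W \<kappa> y), fst (inv_into W \<kappa> y))) (\<kappa> ` W)"
    unfolding im
    by (rule smooth_on_cong[OF o(1), rotated]) (auto simp: W inv_into_map_prod[OF cV cU])
qed

lemma has_derivative_Pair_left:
  assumes "(F has_derivative D) (at (y, z))"
  shows "((\<lambda>y. F (y, z)) has_derivative (\<lambda>w. D (w, 0))) (at y)"
proof -
  have "((\<lambda>y. (y, z)) has_derivative (\<lambda>w. (w, 0))) (at y)"
    by (intro has_derivative_Pair has_derivative_ident has_derivative_const)
  then show ?thesis by (rule has_derivative_compose[where g=F]) (rule assms)
qed

lemma has_derivative_Pair_right:
  assumes "(F has_derivative D) (at (y, z))"
  shows "((\<lambda>z. F (y, z)) has_derivative (\<lambda>w. D (0, w))) (at z)"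
proof -
  have "((\<lambda>z. (y, z)) has_derivative (\<lambda>w. (0, w))) (at z)"
    by (intro has_derivative_Pair has_derivative_ident has_derivative_const)
  then show ?thesis by (rule has_derivative_compose[where g=F]) (rule assms)
qed

lemma smooth_functions_slice_left:
  assumes A: "smooth_atlas A" and B: "smooth_atlas B" and \<Phi>: "\<Phi> \<in> smooth_functions (prod_atlas A B)"
  shows "(\<lambda>x. \<Phi> (x, q)) \<in> smooth_functions A"
proof (rule smooth_functionsI_charts[OF A])
  fix U \<phi> assume U: "(U, \<phi>) \<in> A"
  obtain V \<psi> where V: "(V, \<psi>) \<in> B" "q \<in> V" using atlas_cover[OF B] .
  note cU = chart_simps[OF atlas_chart[OF A U]] and cV = chart_simps[OF atlas_chart[OF B V(1)]]
  have "smooth_on (\<lambda>y. \<Phi> (inv_into U \<phi> (fst (y, \<psi> q)), inv_into V \<psi> (snd (y, \<psi> q)))) (\<phi> ` U)"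
    by (rule smooth_on_compose[OF cU(2) open_Times[OF cU(2) cV(2)] _ _ smooth_functions_prod_chart[OF A B \<Phi> U V(1)]])
      (use V(2) in \<open>auto intro!: smooth_on_Pair smooth_on_id smooth_on_const cU(2)\<close>)
  then show "smooth_on (\<lambda>y. \<Phi> (inv_into U \<phi> y, q)) (\<phi> ` U)" using cV(5)[OF V(2)] by simp
qed

lemma smooth_functions_slice_right:
  assumes A: "smooth_atlas A" and B: "smooth_atlas B" and \<Phi>: "\<Phi> \<in> smooth_functions (prod_atlas A B)"
  shows "(\<lambda>y. \<Phi> (p, y)) \<in> smooth_functions B"
  using smooth_functions_slice_left[OF B A smooth_functions_swap[OF A B \<Phi>], of p] by simp

lemma chart_derivative_slice:
  assumes A: "smooth_atlas A" and B: "smooth_atlas B" and \<Phi>: "\<Phi> \<in> smooth_functions (prod_atlas A B)"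
    and U: "(U, \<phi>) \<in> A" "p \<in> U" and V: "(V, \<psi>) \<in> B" "z \<in> \<psi> ` V"
  shows "chart_derivative U \<phi> p w (\<lambda>x. \<Phi> (x, inv_into V \<psi> z)) =
    frechet_derivative (\<lambda>x. \<Phi> (inv_into U \<phi> (fst x), inv_into V \<psi> (snd x))) (at (\<phi> p, z)) (w, 0)"
proof -
  have "((\<lambda>x. \<Phi> (inv_into U \<phi> (fst x), inv_into V \<psi> (snd x))) has_derivative
      frechet_derivative (\<lambda>x. \<Phi> (inv_into U \<phi> (fst x), inv_into V \<psi> (snd x))) (at (\<phi> p, z))) (at (\<phi> p, z))"
    by (rule smooth_on_has_derivative[OF smooth_functions_prod_chart[OF A B \<Phi> U(1) V(1)]]) (use U V in auto)
  from fun_cong[OF frechet_derivative_at[OF has_derivative_Pair_left[OF this]], of w] show ?thesis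
    by (simp add: chart_derivative_def)
qed

text \<open>In charts the function is a partial derivative of \<open>\<Phi>\<close> with respect to the first variable, at a fixed
  point and in a fixed direction.\<close>

lemma tangent_slice_smooth:
  fixes A :: "('m::{t2_space,second_countable_topology}, 'e::euclidean_space) chart set"
    and B :: "('n::{t2_space,second_countable_topology}, 'd::euclidean_space) chart set"
  assumes A: "smooth_atlas A" and B: "smooth_atlas B" and \<Phi>: "\<Phi> \<in> smooth_functions (prod_atlas A B)"
    and a: "a \<in> tangent_space A p"
  shows "(\<lambda>q. a (\<lambda>x. \<Phi> (x, q))) \<in> smooth_functions B"
proof (rule smooth_functionsI_charts[OF B])
  fix V \<psi> assume V: "(V, \<psi>) \<in> B"
  obtain U \<phi> where U: "(U, \<phi>) \<in> A" "p \<in> U" using atlas_cover[OF A] .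
  note cU = chart_simps[OF atlas_chart[OF A U(1)]] and cV = chart_simps[OF atlas_chart[OF B V]]
  obtain w where w: "\<And>f. f \<in> smooth_functions A \<Longrightarrow> a f = chart_derivative U \<phi> p w f"
    using tangent_space_chart_derivative[OF A a U] by blast
  define \<Psi> where "\<Psi> = (\<lambda>x. \<Phi> (inv_into U \<phi> (fst x), inv_into V \<psi> (snd x)))"
  have \<Psi>: "smooth_on \<Psi> (\<phi> ` U \<times> \<psi> ` V)"
    unfolding \<Psi>_def by (rule smooth_functions_prod_chart[OF A B \<Phi> U(1) V])
  have "smooth_on (\<lambda>z. frechet_derivative \<Psi> (at (\<phi> p, z)) (w, 0)) (\<psi> ` V)"
    by (rule smooth_on_compose[OF cV(2) open_Times[OF cU(2) cV(2)] _ _ smooth_on_frechet_derivative[OF \<Psi>]])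
      (use U(2) in \<open>auto intro!: smooth_on_Pair smooth_on_id smooth_on_const cV(2)\<close>)
  then show "smooth_on (\<lambda>z. a (\<lambda>x. \<Phi> (x, inv_into V \<psi> z))) (\<psi> ` V)"
    by (rule smooth_on_cong[OF cV(2), rotated])
      (simp only: w[OF smooth_functions_slice_left[OF A B \<Phi>]] chart_derivative_slice[OF A B \<Phi> U V] \<Psi>_def)
qed

text \<open>In charts this is the symmetry of the mixed second derivatives.\<close>

lemma tangent_commute:
  fixes A :: "('m::{t2_space,second_countable_topology}, 'e::euclidean_space) chart set"
    and B :: "('n::{t2_space,second_countable_topology}, 'd::euclidean_space) chart set"
  assumes A: "smooth_atlas A" and B: "smooth_atlas B" and \<Phi>: "\<Phi> \<in> smooth_functions (prod_atlas A B)"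
    and a: "a \<in> tangent_space A p" and b: "b \<in> tangent_space B q"
  shows "a (\<lambda>x. b (\<lambda>y. \<Phi> (x, y))) = b (\<lambda>y. a (\<lambda>x. \<Phi> (x, y)))"
proof -
  obtain U \<phi> where U: "(U, \<phi>) \<in> A" "p \<in> U" using atlas_cover[OF A] .
  obtain V \<psi> where V: "(V, \<psi>) \<in> B" "q \<in> V" using atlas_cover[OF B] .
  note cU = chart_simps[OF atlas_chart[OF A U(1)]] and cV = chart_simps[OF atlas_chart[OF B V(1)]]
  obtain w where w: "\<And>f. f \<in> smooth_functions A \<Longrightarrow> a f = chart_derivative U \<phi> p w f"
    using tangent_space_chart_derivative[OF A a U] by blast
  obtain w' where w': "\<And>f. f \<in> smooth_functions B \<Longrightarrow> b f = chart_derivative V \<psi> q w' f"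
    using tangent_space_chart_derivative[OF B b V] by blast
  define \<Psi> where "\<Psi> = (\<lambda>x. \<Phi> (inv_into U \<phi> (fst x), inv_into V \<psi> (snd x)))"
  have \<Psi>: "smooth_on \<Psi> (\<phi> ` U \<times> \<psi> ` V)"
    unfolding \<Psi>_def by (rule smooth_functions_prod_chart[OF A B \<Phi> U(1) V(1)])
  define D where "D = (\<lambda>u x. frechet_derivative \<Psi> (at x) u)"
  have sD: "smooth_on (D u) (\<phi> ` U \<times> \<psi> ` V)" for u
    unfolding D_def by (rule smooth_on_frechet_derivative[OF \<Psi>])
  have o: "open (\<phi> ` U \<times> \<psi> ` V)" using cU(2) cV(2) by (rule open_Times)
  have pq: "(\<phi> p, \<psi> q) \<in> \<phi> ` U \<times> \<psi> ` V" using U(2) V(2) by auto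
  let ?D2 = "\<lambda>u v. frechet_derivative (D u) (at (\<phi> p, \<psi> q)) v"
  have d\<Psi>: "(\<Psi> has_derivative (\<lambda>u. D u x)) (at x)" if "x \<in> \<phi> ` U \<times> \<psi> ` V" for x
    unfolding D_def by (rule smooth_on_has_derivative[OF \<Psi> that])
  have dD: "(D u has_derivative ?D2 u) (at (\<phi> p, \<psi> q))" for u
    by (rule smooth_on_has_derivative[OF sD pq])
  have ia: "a (\<lambda>x. \<Phi> (x, inv_into V \<psi> z)) = D (w, 0) (\<phi> p, z)" if "z \<in> \<psi> ` V" for z
    unfolding w[OF smooth_functions_slice_left[OF A B \<Phi>]] chart_derivative_slice[OF A B \<Phi> U V(1) that]
      D_def \<Psi>_def ..
  have ib: "b (\<lambda>y. \<Phi> (inv_into U \<phi> z, y)) = D (0, w') (z, \<psi> q)" if z: "z \<in> \<phi> ` U" for z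
  proof -
    have "((\<lambda>y. \<Psi> (z, y)) has_derivative (\<lambda>w. D (0, w) (z, \<psi> q))) (at (\<psi> q))"
      by (rule has_derivative_Pair_right[OF d\<Psi>]) (use z V(2) in auto)
    from fun_cong[OF frechet_derivative_at[OF this], of w'] show ?thesis
      unfolding w'[OF smooth_functions_slice_right[OF A B \<Phi>]] chart_derivative_def by (simp add: \<Psi>_def)
  qed
  have "b (\<lambda>y. a (\<lambda>x. \<Phi> (x, y))) = ?D2 (w, 0) (0, w')"
  proof -
    have "((\<lambda>z. D (w, 0) (\<phi> p, z)) has_derivative (\<lambda>v. ?D2 (w, 0) (0, v))) (at (\<psi> q))"
      by (rule has_derivative_Pair_right[OF dD])
    then have "((\<lambda>z. a (\<lambda>x. \<Phi> (x, inv_into V \<psi> z))) has_derivative (\<lambda>v. ?D2 (w, 0) (0, v))) (at (\<psi> q))"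
      by (rule has_derivative_transform_within_open[OF _ cV(2)]) (use V(2) ia in auto)
    from fun_cong[OF frechet_derivative_at[OF this], of w'] show ?thesis
      unfolding w'[OF tangent_slice_smooth[OF A B \<Phi> a]] chart_derivative_def by simp
  qed
  moreover have "a (\<lambda>x. b (\<lambda>y. \<Phi> (x, y))) = ?D2 (0, w') (w, 0)"
  proof -
    have "((\<lambda>z. D (0, w') (z, \<psi> q)) has_derivative (\<lambda>v. ?D2 (0, w') (v, 0))) (at (\<phi> p))"
      by (rule has_derivative_Pair_left[OF dD])
    then have d: "((\<lambda>z. b (\<lambda>y. \<Phi> (inv_into U \<phi> z, y))) has_derivative (\<lambda>v. ?D2 (0, w') (v, 0))) (at (\<phi> p))"
      by (rule has_derivative_transform_within_open[OF _ cU(2)]) (use U(2) ib in auto)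
    have "(\<lambda>x. b (\<lambda>y. \<Phi> (x, y))) \<in> smooth_functions A"
      using tangent_slice_smooth[OF B A smooth_functions_swap[OF A B \<Phi>] b] by simp
    with fun_cong[OF frechet_derivative_at[OF d], of w] show ?thesis
      by (simp add: w chart_derivative_def)
  qed
  moreover have "?D2 (w, 0) (0, w') = ?D2 (0, w') (w, 0)"
    unfolding D_def by (rule smooth_on_derivative_commute[OF \<Psi> o pq])
  ultimately show ?thesis by simp
qed

section \<open>Left-invariant fields and their integral curves\<close>

locale smooth_lie_group =
  fixes G :: "('g::{t2_space,second_countable_topology}, 'd::euclidean_space) lie_group" (structure)
  assumes is_lie_group: "is_lie_group G"
begin

abbreviation smooth :: "('g \<Rightarrow> real) set" where
  "smooth \<equiv> smooth_functions (atlas G)"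

lemma carrier_UNIV [simp]: "carrier G = UNIV"
  and atlas: "smooth_atlas (atlas G)"
  and mult_smooth: "smooth_map (prod_atlas (atlas G) (atlas G)) (atlas G) (\<lambda>(g, h). g \<otimes> h)"
  using is_lie_group by (simp_all add: is_lie_group_def)

sublocale group G
  using is_lie_group by (simp add: is_lie_group_def)

lemma smooth_mult:
  assumes "f \<in> smooth"
  shows "(\<lambda>x. f (fst x \<otimes> snd x)) \<in> smooth_functions (prod_atlas (atlas G) (atlas G))"
  using smooth_functions_compose[OF smooth_atlas_prod[OF atlas atlas] atlas mult_smooth assms]
  by (simp add: split_beta')

lemma smooth_translate: "f \<in> smooth \<Longrightarrow> (\<lambda>h. f (g \<otimes> h)) \<in> smooth"
  using smooth_functions_slice_right[OF atlas atlas smooth_mult, of f g] by simp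

lemma continuous_translate: "continuous_on UNIV (\<lambda>h. g \<otimes> h)"
proof -
  have "continuous_on UNIV (\<lambda>(g, h). g \<otimes> h)" using mult_smooth by (simp add: smooth_map_def)
  then have "continuous_on UNIV (\<lambda>h. case (g, h) of (g, h) \<Rightarrow> g \<otimes> h)"
    by (rule continuous_on_compose2) (auto intro!: continuous_intros)
  then show ?thesis by simp
qed

text \<open>The derivative along the left-invariant field generated by \<open>a\<close>, as an operator on functions.\<close>

definition lderiv :: "'g tvec \<Rightarrow> ('g \<Rightarrow> real) \<Rightarrow> 'g \<Rightarrow> real" where
  "lderiv a f g = a (\<lambda>h. f (g \<otimes> h))"

lemma lderiv_smooth: "a \<in> Lie G \<Longrightarrow> f \<in> smooth \<Longrightarrow> lderiv a f \<in> smooth"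
  using tangent_slice_smooth[OF atlas atlas smooth_functions_swap[OF atlas atlas smooth_mult[of f]], of a "\<one>"]
  by (simp add: lderiv_def[abs_def] Lie_def)

lemma lderiv_translate: "lderiv a (\<lambda>h. f (g \<otimes> h)) k = lderiv a f (g \<otimes> k)"
  by (simp add: lderiv_def m_assoc)

lemma lderiv_one: "lderiv a f \<one> = a f"
  by (simp add: lderiv_def)

text \<open>Integral curves are characterised by their effect on functions, which makes invariance under
  left translation immediate.\<close>

definition integral_curve :: "'g tvec \<Rightarrow> (real \<Rightarrow> 'g) \<Rightarrow> real set \<Rightarrow> bool" where
  "integral_curve a \<gamma> I \<longleftrightarrow> continuous_on I \<gamma> \<and>
     (\<forall>t\<in>I. \<forall>f\<in>smooth. ((\<lambda>s. f (\<gamma> s)) has_real_derivative lderiv a f (\<gamma> t)) (at t))"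

lemma integral_curveD:
  "integral_curve a \<gamma> I \<Longrightarrow> t \<in> I \<Longrightarrow> f \<in> smooth \<Longrightarrow>
    ((\<lambda>s. f (\<gamma> s)) has_real_derivative lderiv a f (\<gamma> t)) (at t)"
  by (simp add: integral_curve_def)

lemma integral_curve_subset: "integral_curve a \<gamma> I \<Longrightarrow> J \<subseteq> I \<Longrightarrow> integral_curve a \<gamma> J"
  by (auto simp: integral_curve_def intro: continuous_on_subset)

lemma integral_curve_translate:
  assumes "integral_curve a \<gamma> I"
  shows "integral_curve a (\<lambda>t. g \<otimes> \<gamma> t) I"
  unfolding integral_curve_def
proof (intro conjI ballI)
  show "continuous_on I (\<lambda>t. g \<otimes> \<gamma> t)"
    using continuous_on_compose2[OF continuous_translate] assms by (auto simp: integral_curve_def)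
  fix t f assume "t \<in> I" "f \<in> smooth"
  from integral_curveD[OF assms this(1) smooth_translate[OF this(2)], of g]
  show "((\<lambda>s. f (g \<otimes> \<gamma> s)) has_real_derivative lderiv a f (g \<otimes> \<gamma> t)) (at t)"
    by (simp add: lderiv_translate)
qed

lemma integral_curve_shift:
  assumes "integral_curve a \<gamma> I" "\<And>t. t \<in> J \<Longrightarrow> s + t \<in> I"
  shows "integral_curve a (\<lambda>t. \<gamma> (s + t)) J"
  unfolding integral_curve_def
proof (intro conjI ballI)
  have "continuous_on I \<gamma>" using assms(1) by (simp add: integral_curve_def)
  then show "continuous_on J (\<lambda>t. \<gamma> (s + t))"
    by (rule continuous_on_compose2) (use assms(2) in \<open>auto intro: continuous_intros\<close>)
  fix t f assume "t \<in> J" "f \<in> smooth"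
  from integral_curveD[OF assms(1) assms(2)[OF this(1)] this(2)]
  have "((\<lambda>t. f (\<gamma> t)) has_real_derivative lderiv a f (\<gamma> (s + t))) (at (t + s))"
    by (simp add: add.commute)
  from this[THEN DERIV_shift[THEN iffD1]]
  show "((\<lambda>t. f (\<gamma> (s + t))) has_real_derivative lderiv a f (\<gamma> (s + t))) (at t)"
    by (simp add: add.commute)
qed

text \<open>In a chart around the identity, the field at \<open>y\<close> is the derivative of the multiplication with
  respect to its second argument at the identity.\<close>

lemma left_invariant_field_in_chart:
  assumes a: "a \<in> Lie G" and V: "(V, \<psi>) \<in> atlas G" "\<one> \<in> V"
  obtains X :: "'d \<Rightarrow> 'd" where "smooth_on X (\<psi> ` V)"
    "\<And>g f. g \<in> V \<Longrightarrow> f \<in> smooth \<Longrightarrow> lderiv a f g = chart_derivative V \<psi> g (X (\<psi> g)) f"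
proof -
  note cV = chart_simps[OF atlas_chart[OF atlas V(1)]]
  obtain w where w: "\<And>f. f \<in> smooth \<Longrightarrow> a f = chart_derivative V \<psi> \<one> w f"
    using tangent_space_chart_derivative[OF atlas _ V] a unfolding Lie_def by blast
  define S where "S = map_prod \<psi> \<psi> ` ((V \<times> V) \<inter> (\<lambda>(g, h). g \<otimes> h) -` V)"
  define \<mu> where "\<mu> = (\<lambda>(y, z). \<psi> (inv_into V \<psi> y \<otimes> inv_into V \<psi> z))"
  have S: "open S" and \<mu>: "smooth_on \<mu> S"
    using smooth_map_prod_chart[OF atlas atlas atlas mult_smooth V(1) V(1) V(1)]
    unfolding S_def \<mu>_def by simp_all
  have inS: "(\<psi> g, \<psi> h) \<in> S" if "g \<in> V" "h \<in> V" "g \<otimes> h \<in> V" for g h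
    using that by (force simp: S_def)
  define X where "X = (\<lambda>y. frechet_derivative \<mu> (at (y, \<psi> \<one>)) (0, w))"
  show ?thesis
  proof
    show "smooth_on X (\<psi> ` V)"
      unfolding X_def
      by (rule smooth_on_compose[OF cV(2) S _ _ smooth_on_frechet_derivative[OF \<mu>]])
        (use V(2) inS in \<open>auto intro!: smooth_on_Pair smooth_on_id smooth_on_const cV(2)\<close>)
    fix g f assume g: "g \<in> V" and f: "f \<in> smooth"
    have pt: "(\<psi> g, \<psi> \<one>) \<in> S" using inS[of g \<one>] g V(2) by simp
    have m1: "\<mu> (\<psi> g, \<psi> \<one>) = \<psi> g" using cV(5) g V(2) by (simp add: \<mu>_def)
    define W where "W = V \<inter> (\<lambda>h. g \<otimes> h) -` V"
    have W: "open W" unfolding W_def using cV(1) open_vimage[OF cV(1) continuous_translate] by auto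
    have "((\<lambda>y. f (inv_into V \<psi> y)) has_derivative (\<lambda>w. chart_derivative V \<psi> g w f)) (at (\<mu> (\<psi> g, \<psi> \<one>)))"
      unfolding m1 by (rule chart_derivative[OF atlas V(1) g f])
    from has_derivative_compose[OF has_derivative_Pair_right[OF smooth_on_has_derivative[OF \<mu> pt]] this]
    have d: "((\<lambda>z. f (inv_into V \<psi> (\<mu> (\<psi> g, z)))) has_derivative
        (\<lambda>w. chart_derivative V \<psi> g (frechet_derivative \<mu> (at (\<psi> g, \<psi> \<one>)) (0, w)) f)) (at (\<psi> \<one>))" .
    have "lderiv a f g = chart_derivative V \<psi> \<one> w (\<lambda>h. f (g \<otimes> h))"
      unfolding lderiv_def by (rule w[OF smooth_translate[OF f]])
    also have "\<dots> = chart_derivative V \<psi> g (frechet_derivative \<mu> (at (\<psi> g, \<psi> \<one>)) (0, w)) f"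
      by (rule chart_derivative_germ[OF atlas V W _ _ _ d])
        (use V(2) g cV(5) in \<open>auto simp: W_def \<mu>_def\<close>)
    finally show "lderiv a f g = chart_derivative V \<psi> g (X (\<psi> g)) f" by (simp add: X_def)
  qed
qed

text \<open>The coordinates are not global functions, but near \<open>\<gamma> t\<close> they agree with global functions, on which
  the curve can be tested.\<close>

lemma integral_curve_in_chart:
  assumes V: "(V, \<psi>) \<in> atlas G" and X: "\<And>g f. g \<in> V \<Longrightarrow> f \<in> smooth \<Longrightarrow> lderiv a f g = chart_derivative V \<psi> g (X (\<psi> g)) f"
    and \<gamma>: "integral_curve a \<gamma> I" "open I" "t \<in> I" "\<gamma> t \<in> V"
  shows "((\<lambda>s. \<psi> (\<gamma> s)) has_vector_derivative X (\<psi> (\<gamma> t))) (at t)"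
  unfolding has_vector_derivative_def
proof (subst has_derivative_componentwise_within, intro ballI)
  fix i :: 'd
  have "smooth_on (\<lambda>y. y \<bullet> i) UNIV"
    by (intro smooth_on_inner smooth_on_id smooth_on_const open_UNIV)
  from smooth_extension[OF atlas V \<gamma>(4) this open_UNIV UNIV_I]
  obtain f W where f: "f \<in> smooth" "open W" "\<gamma> t \<in> W" "W \<subseteq> V" "\<And>x. x \<in> W \<Longrightarrow> f x = \<psi> x \<bullet> i"
    by metis
  have "((\<lambda>y. y \<bullet> i) has_derivative (\<lambda>w. w \<bullet> i)) (at (\<psi> (\<gamma> t)))"
    by (auto intro!: derivative_eq_intros)
  from chart_derivative_germ[OF atlas V \<gamma>(4) f(2,3,4) f(5) this]
  have "lderiv a f (\<gamma> t) = X (\<psi> (\<gamma> t)) \<bullet> i" by (simp add: X[OF \<gamma>(4) f(1)])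
  then have d: "((\<lambda>s. f (\<gamma> s)) has_derivative (\<lambda>h. (h *\<^sub>R X (\<psi> (\<gamma> t))) \<bullet> i)) (at t)"
    using integral_curveD[OF \<gamma>(1,3) f(1)] by (simp add: has_field_derivative_def mult.commute[of "X (\<psi> (\<gamma> t)) \<bullet> i"] mult_commute_abs)
  have "open (I \<inter> \<gamma> -` W)"
    using \<gamma>(1,2) f(2) by (auto simp: integral_curve_def intro: continuous_open_preimage)
  from has_derivative_transform_within_open[OF d this] show "((\<lambda>s. \<psi> (\<gamma> s) \<bullet> i) has_derivative (\<lambda>h. (h *\<^sub>R X (\<psi> (\<gamma> t))) \<bullet> i)) (at t)"
    using \<gamma>(3) f(3,5) by auto
qed

text \<open>In a chart around the identity both curves solve the same differential equation with a Lipschitz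
  right-hand side.\<close>

lemma integral_curve_local_unique:
  assumes a: "a \<in> Lie G" and I: "open I" "0 \<in> I"
    and \<gamma>: "integral_curve a \<gamma> I" "\<gamma> 0 = \<one>" and \<sigma>: "integral_curve a \<sigma> I" "\<sigma> 0 = \<one>"
  obtains e where "0 < e" "\<And>t. t \<in> {-e<..<e} \<Longrightarrow> \<gamma> t = \<sigma> t"
proof -
  obtain V \<psi> where V: "(V, \<psi>) \<in> atlas G" "\<one> \<in> V" using atlas_cover[OF atlas] .
  note cV = chart_simps[OF atlas_chart[OF atlas V(1)]]
  obtain X where X: "smooth_on X (\<psi> ` V)"
    "\<And>g f. g \<in> V \<Longrightarrow> f \<in> smooth \<Longrightarrow> lderiv a f g = chart_derivative V \<psi> g (X (\<psi> g)) f"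
    using left_invariant_field_in_chart[OF a V] by metis
  obtain r L where r: "0 < r" "cball (\<psi> \<one>) r \<subseteq> \<psi> ` V" "L-lipschitz_on (cball (\<psi> \<one>) r) X"
    using smooth_on_imp_lipschitz[OF X(1) cV(2)] V(2) by (metis imageI)
  define W where "W = V \<inter> \<psi> -` ball (\<psi> \<one>) r"
  have W: "open W" "\<one> \<in> W" unfolding W_def
    using continuous_open_preimage[OF cV(3,1) open_ball] V(2) r(1) by auto
  have "open (I \<inter> \<gamma> -` W)" "open (I \<inter> \<sigma> -` W)"
    using \<gamma>(1) \<sigma>(1) I(1) W(1) by (auto simp: integral_curve_def intro: continuous_open_preimage)
  then have "open ((I \<inter> \<gamma> -` W) \<inter> (I \<inter> \<sigma> -` W))" by (rule open_Int)
  moreover have "0 \<in> (I \<inter> \<gamma> -` W) \<inter> (I \<inter> \<sigma> -` W)" using I(2) \<gamma>(2) \<sigma>(2) W(2) by auto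
  ultimately obtain e where e: "0 < e" "ball 0 e \<subseteq> (I \<inter> \<gamma> -` W) \<inter> (I \<inter> \<sigma> -` W)"
    using open_contains_ball by blast
  have "\<gamma> t = \<sigma> t" if t: "t \<in> {-e<..<e}" for t
  proof -
    have s: "s \<in> I \<and> \<gamma> s \<in> W \<and> \<sigma> s \<in> W" if "s \<in> {-e<..<e}" for s
    proof -
      have "s \<in> ball 0 e" using that by auto
      then show ?thesis using e(2) by blast
    qed
    have "\<psi> (\<gamma> t) = \<psi> (\<sigma> t)"
    proof (rule ode_unique[OF r(3), where u="\<lambda>s. \<psi> (\<gamma> s)" and w="\<lambda>s. \<psi> (\<sigma> s)" and t=t and e=e])
      show "\<psi> (\<gamma> 0) = \<psi> (\<sigma> 0)" by (simp add: \<gamma>(2) \<sigma>(2))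
      show "t \<in> {-e<..<e}" by (rule t)
      fix s assume "s \<in> {-e<..<e}"
      note s = s[OF this]
      have I': "s \<in> I" "\<gamma> s \<in> V" "\<sigma> s \<in> V" and b: "\<psi> (\<gamma> s) \<in> cball (\<psi> \<one>) r" "\<psi> (\<sigma> s) \<in> cball (\<psi> \<one>) r"
        using s by (auto simp: W_def less_imp_le)
      show "\<psi> (\<gamma> s) \<in> cball (\<psi> \<one>) r \<and> ((\<lambda>s. \<psi> (\<gamma> s)) has_vector_derivative X (\<psi> (\<gamma> s))) (at s)"
        by (rule conjI[OF b(1) integral_curve_in_chart[OF V(1) X(2) \<gamma>(1) I(1) I'(1,2)]])
      show "\<psi> (\<sigma> s) \<in> cball (\<psi> \<one>) r \<and> ((\<lambda>s. \<psi> (\<sigma> s)) has_vector_derivative X (\<psi> (\<sigma> s))) (at s)"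
        by (rule conjI[OF b(2) integral_curve_in_chart[OF V(1) X(2) \<sigma>(1) I(1) I'(1,3)]])
    qed
    moreover have "\<gamma> t \<in> V" "\<sigma> t \<in> V" using s[OF t] by (auto simp: W_def)
    ultimately show ?thesis using inj_onD[OF cV(8)] by blast
  qed
  with e(1) show ?thesis using that by blast
qed

text \<open>The set of times at which the curves agree is closed by the Hausdorff property. It is open
  because translation by the inverse of the common value leads to curves through the identity, to
  which local uniqueness applies.\<close>

lemma integral_curve_unique:
  assumes a: "a \<in> Lie G" and I: "open I" "connected I" "s \<in> I"
    and \<gamma>: "integral_curve a \<gamma> I" and \<sigma>: "integral_curve a \<sigma> I" and eq: "\<gamma> s = \<sigma> s" and t: "t \<in> I"
  shows "\<gamma> t = \<sigma> t"
proof -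
  define E where "E = {t\<in>I. \<gamma> t = \<sigma> t}"
  have "open E" unfolding open_dist
  proof
    fix t assume "t \<in> E"
    then have t: "t \<in> I" "\<gamma> t = \<sigma> t" by (auto simp: E_def)
    define J where "J = (\<lambda>x. t + x) -` I"
    have J: "open J" unfolding J_def by (intro open_vimage I(1) continuous_intros)
    have J0: "0 \<in> J" using t(1) by (simp add: J_def)
    have c: "integral_curve a (\<lambda>x. inv (\<gamma> t) \<otimes> \<gamma> (t + x)) J" "integral_curve a (\<lambda>x. inv (\<gamma> t) \<otimes> \<sigma> (t + x)) J"
      by (intro integral_curve_translate integral_curve_shift[OF \<gamma>] integral_curve_shift[OF \<sigma>]; simp add: J_def)+
    have c0: "inv (\<gamma> t) \<otimes> \<gamma> (t + 0) = \<one>" "inv (\<gamma> t) \<otimes> \<sigma> (t + 0) = \<one>"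
      using t(2) by (simp_all add: l_inv)
    obtain e where e: "0 < e"
      "\<And>x. x \<in> {-e<..<e} \<Longrightarrow> inv (\<gamma> t) \<otimes> \<gamma> (t + x) = inv (\<gamma> t) \<otimes> \<sigma> (t + x)"
      by (rule integral_curve_local_unique[OF a J J0 c(1) c0(1) c(2) c0(2)]) (rule that)
    have eq: "\<gamma> (t + x) = \<sigma> (t + x)" if "x \<in> {-e<..<e}" for x
      using e(2)[OF that] by simp
    obtain d where d: "0 < d" "\<And>y. dist y t < d \<Longrightarrow> y \<in> I" using I(1) t(1) open_dist by metis
    have "y \<in> E" if "dist y t < min d e" for y
      using d(2)[of y] eq[of "y - t"] that by (auto simp: E_def dist_real_def abs_less_iff)
    then show "\<exists>d>0. \<forall>y. dist y t < d \<longrightarrow> y \<in> E" using d(1) e(1) by (intro exI[of _ "min d e"]) auto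
  qed
  moreover have "open (I - E)"
  proof -
    have "continuous_on I (\<lambda>t. (\<gamma> t, \<sigma> t))"
      using \<gamma> \<sigma> by (auto simp: integral_curve_def intro: continuous_on_Pair)
    from continuous_open_preimage[OF this I(1) open_diagonal_complement]
    have "open (I \<inter> (\<lambda>t. (\<gamma> t, \<sigma> t)) -` {(x, y) |x y. x \<noteq> y})" .
    moreover have "I \<inter> (\<lambda>t. (\<gamma> t, \<sigma> t)) -` {(x, y) |x y. x \<noteq> y} = I - E" by (auto simp: E_def)
    ultimately show ?thesis by simp
  qed
  ultimately have "E \<inter> I = {} \<or> (I - E) \<inter> I = {}"
    by (intro connectedD[OF I(2)]) auto
  moreover have "s \<in> E" using I(3) eq by (simp add: E_def)
  ultimately show ?thesis using I(3) t by (auto simp: E_def)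
qed

lemma integral_curve_local_exists:
  assumes a: "a \<in> Lie G"
  obtains e \<gamma> V \<psi> where "0 < e" "integral_curve a \<gamma> {-e<..<e}" "\<gamma> 0 = \<one>"
    "(V, \<psi>) \<in> atlas G" "\<And>t. t \<in> {-e<..<e} \<Longrightarrow> \<gamma> t \<in> V" "smooth_on (\<lambda>t. \<psi> (\<gamma> t)) {-e<..<e}"
proof -
  obtain V \<psi> where V: "(V, \<psi>) \<in> atlas G" "\<one> \<in> V" using atlas_cover[OF atlas] .
  note cV = chart_simps[OF atlas_chart[OF atlas V(1)]]
  obtain X where X: "smooth_on X (\<psi> ` V)"
    "\<And>g f. g \<in> V \<Longrightarrow> f \<in> smooth \<Longrightarrow> lderiv a f g = chart_derivative V \<psi> g (X (\<psi> g)) f"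
    using left_invariant_field_in_chart[OF a V] by metis
  obtain r L where r: "0 < r" "cball (\<psi> \<one>) r \<subseteq> \<psi> ` V" "L-lipschitz_on (cball (\<psi> \<one>) r) X"
    using smooth_on_imp_lipschitz[OF X(1) cV(2)] V(2) by (metis imageI)
  obtain e u where e: "0 < e" "u 0 = \<psi> \<one>"
    and u: "\<And>t. t \<in> {-e<..<e} \<Longrightarrow> u t \<in> ball (\<psi> \<one>) r \<and> (u has_vector_derivative X (u t)) (at t)"
    using ode_local_solution[OF r(1,3)] by metis
  have uV: "u t \<in> \<psi> ` V" if "t \<in> {-e<..<e}" for t
    using u[OF that] r(2) by (meson ball_subset_cball subsetD)
  define \<gamma> where "\<gamma> = (\<lambda>t. inv_into V \<psi> (u t))"
  have \<gamma>V: "\<gamma> t \<in> V" "\<psi> (\<gamma> t) = u t" if "t \<in> {-e<..<e}" for t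
    using cV(6,7)[OF uV[OF that]] by (simp_all add: \<gamma>_def)
  have su: "smooth_on u {-e<..<e}"
    by (rule ode_solution_smooth[OF X(1) cV(2)]) (use u uV in auto)
  show ?thesis
  proof (rule that[OF e(1) _ _ V(1) \<gamma>V(1)])
    show "\<gamma> 0 = \<one>" using e(2) cV(5)[OF V(2)] by (simp add: \<gamma>_def)
    show "smooth_on (\<lambda>t. \<psi> (\<gamma> t)) {-e<..<e}"
      by (rule smooth_on_cong[OF _ _ su]) (auto simp: \<gamma>V(2))
    show "integral_curve a \<gamma> {-e<..<e}"
      unfolding integral_curve_def
    proof (intro conjI ballI)
      show "continuous_on {-e<..<e} \<gamma>"
        unfolding \<gamma>_def
        by (rule continuous_on_compose2[OF cV(4) smooth_on_continuous[OF su]]) (use uV in auto)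
      fix t f assume t: "t \<in> {-e<..<e}" and f: "f \<in> smooth"
      note cd = chart_derivative[OF atlas V(1) \<gamma>V(1)[OF t] f, unfolded \<gamma>V(2)[OF t]]
      have "(u has_derivative (\<lambda>h. h *\<^sub>R X (u t))) (at t)"
        using u[OF t] by (simp add: has_vector_derivative_def)
      from has_derivative_compose[OF this cd]
      have "((\<lambda>s. f (\<gamma> s)) has_derivative (\<lambda>h. chart_derivative V \<psi> (\<gamma> t) (h *\<^sub>R X (u t)) f)) (at t)"
        by (simp add: \<gamma>_def)
      then show "((\<lambda>s. f (\<gamma> s)) has_real_derivative lderiv a f (\<gamma> t)) (at t)"
        using linear_cmul[OF has_derivative_linear[OF cd]]
        by (simp add: X(2)[OF \<gamma>V(1)[OF t] f] \<gamma>V(2)[OF t] has_field_derivative_def mult_commute_abs)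
    qed
  qed
qed

end

section \<open>One-parameter subgroups and the exponential map\<close>

context smooth_lie_group
begin

text \<open>For fixed \<open>s\<close> both sides are integral curves in \<open>t\<close>, and they agree at \<open>t = 0\<close>.\<close>

lemma integral_curve_local_homomorphism:
  assumes a: "a \<in> Lie G" and \<gamma>: "integral_curve a \<gamma> {-e<..<e}" "\<gamma> 0 = \<one>"
    and s: "\<bar>s\<bar> < e / 2" and t: "\<bar>t\<bar> < e / 2"
  shows "\<gamma> (s + t) = \<gamma> s \<otimes> \<gamma> t"
proof (rule integral_curve_unique[OF a, where I="{-(e / 2)<..<e / 2}" and s=0
      and \<gamma>="\<lambda>t. \<gamma> (s + t)" and \<sigma>="\<lambda>t. \<gamma> s \<otimes> \<gamma> t"])
  show "integral_curve a (\<lambda>t. \<gamma> (s + t)) {-(e / 2)<..<e / 2}"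
    by (rule integral_curve_shift[OF \<gamma>(1)]) (use s in auto)
  show "integral_curve a (\<lambda>t. \<gamma> s \<otimes> \<gamma> t) {-(e / 2)<..<e / 2}"
    by (rule integral_curve_translate[OF integral_curve_subset[OF \<gamma>(1)]]) (use s in auto)
qed (use s t \<gamma>(2) in auto)

lemma integral_curve_cong:
  assumes J: "open J" and \<sigma>: "integral_curve a \<sigma> J" and eq: "\<And>s. s \<in> J \<Longrightarrow> \<sigma> s = \<gamma> s"
  shows "integral_curve a \<gamma> J"
  unfolding integral_curve_def
proof (intro conjI ballI)
  show "continuous_on J \<gamma>"
    using \<sigma> by (intro continuous_on_eq[OF _ eq]) (auto simp: integral_curve_def)
  fix t f assume t: "t \<in> J" and f: "f \<in> smooth"
  have "((\<lambda>s. f (\<sigma> s)) has_derivative (*) (lderiv a f (\<gamma> t))) (at t)"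
    using integral_curveD[OF \<sigma> t f] eq[OF t] by (simp add: has_field_derivative_def)
  then have "((\<lambda>s. f (\<gamma> s)) has_derivative (*) (lderiv a f (\<gamma> t))) (at t)"
    by (rule has_derivative_transform_within_open[OF _ J t]) (simp add: eq)
  then show "((\<lambda>s. f (\<gamma> s)) has_real_derivative lderiv a f (\<gamma> t)) (at t)"
    by (simp add: has_field_derivative_def)
qed

lemma integral_curve_UNIV_local:
  assumes "\<And>t. \<exists>J. open J \<and> t \<in> J \<and> integral_curve a \<gamma> J"
  shows "integral_curve a \<gamma> UNIV"
  unfolding integral_curve_def
proof (intro conjI ballI)
  have "continuous (at t) \<gamma>" for t
    using assms[of t] continuous_on_eq_continuous_at unfolding integral_curve_def by blast
  then show "continuous_on UNIV \<gamma>" by (simp add: continuous_at_imp_continuous_on)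
  fix t f assume "f \<in> smooth"
  then show "((\<lambda>s. f (\<gamma> s)) has_real_derivative lderiv a f (\<gamma> t)) (at t)"
    using assms[of t] integral_curveD by blast
qed

text \<open>A local one-parameter subgroup \<open>\<gamma>\<^sub>0\<close> extends to the whole line by
  \<open>\<gamma> t = \<gamma>\<^sub>0 (t / n)\<^sup>n\<close>, which does not depend on the large number \<open>n\<close>.\<close>

lemma local_homomorphism_extends:
  fixes \<gamma>\<^sub>0 :: "real \<Rightarrow> 'g"
  assumes d: "0 < d" and one: "\<gamma>\<^sub>0 0 = \<one>"
    and hom: "\<And>s t. \<bar>s\<bar> < d \<Longrightarrow> \<bar>t\<bar> < d \<Longrightarrow> \<gamma>\<^sub>0 (s + t) = \<gamma>\<^sub>0 s \<otimes> \<gamma>\<^sub>0 t"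
  obtains \<gamma> where "\<And>s t. \<gamma> (s + t) = \<gamma> s \<otimes> \<gamma> t" "\<And>t. \<bar>t\<bar> < d \<Longrightarrow> \<gamma> t = \<gamma>\<^sub>0 t"
proof -
  have mult: "\<gamma>\<^sub>0 (real k * s) = \<gamma>\<^sub>0 s [^] k" if "\<bar>real k * s\<bar> < d" for k s
    using that
  proof (induction k)
    case 0
    then show ?case by (simp add: one)
  next
    case (Suc k)
    \<comment> \<open>\<open>k s\<close> and \<open>s\<close> stay in the interval where \<open>\<gamma>\<^sub>0\<close> is multiplicative\<close>
    have le: "\<bar>real k * s\<bar> \<le> \<bar>real (Suc k) * s\<bar>" "\<bar>s\<bar> \<le> \<bar>real (Suc k) * s\<bar>"
      by (auto simp: abs_mult intro: mult_right_mono mult_le_cancel_right1[THEN iffD2])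
    have "\<gamma>\<^sub>0 (real k * s + s) = \<gamma>\<^sub>0 (real k * s) \<otimes> \<gamma>\<^sub>0 s"
      using le Suc.prems by (intro hom) linarith+
    also have "\<gamma>\<^sub>0 (real k * s) = \<gamma>\<^sub>0 s [^] k" using le Suc.prems by (intro Suc.IH) linarith
    finally show ?case by (simp add: algebra_simps)
  qed
  have indep: "\<gamma>\<^sub>0 (t / real m) [^] m = \<gamma>\<^sub>0 (t / real (m * n)) [^] (m * n)"
    if "0 < m" "0 < n" "\<bar>t\<bar> < real m * d" for m n t
  proof -
    have e: "real n * (t / real (m * n)) = t / real m" using that(2) by simp
    have "\<bar>t / real m\<bar> < d" using that(1,3) by (simp add: field_simps)
    then have "\<gamma>\<^sub>0 (t / real m) = \<gamma>\<^sub>0 (t / real (m * n)) [^] n"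
      using mult[of n "t / real (m * n)"] unfolding e by simp
    then show ?thesis by (simp add: nat_pow_pow mult.commute)
  qed
  define N where "N = (\<lambda>t::real. Suc (nat \<lceil>\<bar>t\<bar> / d\<rceil>))"
  have N: "\<bar>t\<bar> < real (N t) * d" for t
  proof -
    have "\<bar>t\<bar> / d < real (N t)" using d by (simp add: N_def) linarith
    then show ?thesis using d by (simp add: field_simps)
  qed
  define \<gamma> where "\<gamma> = (\<lambda>t. \<gamma>\<^sub>0 (t / real (N t)) [^] N t)"
  have \<gamma>: "\<gamma> t = \<gamma>\<^sub>0 (t / real m) [^] m" if "0 < m" "\<bar>t\<bar> < real m * d" for t m
    using indep[OF _ that(1) N[of t]] indep[OF that(1) _ that(2), of "N t"]
    by (simp add: \<gamma>_def N_def mult.commute)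
  show ?thesis
  proof
    fix s t
    define m where "m = N (\<bar>s\<bar> + \<bar>t\<bar>)"
    have m: "0 < m" by (simp add: m_def N_def)
    have "\<bar>s\<bar> + \<bar>t\<bar> < real m * d" using N[of "\<bar>s\<bar> + \<bar>t\<bar>"] by (simp add: m_def)
    then have b: "\<bar>s\<bar> < real m * d" "\<bar>t\<bar> < real m * d" "\<bar>s + t\<bar> < real m * d" by linarith+
    then have b': "\<bar>s / real m\<bar> < d" "\<bar>t / real m\<bar> < d" using m by (simp_all add: field_simps)
    have comm: "\<gamma>\<^sub>0 (s / real m) \<otimes> \<gamma>\<^sub>0 (t / real m) = \<gamma>\<^sub>0 (t / real m) \<otimes> \<gamma>\<^sub>0 (s / real m)"
      using hom[OF b'] hom[OF b'(2,1)] by (simp add: add.commute)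
    have "\<gamma> (s + t) = \<gamma>\<^sub>0 (s / real m + t / real m) [^] m"
      using \<gamma>[OF m b(3)] by (simp add: add_divide_distrib)
    also have "\<dots> = \<gamma>\<^sub>0 (s / real m) [^] m \<otimes> \<gamma>\<^sub>0 (t / real m) [^] m"
      by (simp add: hom[OF b'] pow_mult_distrib[OF comm])
    finally show "\<gamma> (s + t) = \<gamma> s \<otimes> \<gamma> t" by (simp add: \<gamma>[OF m b(1)] \<gamma>[OF m b(2)])
  next
    fix t :: real assume "\<bar>t\<bar> < d"
    then show "\<gamma> t = \<gamma>\<^sub>0 t" using \<gamma>[of 1 t] by simp
  qed
qed

text \<open>Near any time \<open>t\<close> the extended curve is the translate by \<open>\<gamma> t\<close> of the local solution at the identity,
  so it inherits smoothness and the differential equation.\<close>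

lemma one_parameter_subgroup_exists:
  assumes a: "a \<in> Lie G"
  obtains \<gamma> where "one_parameter_subgroup G \<gamma>" "integral_curve a \<gamma> UNIV"
proof -
  obtain e \<gamma>\<^sub>0 V \<psi> where e: "0 < e" and \<gamma>\<^sub>0: "integral_curve a \<gamma>\<^sub>0 {-e<..<e}" "\<gamma>\<^sub>0 0 = \<one>"
    and V: "(V, \<psi>) \<in> atlas G" and \<gamma>V: "\<And>t. t \<in> {-e<..<e} \<Longrightarrow> \<gamma>\<^sub>0 t \<in> V"
    and sm: "smooth_on (\<lambda>t. \<psi> (\<gamma>\<^sub>0 t)) {-e<..<e}"
    using integral_curve_local_exists[OF a] by blast
  have "0 < e / 2" using e by simp
  from local_homomorphism_extends[of "e / 2" \<gamma>\<^sub>0, OF this \<gamma>\<^sub>0(2)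
      integral_curve_local_homomorphism[OF a \<gamma>\<^sub>0]]
  obtain \<gamma> where hom: "\<And>s t. \<gamma> (s + t) = \<gamma> s \<otimes> \<gamma> t" and ext: "\<And>t. \<bar>t\<bar> < e / 2 \<Longrightarrow> \<gamma> t = \<gamma>\<^sub>0 t"
    by blast
  define J where "J = (\<lambda>t. {t - e / 2<..<t + e / 2})"
  have J: "open (J t)" "t \<in> J t" for t using e by (auto simp: J_def)
  have near: "\<gamma> t \<otimes> \<gamma>\<^sub>0 (- t + s) = \<gamma> s" if "s \<in> J t" for s t
  proof -
    have "t - e / 2 < s" "s < t + e / 2" using that by (auto simp: J_def)
    then have "\<bar>- t + s\<bar> < e / 2" by linarith
    then show ?thesis using hom[of t "- t + s"] ext by simp
  qed
  have ic: "integral_curve a \<gamma> (J t)" for t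
    by (rule integral_curve_cong[OF J(1) integral_curve_translate[OF integral_curve_shift[OF \<gamma>\<^sub>0(1)]] near])
      (use e in \<open>auto simp: J_def\<close>)
  then have int: "integral_curve a \<gamma> UNIV" using J by (intro integral_curve_UNIV_local) blast
  have cont: "continuous_on UNIV \<gamma>" using int by (simp add: integral_curve_def)
  have "smooth_on (\<lambda>s. \<kappa> (\<gamma> s)) (\<gamma> -` W)" if W: "(W, \<kappa>) \<in> atlas G" for W \<kappa>
  proof (rule smooth_on_local)
    fix t assume t: "t \<in> \<gamma> -` W"
    obtain C \<chi>' where C: "(C, \<chi>') \<in> atlas G" "\<gamma> t \<in> C" using atlas_cover[OF atlas] .
    note cC = chart_simps[OF atlas_chart[OF atlas C(1)]] and cV = chart_simps[OF atlas_chart[OF atlas V]]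
    note pc = smooth_map_prod_chart[OF atlas atlas atlas mult_smooth C(1) V W]
    define T where "T = J t \<inter> \<gamma> -` W"
    have "open (\<gamma> -` W)"
      using chart_simps(1)[OF atlas_chart[OF atlas W]] cont by (rule open_vimage)
    then have T: "open T" "t \<in> T" using J t by (auto simp: T_def)
    have TV: "\<gamma>\<^sub>0 (- t + s) \<in> V" "- t + s \<in> {-e<..<e}" if "s \<in> T" for s
    proof -
      show "- t + s \<in> {-e<..<e}" using that e by (auto simp: T_def J_def)
      then show "\<gamma>\<^sub>0 (- t + s) \<in> V" by (rule \<gamma>V)
    qed
    have "smooth_on (\<lambda>s. \<psi> (\<gamma>\<^sub>0 (- t + s))) T"
      by (rule smooth_on_compose[OF T(1) _ _ _ sm])
        (use TV(2) in \<open>auto intro!: smooth_on_diff smooth_on_const smooth_on_id T(1)\<close>)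
    then have "smooth_on (\<lambda>s. (\<chi>' (\<gamma> t), \<psi> (\<gamma>\<^sub>0 (- t + s)))) T"
      by (intro smooth_on_Pair T(1) smooth_on_const)
    moreover have "(\<lambda>s. (\<chi>' (\<gamma> t), \<psi> (\<gamma>\<^sub>0 (- t + s)))) ` T \<subseteq>
        map_prod \<chi>' \<psi> ` ((C \<times> V) \<inter> (\<lambda>(g, h). g \<otimes> h) -` W)"
    proof
      fix x assume "x \<in> (\<lambda>s. (\<chi>' (\<gamma> t), \<psi> (\<gamma>\<^sub>0 (- t + s)))) ` T"
      then obtain s where s: "s \<in> T" "x = map_prod \<chi>' \<psi> (\<gamma> t, \<gamma>\<^sub>0 (- t + s))" by auto
      have "(\<gamma> t, \<gamma>\<^sub>0 (- t + s)) \<in> (C \<times> V) \<inter> (\<lambda>(g, h). g \<otimes> h) -` W"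
        using C(2) TV(1)[OF s(1)] near[of s t] s(1) by (auto simp: T_def)
      then show "x \<in> map_prod \<chi>' \<psi> ` ((C \<times> V) \<inter> (\<lambda>(g, h). g \<otimes> h) -` W)" using s(2) by (rule rev_image_eqI)
    qed
    ultimately have "smooth_on (\<lambda>s. (\<lambda>(y, z). \<kappa> ((\<lambda>(g, h). g \<otimes> h) (inv_into C \<chi>' y, inv_into V \<psi> z)))
        (\<chi>' (\<gamma> t), \<psi> (\<gamma>\<^sub>0 (- t + s)))) T"
      by (intro smooth_on_compose[OF T(1) pc(1) _ _ pc(2)])
    then have "smooth_on (\<lambda>s. \<kappa> (\<gamma> s)) T"
      by (rule smooth_on_cong[OF T(1), rotated])
        (use near cC(5)[OF C(2)] cV(5) TV(1) in \<open>auto simp: T_def\<close>)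
    with T show "\<exists>T. open T \<and> t \<in> T \<and> smooth_on (\<lambda>s. \<kappa> (\<gamma> s)) T" by blast
  qed
  then have "one_parameter_subgroup G \<gamma>"
    using cont hom
    by (auto simp: one_parameter_subgroup_def smooth_map_def euclidean_atlas_def o_def)
  then show ?thesis using int that by blast
qed

lemma one_parameter_subgroup_one:
  assumes "one_parameter_subgroup G \<gamma>" shows "\<gamma> 0 = \<one>"
proof -
  have "\<gamma> 0 \<otimes> \<gamma> 0 = \<gamma> (0 + 0)" using assms unfolding one_parameter_subgroup_def by metis
  then show ?thesis by simp
qed

lemma velocity_integral_curve:
  assumes a: "a \<in> Lie G" and \<gamma>: "integral_curve a \<gamma> UNIV" "\<gamma> 0 = \<one>"
  shows "velocity (atlas G) \<gamma> 0 = a"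
proof
  fix f show "velocity (atlas G) \<gamma> 0 f = a f"
  proof (cases "f \<in> smooth")
    case True
    from DERIV_imp_deriv[OF integral_curveD[OF \<gamma>(1) UNIV_I True, of 0]] show ?thesis
      using True by (simp add: velocity_def on_smooth_def o_def \<gamma>(2) lderiv_one)
  next
    case False
    then show ?thesis using a tangent_not_smooth by (simp add: velocity_def on_smooth_def Lie_def)
  qed
qed

text \<open>A one-parameter subgroup is an integral curve: by the homomorphism property its derivative at any
  time is a left translate of its derivative at time zero.\<close>

lemma one_parameter_subgroup_integral_curve:
  assumes \<gamma>: "one_parameter_subgroup G \<gamma>" "velocity (atlas G) \<gamma> 0 = a"
  shows "integral_curve a \<gamma> UNIV"
  unfolding integral_curve_def
proof (intro conjI ballI)
  have sm: "smooth_map (euclidean_atlas :: (real, real) chart set) (atlas G) \<gamma>"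
    and hom: "\<And>s t. \<gamma> (s + t) = \<gamma> s \<otimes> \<gamma> t"
    using \<gamma>(1) by (auto simp: one_parameter_subgroup_def)
  show "continuous_on UNIV \<gamma>" using sm by (simp add: smooth_map_def)
  fix t f assume f: "f \<in> smooth"
  let ?h = "\<lambda>g. f (\<gamma> t \<otimes> g)"
  have h: "?h \<in> smooth" by (rule smooth_translate[OF f])
  have "(\<lambda>s. ?h (\<gamma> s)) \<in> smooth_functions (euclidean_atlas :: (real, real) chart set)"
    by (rule smooth_functions_compose[OF smooth_atlas_euclidean atlas sm h])
  then have "(\<lambda>s. ?h (\<gamma> s)) differentiable (at 0)"
    using smooth_on_has_derivative[of "\<lambda>s. ?h (\<gamma> s)" UNIV 0]
    by (auto simp: smooth_functions_euclidean differentiable_def)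
  then have "((\<lambda>s. ?h (\<gamma> s)) has_real_derivative deriv (\<lambda>s. ?h (\<gamma> s)) 0) (at 0)"
    by (metis DERIV_imp_deriv real_differentiable_def)
  moreover have "deriv (\<lambda>s. ?h (\<gamma> s)) 0 = a ?h"
    using fun_cong[OF \<gamma>(2), of ?h] h by (simp add: velocity_def on_smooth_def o_def)
  ultimately have "((\<lambda>s. f (\<gamma> (s + t))) has_real_derivative lderiv a f (\<gamma> t)) (at 0)"
    by (simp add: lderiv_def hom[symmetric] add.commute)
  then show "((\<lambda>s. f (\<gamma> s)) has_real_derivative lderiv a f (\<gamma> t)) (at t)"
    using DERIV_shift[of "\<lambda>s. f (\<gamma> s)" "lderiv a f (\<gamma> t)" 0 t] by simp
qed

lemma Lie_scale: "a \<in> Lie G \<Longrightarrow> (\<lambda>f. t * a f) \<in> Lie G"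
  by (auto simp: Lie_def tangent_space_def algebra_simps)

text \<open>The curve \<open>s \<mapsto> \<gamma> (t s)\<close> is a one-parameter subgroup with velocity \<open>t a\<close>, and by uniqueness of
  integral curves it is the only one.\<close>

lemma exp_map_scale:
  assumes a: "a \<in> Lie G" and \<gamma>: "one_parameter_subgroup G \<gamma>" "integral_curve a \<gamma> UNIV"
  shows "exp_map G (\<lambda>f. t * a f) = \<gamma> t"
proof -
  have sm: "smooth_map (euclidean_atlas :: (real, real) chart set) (atlas G) \<gamma>"
    and hom: "\<And>s t. \<gamma> (s + t) = \<gamma> s \<otimes> \<gamma> t"
    using \<gamma>(1) by (auto simp: one_parameter_subgroup_def)
  note ta = Lie_scale[OF a, of t]
  let ?\<sigma> = "\<lambda>s. \<gamma> (t * s)"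
  have "integral_curve (\<lambda>f. t * a f) ?\<sigma> UNIV"
    unfolding integral_curve_def
  proof (intro conjI ballI)
    have "continuous_on UNIV \<gamma>" using sm by (simp add: smooth_map_def)
    then show "continuous_on UNIV ?\<sigma>"
      by (rule continuous_on_compose2) (auto intro: continuous_intros)
    fix s f assume "f \<in> smooth"
    from integral_curveD[OF \<gamma>(2) UNIV_I this]
    have "((\<lambda>s. f (\<gamma> s)) has_real_derivative lderiv a f (\<gamma> (t * s))) (at (t * s))" .
    moreover have "((\<lambda>s. t * s) has_real_derivative t) (at s)"
      by (auto intro!: derivative_eq_intros)
    ultimately have "((\<lambda>s. f (\<gamma> (t * s))) has_real_derivative lderiv a f (\<gamma> (t * s)) * t) (at s)"
      by (rule DERIV_chain2)
    then show "((\<lambda>s. f (\<gamma> (t * s))) has_real_derivative lderiv (\<lambda>f. t * a f) f (\<gamma> (t * s))) (at s)"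
      by (simp add: lderiv_def mult.commute)
  qed
  note ic = this
  have \<sigma>: "one_parameter_subgroup G ?\<sigma>"
  proof -
    have "smooth_on (\<lambda>s. \<kappa> (\<gamma> (t * s))) (?\<sigma> -` W)" if W: "(W, \<kappa>) \<in> atlas G" for W \<kappa>
    proof (rule smooth_on_compose[of _ "\<gamma> -` W" "\<lambda>s. t * s" "\<lambda>s. \<kappa> (\<gamma> s)"])
      have W': "open W" by (rule chart_simps(1)[OF atlas_chart[OF atlas W]])
      show "open (?\<sigma> -` W)" "open (\<gamma> -` W)"
        using W' ic \<gamma>(2) by (auto simp: integral_curve_def intro: open_vimage)
      then show "smooth_on (\<lambda>s. t * s) (?\<sigma> -` W)"
        by (intro smooth_on_mult smooth_on_const smooth_on_id)
      show "smooth_on (\<lambda>s. \<kappa> (\<gamma> s)) (\<gamma> -` W)"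
        using sm W by (auto simp: smooth_map_def euclidean_atlas_def o_def)
    qed auto
    moreover have "continuous_on UNIV ?\<sigma>" using ic by (simp add: integral_curve_def)
    ultimately show ?thesis
      by (auto simp: one_parameter_subgroup_def smooth_map_def euclidean_atlas_def o_def
          distrib_left hom)
  qed
  have "(THE \<gamma>. one_parameter_subgroup G \<gamma> \<and> velocity (atlas G) \<gamma> 0 = (\<lambda>f. t * a f)) = ?\<sigma>"
  proof (rule the_equality)
    show "one_parameter_subgroup G ?\<sigma> \<and> velocity (atlas G) ?\<sigma> 0 = (\<lambda>f. t * a f)"
      using \<sigma> velocity_integral_curve[OF ta ic] one_parameter_subgroup_one[OF \<sigma>] by simp
    fix \<rho> assume \<rho>: "one_parameter_subgroup G \<rho> \<and> velocity (atlas G) \<rho> 0 = (\<lambda>f. t * a f)"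
    show "\<rho> = ?\<sigma>"
    proof
      fix s
      show "\<rho> s = \<gamma> (t * s)"
        using integral_curve_unique[OF ta open_UNIV connected_UNIV UNIV_I
            one_parameter_subgroup_integral_curve ic, of \<rho> 0 s] \<rho>
          one_parameter_subgroup_one[OF \<sigma>] one_parameter_subgroup_one[of \<rho>] by simp
    qed
  qed
  then show ?thesis by (simp add: exp_map_def)
qed

end

section \<open>The Lie bracket\<close>

context smooth_lie_group
begin

lemma Lie_linear:
  "a \<in> Lie G \<Longrightarrow> b \<in> Lie G \<Longrightarrow> (\<lambda>f. c * a f + b f) \<in> Lie G"
  by (auto simp: Lie_def tangent_space_def algebra_simps)

lemma lie_bracket_apply:
  assumes a: "a \<in> Lie G" and b: "b \<in> Lie G" and f: "f \<in> smooth"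
  shows "lie_bracket G a b f = a (lderiv b f) - b (lderiv a f)"
proof -
  have L: "lie_derivative_fun (left_invariant_field G c) f = lderiv c f" for c
    using f by (simp add: lie_derivative_fun_def left_invariant_field_def tangent_map_def
        on_smooth_def lderiv_def[abs_def] o_def)
  have "left_invariant_field G c \<one> h = c h" if "h \<in> smooth" for c h
    using that by (simp add: left_invariant_field_def tangent_map_def on_smooth_def o_def)
  then show ?thesis
    using f lderiv_smooth[OF a f] lderiv_smooth[OF b f]
    by (simp add: lie_bracket_def vf_bracket_def on_smooth_def L)
qed

lemma lie_bracket_not_smooth: "f \<notin> smooth \<Longrightarrow> lie_bracket G a b f = 0"
  by (simp add: lie_bracket_def vf_bracket_def on_smooth_def)

lemma lderiv_linear:
  assumes "a \<in> Lie G" "f \<in> smooth" "h \<in> smooth"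
  shows "lderiv a (\<lambda>x. c * f x + h x) = (\<lambda>x. c * lderiv a f x + lderiv a h x)"
  using tangent_linear[OF assms(1)[unfolded Lie_def] smooth_translate[OF assms(2)] smooth_translate[OF assms(3)]]
  by (simp add: lderiv_def[abs_def])

lemma lderiv_mult:
  assumes "a \<in> Lie G" "f \<in> smooth" "h \<in> smooth"
  shows "lderiv a (\<lambda>x. f x * h x) = (\<lambda>x. f x * lderiv a h x + h x * lderiv a f x)"
  using tangent_mult[OF assms(1)[unfolded Lie_def] smooth_translate[OF assms(2)] smooth_translate[OF assms(3)]]
  by (simp add: lderiv_def[abs_def])

text \<open>The cross terms in the product rule for the second-order operators are symmetric in \<open>a\<close> and \<open>b\<close> and
  cancel in the commutator.\<close>

lemma lie_bracket_closed:
  assumes a: "a \<in> Lie G" and b: "b \<in> Lie G"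
  shows "lie_bracket G a b \<in> Lie G"
proof -
  note aT = a[unfolded Lie_def] and bT = b[unfolded Lie_def]
  have lin: "lie_bracket G a b (\<lambda>x. c * f x + h x) = c * lie_bracket G a b f + lie_bracket G a b h"
    if f: "f \<in> smooth" and h: "h \<in> smooth" for f h c
  proof -
    have fh: "(\<lambda>x. c * f x + h x) \<in> smooth"
      by (intro smooth_functions_add smooth_functions_cmult atlas f h)
    show ?thesis
      by (simp add: lie_bracket_apply[OF a b] f h fh lderiv_linear a b
          tangent_linear[OF aT] tangent_linear[OF bT] lderiv_smooth) (simp add: algebra_simps)
  qed
  have prod: "lie_bracket G a b (\<lambda>x. f x * h x) = f \<one> * lie_bracket G a b h + h \<one> * lie_bracket G a b f"
    if f: "f \<in> smooth" and h: "h \<in> smooth" for f h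
  proof -
    have fh: "(\<lambda>x. f x * h x) \<in> smooth" by (intro smooth_functions_mult atlas f h)
    have *: "u (\<lambda>x. f x * lderiv w h x + h x * lderiv w f x) =
        (f \<one> * u (lderiv w h) + lderiv w h \<one> * u f) + (h \<one> * u (lderiv w f) + lderiv w f \<one> * u h)"
      if "u \<in> Lie G" "w \<in> Lie G" for u w
      using that f h
      by (simp add: Lie_def[symmetric] tangent_add[OF that(1)[unfolded Lie_def]]
          tangent_mult[OF that(1)[unfolded Lie_def]] smooth_functions_mult atlas lderiv_smooth)
    show ?thesis
      by (simp add: lie_bracket_apply[OF a b] f h fh lderiv_mult a b * lderiv_one algebra_simps)
  qed
  show ?thesis
    unfolding Lie_def tangent_space_def using lin prod lie_bracket_not_smooth by blast
qed

lemma lie_bracket_linear: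
  assumes "a \<in> Lie G" "a' \<in> Lie G" "b \<in> Lie G"
  shows "lie_bracket G (\<lambda>f. c * a f + a' f) b = (\<lambda>f. c * lie_bracket G a b f + lie_bracket G a' b f)"
proof
  fix f
  have *: "lderiv (\<lambda>f. c * a f + a' f) f = (\<lambda>x. c * lderiv a f x + lderiv a' f x)"
    by (simp add: lderiv_def[abs_def])
  show "lie_bracket G (\<lambda>f. c * a f + a' f) b f = c * lie_bracket G a b f + lie_bracket G a' b f"
  proof (cases "f \<in> smooth")
    case True
    then show ?thesis
      using * assms
      by (simp add: lie_bracket_apply Lie_linear lderiv_smooth
          tangent_linear[OF assms(3)[unfolded Lie_def]]) (simp add: algebra_simps)
  qed (simp add: lie_bracket_not_smooth)
qed

lemma lie_bracket_commute:
  assumes "a \<in> Lie G" "b \<in> Lie G"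
  shows "lie_bracket G a b f = - lie_bracket G b a f"
  using assms by (cases "f \<in> smooth") (simp_all add: lie_bracket_apply lie_bracket_not_smooth)

lemma lderiv_lie_bracket:
  assumes a: "a \<in> Lie G" and b: "b \<in> Lie G" and f: "f \<in> smooth"
  shows "lderiv (lie_bracket G a b) f = (\<lambda>x. lderiv a (lderiv b f) x - lderiv b (lderiv a f) x)"
proof
  fix g
  have t: "lderiv c (\<lambda>h. f (g \<otimes> h)) = (\<lambda>k. lderiv c f (g \<otimes> k))" for c
    by (rule ext) (rule lderiv_translate)
  have "lderiv (lie_bracket G a b) f g = lie_bracket G a b (\<lambda>h. f (g \<otimes> h))"
    by (simp add: lderiv_def)
  also have "\<dots> = a (\<lambda>k. lderiv b f (g \<otimes> k)) - b (\<lambda>k. lderiv a f (g \<otimes> k))"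
    unfolding lie_bracket_apply[OF a b smooth_translate[OF f]] t ..
  finally show "lderiv (lie_bracket G a b) f g = lderiv a (lderiv b f) g - lderiv b (lderiv a f) g"
    by (simp add: lderiv_def)
qed

text \<open>The operators \<open>lderiv a\<close> represent the bracket as a commutator, and commutators satisfy the identity.
  The arrangement of the terms is the one in which they occur in \<open>\<delta>\<delta>\<close>.\<close>

lemma lie_bracket_jacobi:
  assumes a: "a \<in> Lie G" and b: "b \<in> Lie G" and c: "c \<in> Lie G"
  shows "lie_bracket G (lie_bracket G a b) c f - lie_bracket G (lie_bracket G a c) b f
    + lie_bracket G (lie_bracket G b c) a f = 0"
proof (cases "f \<in> smooth")
  case f: True
  have *: "lie_bracket G (lie_bracket G u v) w f =
      u (lderiv v (lderiv w f)) - v (lderiv u (lderiv w f)) - (w (lderiv u (lderiv v f)) - w (lderiv v (lderiv u f)))"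
    if u: "u \<in> Lie G" and v: "v \<in> Lie G" and w: "w \<in> Lie G" for u v w
    using lderiv_smooth[OF u] lderiv_smooth[OF v] lderiv_smooth[OF w] f
    by (simp add: lie_bracket_apply[OF lie_bracket_closed[OF u v] w] lderiv_lie_bracket[OF u v]
        lie_bracket_apply[OF u v] tangent_diff[OF atlas w[unfolded Lie_def]])
  show ?thesis by (simp add: *[OF a b c] *[OF a c b] *[OF b c a])
qed (simp add: lie_bracket_not_smooth)

end

section \<open>Infinitesimal generators of an action\<close>

locale smooth_lie_action = smooth_lie_group G
  for G :: "('g::{t2_space,second_countable_topology}, 'd::euclidean_space) lie_group" (structure) +
  fixes A :: "('m::{t2_space,second_countable_topology}, 'e::euclidean_space) chart set"
    and act :: "'g \<Rightarrow> 'm \<Rightarrow> 'm"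
  assumes manifold: "smooth_atlas A" and action: "smooth_action G A act"
begin

lemma act_one: "act \<one> x = x"
  and act_mult: "act (g \<otimes> h) x = act g (act h x)"
proof -
  interpret group_action G UNIV act using action by (simp add: smooth_action_def)
  show "act \<one> x = x" using fun_cong[OF id_eq_one, of x] by simp
  show "act (g \<otimes> h) x = act g (act h x)" by (rule composition_rule) simp_all
qed

lemma smooth_act:
  assumes "f \<in> smooth_functions A"
  shows "(\<lambda>z. f (act (fst z) (snd z))) \<in> smooth_functions (prod_atlas (atlas G) A)"
proof -
  have "smooth_map (prod_atlas (atlas G) A) A (\<lambda>(g, x). act g x)"
    using action by (simp add: smooth_action_def)
  from smooth_functions_compose[OF smooth_atlas_prod[OF atlas manifold] manifold this assms]
  show ?thesis by (simp add: split_beta')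
qed

lemma smooth_orbit: "f \<in> smooth_functions A \<Longrightarrow> (\<lambda>g. f (act g x)) \<in> smooth"
  using smooth_functions_slice_left[OF atlas manifold smooth_act, of f x] by simp

abbreviation gen :: "'g tvec \<Rightarrow> 'm \<Rightarrow> 'm tvec" where
  "gen \<equiv> generator G A act"

text \<open>The generator at \<open>x\<close> is the image of \<open>a\<close> under the differential of the orbit map
  \<open>g \<mapsto> g x\<close> at the identity. All its algebraic properties follow from this formula.\<close>

lemma generator_eq:
  assumes a: "a \<in> Lie G"
  shows "gen a x = on_smooth A (\<lambda>f. a (\<lambda>g. f (act g x)))"
proof -
  obtain \<gamma> where \<gamma>: "one_parameter_subgroup G \<gamma>" "integral_curve a \<gamma> UNIV"
    using one_parameter_subgroup_exists[OF a] .
  have "deriv (\<lambda>t. f (act (\<gamma> t) x)) 0 = a (\<lambda>g. f (act g x))" if f: "f \<in> smooth_functions A" for f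
    using DERIV_imp_deriv[OF integral_curveD[OF \<gamma>(2) UNIV_I smooth_orbit[OF f, of x], of 0]]
    by (simp add: one_parameter_subgroup_one[OF \<gamma>(1)] lderiv_one)
  then show ?thesis
    unfolding generator_def velocity_def exp_map_scale[OF a \<gamma>]
    by (auto simp: on_smooth_def o_def)
qed

lemma generator_apply:
  "a \<in> Lie G \<Longrightarrow> f \<in> smooth_functions A \<Longrightarrow> gen a x f = a (\<lambda>g. f (act g x))"
  by (simp add: generator_eq on_smooth_def)

lemma generator_not_smooth: "a \<in> Lie G \<Longrightarrow> f \<notin> smooth_functions A \<Longrightarrow> gen a x f = 0"
  by (simp add: generator_eq on_smooth_def)

lemma generator_tangent:
  assumes a: "a \<in> Lie G"
  shows "gen a x \<in> tangent_space A x"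
proof -
  note aT = a[unfolded Lie_def]
  have "gen a x (\<lambda>y. c * f y + h y) = c * gen a x f + gen a x h"
    if "f \<in> smooth_functions A" "h \<in> smooth_functions A" for f h c
    using that by (simp add: generator_apply a smooth_functions_add smooth_functions_cmult manifold
        tangent_linear[OF aT] smooth_orbit)
  moreover have "gen a x (\<lambda>y. f y * h y) = f x * gen a x h + h x * gen a x f"
    if "f \<in> smooth_functions A" "h \<in> smooth_functions A" for f h
    using that by (simp add: generator_apply a smooth_functions_mult manifold
        tangent_mult[OF aT] smooth_orbit act_one)
  ultimately show ?thesis
    unfolding tangent_space_def using generator_not_smooth[OF a] by blast
qed

lemma generator_smooth:
  assumes a: "a \<in> Lie G" and f: "f \<in> smooth_functions A"
  shows "(\<lambda>x. gen a x f) \<in> smooth_functions A"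
  using tangent_slice_smooth[OF atlas manifold smooth_act[OF f] a[unfolded Lie_def]]
  by (simp add: generator_apply a f)

lemma generator_vector_field: "a \<in> Lie G \<Longrightarrow> smooth_vector_field A (gen a)"
  by (simp add: smooth_vector_field_def generator_tangent lie_derivative_fun_def generator_smooth)

lemma generator_linear:
  assumes "a \<in> Lie G" "b \<in> Lie G"
  shows "gen (\<lambda>f. c * a f + b f) x = (\<lambda>f. c * gen a x f + gen b x f)"
  by (simp add: generator_eq assms Lie_linear on_smooth_def fun_eq_iff)

text \<open>Differentiating \<open>f (h g x)\<close> first in \<open>h\<close> and then in \<open>g\<close> gives the composition of generators;
  exchanging the order gives the composition of left-invariant fields in the opposite order. Hence the
  sign in the bracket relation.\<close>

lemma generator_generator:
  assumes a: "a \<in> Lie G" and b: "b \<in> Lie G" and f: "f \<in> smooth_functions A"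
  shows "gen a x (\<lambda>y. gen b y f) = b (lderiv a (\<lambda>g. f (act g x)))"
proof -
  let ?F = "\<lambda>g. f (act g x)"
  have F: "?F \<in> smooth" by (rule smooth_orbit[OF f])
  have "gen a x (\<lambda>y. gen b y f) = a (\<lambda>g. b (\<lambda>h. ?F (h \<otimes> g)))"
    unfolding generator_apply[OF a generator_smooth[OF b f]] by (simp add: generator_apply b f act_mult)
  also have "\<dots> = b (\<lambda>h. a (\<lambda>g. ?F (h \<otimes> g)))"
    using tangent_commute[OF atlas atlas smooth_functions_swap[OF atlas atlas smooth_mult[OF F]]
        a[unfolded Lie_def] b[unfolded Lie_def]] by simp
  finally show ?thesis by (simp add: lderiv_def[abs_def])
qed

lemma generator_lie_bracket:
  assumes a: "a \<in> Lie G" and b: "b \<in> Lie G" and f: "f \<in> smooth_functions A"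
  shows "gen (lie_bracket G a b) x f = gen b x (\<lambda>y. gen a y f) - gen a x (\<lambda>y. gen b y f)"
  unfolding generator_generator[OF a b f] generator_generator[OF b a f]
  by (simp add: generator_apply lie_bracket_closed a b f lie_bracket_apply smooth_orbit)

lemma vf_bracket_generator:
  assumes a: "a \<in> Lie G" and b: "b \<in> Lie G"
  shows "vf_bracket A (gen a) (gen b) x = (\<lambda>f. - gen (lie_bracket G a b) x f)"
proof
  fix f
  show "vf_bracket A (gen a) (gen b) x f = - gen (lie_bracket G a b) x f"
    by (cases "f \<in> smooth_functions A")
      (simp_all add: vf_bracket_def on_smooth_def lie_derivative_fun_def generator_lie_bracket a b
        generator_not_smooth lie_bracket_closed)
qed

end

section \<open>Hamiltonian vector fields\<close>

lemma tangent_space_linear: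
  "u \<in> tangent_space A p \<Longrightarrow> v \<in> tangent_space A p \<Longrightarrow> (\<lambda>f. c * u f + v f) \<in> tangent_space A p"
  by (auto simp: tangent_space_def algebra_simps)

lemma two_form_linear:
  assumes "two_form A \<omega>" "u \<in> tangent_space A p" "v \<in> tangent_space A p" "w \<in> tangent_space A p"
  shows "\<omega> p (\<lambda>f. c * u f + v f) w = c * \<omega> p u w + \<omega> p v w"
    "\<omega> p w (\<lambda>f. c * u f + v f) = c * \<omega> p w u + \<omega> p w v"
  using assms by (auto simp: two_form_def)

lemma two_form_alternating:
  "two_form A \<omega> \<Longrightarrow> u \<in> tangent_space A p \<Longrightarrow> \<omega> p u u = 0"
  by (auto simp: two_form_def)

lemma two_form_antisym:
  assumes \<omega>: "two_form A \<omega>" and uv: "u \<in> tangent_space A p" "v \<in> tangent_space A p"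
  shows "\<omega> p u v = - \<omega> p v u"
proof -
  note sum = tangent_space_linear[OF uv, of 1]
  show ?thesis
    using two_form_alternating[OF \<omega> sum] two_form_alternating[OF \<omega> uv(1)] two_form_alternating[OF \<omega> uv(2)]
      two_form_linear(1)[OF \<omega> uv sum, of 1] two_form_linear(2)[OF \<omega> uv uv(1), of 1]
      two_form_linear(2)[OF \<omega> uv uv(2), of 1] by simp
qed

text \<open>A chart identifies the tangent space with the finite-dimensional model space. There the injective
  linear map given by the Gram matrix of \<open>\<omega>\<close> is onto, so \<open>d f\<close> is represented by a unique vector.\<close>

lemma hamiltonian_vf:
  fixes A :: "('m::{t2_space,second_countable_topology}, 'e::euclidean_space) chart set"
  assumes A: "smooth_atlas A" and \<omega>: "two_form A \<omega>" "nondegenerate A \<omega>" and f: "f \<in> smooth_functions A"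
  shows "hamiltonian_vf A \<omega> f p \<in> tangent_space A p"
    and "\<And>v. v \<in> tangent_space A p \<Longrightarrow> \<omega> p (hamiltonian_vf A \<omega> f p) v = v f"
proof -
  obtain U \<phi> where U: "(U, \<phi>) \<in> A" "p \<in> U" using atlas_cover[OF A] .
  define D where "D = (\<lambda>w. on_smooth A (chart_derivative U \<phi> p w))"
  have DT: "D w \<in> tangent_space A p" for w
    unfolding D_def by (rule chart_derivative_in_tangent_space[OF A U])
  have Dlin: "D (c *\<^sub>R w + w') = (\<lambda>h. c * D w h + D w' h)" for c w w'
  proof
    fix h show "D (c *\<^sub>R w + w') h = c * D w h + D w' h"
    proof (cases "h \<in> smooth_functions A")
      case True
      note l = has_derivative_linear[OF chart_derivative[OF A U True]]
      from True show ?thesis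
        by (simp add: D_def on_smooth_def linear_add[OF l] linear_cmul[OF l])
    qed (simp add: D_def on_smooth_def)
  qed
  have Dsurj: "\<exists>w. v = D w" if v: "v \<in> tangent_space A p" for v
  proof -
    obtain w where "\<And>h. h \<in> smooth_functions A \<Longrightarrow> v h = chart_derivative U \<phi> p w h"
      using tangent_space_chart_derivative[OF A v U] by blast
    then have "v = D w" using tangent_not_smooth[OF v] by (auto simp: D_def on_smooth_def)
    then show ?thesis ..
  qed
  note lin = two_form_linear[OF \<omega>(1)]
  have linearI': "linear h" if "\<And>c w w'. h (c *\<^sub>R w + w') = c *\<^sub>R h w + h w'" for h :: "'e \<Rightarrow> real"
  proof (rule linearI)
    have "h 0 = 0" using that[of "- 1" 0 0] by simp
    then show "h (c *\<^sub>R w) = c *\<^sub>R h w" for c w using that[of c w 0] by simp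
    show "h (w + w') = h w + h w'" for w w' using that[of 1 w w'] by simp
  qed
  define B where "B = (\<lambda>w w'. \<omega> p (D w) (D w'))"
  have B1: "linear (\<lambda>w. B w w')" and B2: "linear (B w)" for w w'
    by (rule linearI'; simp add: B_def Dlin lin DT)+
  have Brep: "B w w' = (\<Sum>b\<in>Basis. (w' \<bullet> b) * B w b)" for w w'
  proof -
    have "B w w' = B w (\<Sum>b\<in>Basis. (w' \<bullet> b) *\<^sub>R b)" by (simp only: euclidean_representation)
    then show ?thesis by (simp only: linear_sum[OF B2] linear_cmul[OF B2] real_scaleR_def)
  qed
  define T where "T = (\<lambda>w. \<Sum>b\<in>Basis. B w b *\<^sub>R b)"
  have Tb: "T w \<bullet> b = B w b" if "b \<in> Basis" for w b
    using that by (simp add: T_def inner_sum_left inner_Basis if_distrib cong: if_cong)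
  have T: "linear T"
    by (rule linearI)
      (simp_all add: T_def linear_add[OF B1] linear_cmul[OF B1] scaleR_left_distrib sum.distrib scaleR_sum_right)
  have "inj T"
  proof (rule linear_injective_0[OF T, THEN iffD2], intro allI impI)
    fix w assume "T w = 0"
    then have "B w b = 0" if "b \<in> Basis" for b using Tb[OF that, of w] by simp
    then have "B w w' = 0" for w' using Brep[of w w'] by simp
    then have "\<forall>v\<in>tangent_space A p. \<omega> p (D w) v = 0" using Dsurj by (auto simp: B_def)
    then have "D w = (\<lambda>_. 0)" using \<omega>(2) DT unfolding nondegenerate_def by blast
    moreover have "D 0 = (\<lambda>_. 0)" using Dlin[of "- 1" 0 0] by (simp add: fun_eq_iff)
    ultimately have "D w h = D 0 h" for h by simp
    then have "chart_derivative U \<phi> p w h = chart_derivative U \<phi> p 0 h" if "h \<in> smooth_functions A" for h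
      using that by (simp add: D_def on_smooth_def) meson
    then show "w = 0" by (rule chart_derivative_injective[OF A U])
  qed
  then have "surj T" by (rule linear_inj_imp_surj[OF T])
  then obtain w where w: "T w = (\<Sum>b\<in>Basis. D b f *\<^sub>R b)" by (metis surjD)
  have wb: "B w b = D b f" if "b \<in> Basis" for b
    using that Tb[OF that, of w] by (simp add: w inner_sum_left inner_Basis if_distrib cong: if_cong)
  have Df: "D w' f = (\<Sum>b\<in>Basis. (w' \<bullet> b) * D b f)" for w'
  proof -
    have l: "linear (\<lambda>w. D w f)" by (rule linearI') (simp add: Dlin)
    have "D w' f = D (\<Sum>b\<in>Basis. (w' \<bullet> b) *\<^sub>R b) f" by (simp only: euclidean_representation)
    then show ?thesis by (simp only: linear_sum[OF l] linear_cmul[OF l] real_scaleR_def)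
  qed
  have "B w w' = D w' f" for w'
    unfolding Brep[of w w'] Df[of w'] by (simp add: wb)
  then have ex: "D w \<in> tangent_space A p \<and> (\<forall>v\<in>tangent_space A p. \<omega> p (D w) v = differential f p v)"
    using DT Dsurj by (auto simp: B_def differential_def)
  have "\<exists>!u. u \<in> tangent_space A p \<and> (\<forall>v\<in>tangent_space A p. \<omega> p u v = differential f p v)"
  proof (rule ex1I[where a="D w"])
    show "D w \<in> tangent_space A p \<and> (\<forall>v\<in>tangent_space A p. \<omega> p (D w) v = differential f p v)"
      by (rule ex)
    fix u assume u: "u \<in> tangent_space A p \<and> (\<forall>v\<in>tangent_space A p. \<omega> p u v = differential f p v)"
    obtain w' where w': "u = D w'" using Dsurj u by blast
    have "D ((- 1) *\<^sub>R w + w') \<in> tangent_space A p" by (rule DT)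
    moreover have "\<forall>v\<in>tangent_space A p. \<omega> p (D ((- 1) *\<^sub>R w + w')) v = 0"
    proof
      fix v assume v: "v \<in> tangent_space A p"
      show "\<omega> p (D ((- 1) *\<^sub>R w + w')) v = 0"
        unfolding Dlin lin(1)[OF DT DT v] using u ex w' v by simp
    qed
    ultimately have "D ((- 1) *\<^sub>R w + w') = (\<lambda>_. 0)"
      using \<omega>(2) unfolding nondegenerate_def by blast
    then show "u = D w" unfolding Dlin w' by (simp add: fun_eq_iff)
  qed
  from theI'[OF this, folded hamiltonian_vf_def]
  show "hamiltonian_vf A \<omega> f p \<in> tangent_space A p"
    and "\<And>v. v \<in> tangent_space A p \<Longrightarrow> \<omega> p (hamiltonian_vf A \<omega> f p) v = v f"
    by (auto simp: differential_def)
qed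

section \<open>Two-cocycles\<close>

context smooth_lie_action
begin

abbreviation mact :: "'g tvec \<Rightarrow> ('m \<Rightarrow> real) \<Rightarrow> 'm \<Rightarrow> real" where
  "mact \<equiv> module_action G A act"

abbreviation br :: "'g tvec \<Rightarrow> 'g tvec \<Rightarrow> 'g tvec" where
  "br \<equiv> lie_bracket G"

lemma module_action_apply: "mact a f x = - gen a x f"
  by (simp add: module_action_def lie_derivative_fun_def)

lemma module_action_smooth: "a \<in> Lie G \<Longrightarrow> f \<in> smooth_functions A \<Longrightarrow> mact a f \<in> smooth_functions A"
  unfolding module_action_def lie_derivative_fun_def
  by (rule smooth_functions_minus[OF manifold generator_smooth])

lemma module_action_linear:
  assumes "a \<in> Lie G" "f \<in> smooth_functions A" "h \<in> smooth_functions A"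
  shows "mact a (\<lambda>x. c * f x + h x) x = c * mact a f x + mact a h x"
  using tangent_linear[OF generator_tangent[OF assms(1)] assms(2,3)]
  by (simp add: module_action_apply algebra_simps)

lemma module_action_add:
  "a \<in> Lie G \<Longrightarrow> f \<in> smooth_functions A \<Longrightarrow> h \<in> smooth_functions A \<Longrightarrow>
    mact a (\<lambda>x. f x + h x) x = mact a f x + mact a h x"
  using module_action_linear[of a f h 1] by simp

lemma module_action_diff:
  "a \<in> Lie G \<Longrightarrow> f \<in> smooth_functions A \<Longrightarrow> h \<in> smooth_functions A \<Longrightarrow>
    mact a (\<lambda>x. f x - h x) x = mact a f x - mact a h x"
  using module_action_linear[of a h f "- 1"] by simp

text \<open>The sign in the bracket relation of the generators is compensated by the sign in the module action.\<close>

lemma module_action_lie_bracket: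
  assumes "a \<in> Lie G" "b \<in> Lie G" "f \<in> smooth_functions A"
  shows "mact (br a b) f x = mact a (mact b f) x - mact b (mact a f) x"
proof -
  have "gen c x (mact d f) = - gen c x (\<lambda>y. gen d y f)" if "c \<in> Lie G" "d \<in> Lie G" for c d
    using tangent_cmult[OF manifold generator_tangent[OF that(1)] generator_smooth[OF that(2) assms(3)], of x "- 1"]
    by (simp add: module_action_def lie_derivative_fun_def)
  then show ?thesis
    by (simp add: module_action_apply generator_lie_bracket assms)
qed

text \<open>Two-cochains are handled as functions of two arguments; the last condition is the vanishing of
  the coboundary.\<close>

definition cocycle2 :: "('g tvec \<Rightarrow> 'g tvec \<Rightarrow> 'm \<Rightarrow> real) \<Rightarrow> bool" where
  "cocycle2 F \<longleftrightarrow>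
     (\<forall>a\<in>Lie G. \<forall>b\<in>Lie G. F a b \<in> smooth_functions A) \<and>
     (\<forall>a\<in>Lie G. \<forall>a'\<in>Lie G. \<forall>b\<in>Lie G. \<forall>c x.
        F (\<lambda>f. c * a f + a' f) b x = c * F a b x + F a' b x \<and>
        F b (\<lambda>f. c * a f + a' f) x = c * F b a x + F b a' x) \<and>
     (\<forall>a\<in>Lie G. \<forall>x. F a a x = 0) \<and>
     (\<forall>a\<in>Lie G. \<forall>b\<in>Lie G. \<forall>c\<in>Lie G. \<forall>x.
        mact a (F b c) x - mact b (F a c) x + mact c (F a b) x
        - F (br a b) c x + F (br a c) b x - F (br b c) a x = 0)"

lemma cocycle2_cong:
  assumes "cocycle2 F" "\<And>a b. a \<in> Lie G \<Longrightarrow> b \<in> Lie G \<Longrightarrow> F a b = H a b"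
  shows "cocycle2 H"
  using assms(1) unfolding cocycle2_def
  by (simp add: assms(2)[symmetric] Lie_linear lie_bracket_closed)

lemma cocycle2_add:
  assumes F: "cocycle2 F" and H: "cocycle2 H"
  shows "cocycle2 (\<lambda>a b x. F a b x + H a b x)"
proof -
  note f = F[unfolded cocycle2_def] and h = H[unfolded cocycle2_def]
  have "mact a (\<lambda>x. F b c x + H b c x) x = mact a (F b c) x + mact a (H b c) x"
    if "a \<in> Lie G" "b \<in> Lie G" "c \<in> Lie G" for a b c x
    using that f h by (intro module_action_add) auto
  moreover have "(mact a (F b c) x - mact b (F a c) x + mact c (F a b) x
      - F (br a b) c x + F (br a c) b x - F (br b c) a x) +
      (mact a (H b c) x - mact b (H a c) x + mact c (H a b) x
      - H (br a b) c x + H (br a c) b x - H (br b c) a x) = 0"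
    if "a \<in> Lie G" "b \<in> Lie G" "c \<in> Lie G" for a b c x
    using that f h by simp
  ultimately show ?thesis
    unfolding cocycle2_def using f h
    by (auto simp: smooth_functions_add manifold algebra_simps)
qed

lemma coboundary_pair:
  "coboundary G A act \<beta> [a, b] x = mact a (\<beta> [b]) x - mact b (\<beta> [a]) x - \<beta> [br a b] x"
  by (simp add: coboundary_def delete_nth_def numeral_2_eq_2)

lemma coboundary_triple:
  "coboundary G A act \<alpha> [a, b, c] x =
     mact a (\<alpha> [b, c]) x - mact b (\<alpha> [a, c]) x + mact c (\<alpha> [a, b]) x
     - \<alpha> [br a b, c] x + \<alpha> [br a c, b] x - \<alpha> [br b c, a] x"
  by (simp add: coboundary_def delete_nth_def numeral_3_eq_3)

lemma cocycle2_imp_cocycle: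
  assumes F: "cocycle2 F"
  shows "cocycle G A act 2 (\<lambda>as. F (as ! 0) (as ! 1))"
  unfolding cocycle_def cochain_def
proof (intro conjI ballI allI impI)
  note f = F[unfolded cocycle2_def]
  {
    fix as assume "as \<in> arguments G 2"
    then obtain a b where as: "as = [a, b]" and ab: "a \<in> Lie G" "b \<in> Lie G"
      by (auto simp: arguments_def numeral_2_eq_2 length_Suc_conv)
    show "F (as ! 0) (as ! 1) \<in> smooth_functions A" using f ab by (simp add: as)
    {
      fix i :: nat and u v c assume "i < 2" and uv: "u \<in> Lie G" "v \<in> Lie G"
      then have "i = 0 \<or> i = 1" by auto
      then show "F (as[i := \<lambda>f. c * u f + v f] ! 0) (as[i := \<lambda>f. c * u f + v f] ! 1) =
          (\<lambda>x. c * F (as[i := u] ! 0) (as[i := u] ! 1) x + F (as[i := v] ! 0) (as[i := v] ! 1) x)"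
        using f ab uv by (auto simp: as fun_eq_iff)
    next
      fix i j :: nat assume "i < j" "j < 2" "as ! i = as ! j"
      then have "i = 0" "j = 1" by auto
      with \<open>as ! i = as ! j\<close> have ba: "b = a" by (simp add: as)
      have "F a a x = 0" for x using f ab(1) by blast
      then show "F (as ! 0) (as ! 1) = (\<lambda>_. 0)" unfolding as ba by (intro ext) simp
    }
  next
    fix as assume "as \<in> arguments G (Suc 2)"
    then obtain a b c where as: "as = [a, b, c]" and abc: "a \<in> Lie G" "b \<in> Lie G" "c \<in> Lie G"
      by (auto simp: arguments_def numeral_2_eq_2 length_Suc_conv)
    show "coboundary G A act (\<lambda>as. F (as ! 0) (as ! 1)) as = (\<lambda>_. 0)"
      using f abc by (simp add: as fun_eq_iff coboundary_triple)
  }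
qed

text \<open>\<open>\<delta>\<delta> = 0\<close> on one-cochains: the module identity cancels the second derivatives, the Jacobi
  identity the values on iterated brackets.\<close>

lemma cocycle2_coboundary:
  fixes \<beta> :: "'g tvec \<Rightarrow> 'm \<Rightarrow> real"
  assumes smooth: "\<And>a. a \<in> Lie G \<Longrightarrow> \<beta> a \<in> smooth_functions A"
    and linear: "\<And>a b c x. a \<in> Lie G \<Longrightarrow> b \<in> Lie G \<Longrightarrow> \<beta> (\<lambda>f. c * a f + b f) x = c * \<beta> a x + \<beta> b x"
  shows "cocycle2 (\<lambda>a b x. mact a (\<beta> b) x - mact b (\<beta> a) x - \<beta> (br a b) x)"
proof -
  let ?F = "\<lambda>a b x. mact a (\<beta> b) x - mact b (\<beta> a) x - \<beta> (br a b) x"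
  note cl = lie_bracket_closed
  have lin1: "?F (\<lambda>f. c * a f + a' f) b x = c * ?F a b x + ?F a' b x"
    if "a \<in> Lie G" "a' \<in> Lie G" "b \<in> Lie G" for a a' b c x
  proof -
    have "\<beta> (\<lambda>f. c * a f + a' f) = (\<lambda>x. c * \<beta> a x + \<beta> a' x)" using linear that by blast
    moreover have "mact (\<lambda>f. c * a f + a' f) (\<beta> b) x = c * mact a (\<beta> b) x + mact a' (\<beta> b) x"
      by (simp add: module_action_apply generator_linear that)
    ultimately show ?thesis
      by (simp add: lie_bracket_linear that linear cl module_action_linear smooth)
        (simp add: algebra_simps)
  qed
  have zero: "\<beta> (\<lambda>_. 0) x = 0" if "a \<in> Lie G" for a x
    using linear[OF that that, of "- 1" x] by simp
  have neg: "\<beta> (\<lambda>f. - a f) x = - \<beta> a x" if a: "a \<in> Lie G" for a x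
  proof -
    have "(\<lambda>_. 0) \<in> Lie G" using Lie_linear[OF a a, of "- 1"] by simp
    from linear[OF a this, of "- 1" x] zero[OF a] show ?thesis by simp
  qed
  have anti: "?F b a x = - ?F a b x" if "a \<in> Lie G" "b \<in> Lie G" for a b x
  proof -
    have "br b a = (\<lambda>f. - br a b f)" by (rule ext) (rule lie_bracket_commute[OF that(2,1)])
    then show ?thesis by (simp add: neg cl that)
  qed
  have lin2: "?F b (\<lambda>f. c * a f + a' f) x = c * ?F b a x + ?F b a' x"
    if "a \<in> Lie G" "a' \<in> Lie G" "b \<in> Lie G" for a a' b c x
    using lin1[OF that, of c x] anti[OF Lie_linear[OF that(1,2)] that(3), of c x]
      anti[OF that(1,3), of x] anti[OF that(2,3), of x]
    by (simp only:)
  have alt: "?F a a x = 0" if "a \<in> Lie G" for a x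
    using anti[OF that that, of x] by linarith
  have sF: "?F a b \<in> smooth_functions A" if "a \<in> Lie G" "b \<in> Lie G" for a b
    by (intro smooth_functions_diff manifold module_action_smooth smooth cl that)
  have mF: "mact a (?F b c) x = mact a (mact b (\<beta> c)) x - mact a (mact c (\<beta> b)) x - mact a (\<beta> (br b c)) x"
    if "a \<in> Lie G" "b \<in> Lie G" "c \<in> Lie G" for a b c x
    using that by (simp add: module_action_diff smooth_functions_diff manifold module_action_smooth smooth cl)
  have jac: "\<beta> (br (br a b) c) x - \<beta> (br (br a c) b) x + \<beta> (br (br b c) a) x = 0"
    if "a \<in> Lie G" "b \<in> Lie G" "c \<in> Lie G" for a b c x
  proof -
    have "br (br a c) b = (\<lambda>f. 1 * br (br a b) c f + br (br b c) a f)"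
      using lie_bracket_jacobi[OF that] by (simp add: fun_eq_iff algebra_simps)
    then show ?thesis by (simp only:) (simp add: linear[of _ _ 1, simplified] that cl)
  qed
  have cob: "mact a (?F b c) x - mact b (?F a c) x + mact c (?F a b) x
      - ?F (br a b) c x + ?F (br a c) b x - ?F (br b c) a x = 0"
    if "a \<in> Lie G" "b \<in> Lie G" "c \<in> Lie G" for a b c x
    using jac[OF that, of x]
    by (simp only: mF that) (simp add: module_action_lie_bracket smooth that)
  show ?thesis
    unfolding cocycle2_def by (intro conjI ballI allI; rule sF lin1 lin2 alt cob; assumption)
qed

text \<open>On the generators, Koszul's formula for \<open>d\<omega>\<close> becomes the coboundary of \<open>(a, b) \<mapsto> \<Omega>(b, a)\<close>,
  because the bracket of generators is minus the generator of the bracket.\<close>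

lemma cocycle2_canonical:
  assumes \<omega>: "two_form A \<omega>" "closed_form A \<omega>"
  shows "cocycle2 (\<lambda>a b. canonical_cocycle G A act \<omega> b a)"
proof -
  note lin = two_form_linear[OF \<omega>(1)] and alt = two_form_alternating[OF \<omega>(1)]
    and anti = two_form_antisym[OF \<omega>(1)]
  have smooth: "(\<lambda>x. \<omega> x (gen b x) (gen a x)) \<in> smooth_functions A" if "a \<in> Lie G" "b \<in> Lie G" for a b
    using \<omega>(1) generator_vector_field that by (auto simp: two_form_def)
  note gT = generator_tangent
  have br: "\<omega> x (vf_bracket A (gen a) (gen b) x) (gen c x) = - \<omega> x (gen (br a b) x) (gen c x)"
    if "a \<in> Lie G" "b \<in> Lie G" "c \<in> Lie G" for a b c x
  proof -
    have t: "gen (br a b) x \<in> tangent_space A x" "gen c x \<in> tangent_space A x"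
      using gT lie_bracket_closed that by blast+
    have z: "(\<lambda>h. 0) \<in> tangent_space A x" by (simp add: tangent_space_def)
    have "\<omega> x (\<lambda>h. 0) (gen c x) = 0" using lin(1)[OF z z t(2), of "- 1"] by simp
    with lin(1)[OF t(1) z t(2), of "- 1"] show ?thesis
      by (simp add: vf_bracket_generator that)
  qed
  have gen_swap: "gen a x (\<lambda>y. \<omega> y (gen c y) (gen b y)) = - gen a x (\<lambda>y. \<omega> y (gen b y) (gen c y))"
    if "a \<in> Lie G" "b \<in> Lie G" "c \<in> Lie G" for a b c x
  proof -
    have "(\<lambda>y. \<omega> y (gen c y) (gen b y)) = (\<lambda>y. - 1 * \<omega> y (gen b y) (gen c y))"
      using anti[OF gT[OF that(3)] gT[OF that(2)]] by (intro ext) simp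
    then show ?thesis
      using tangent_cmult[OF manifold gT[OF that(1)] smooth[OF that(3,2)], of x "- 1"] by (simp only:)
  qed
  have "exterior_derivative A \<omega> (gen a) (gen b) (gen c) x = 0"
    if "a \<in> Lie G" "b \<in> Lie G" "c \<in> Lie G" for a b c x
    using \<omega>(2) generator_vector_field that by (auto simp: closed_form_def)
  then have d: "gen a x (\<lambda>y. \<omega> y (gen b y) (gen c y)) - gen b x (\<lambda>y. \<omega> y (gen a y) (gen c y))
      + gen c x (\<lambda>y. \<omega> y (gen a y) (gen b y)) + \<omega> x (gen (br a b) x) (gen c x)
      - \<omega> x (gen (br a c) x) (gen b x) + \<omega> x (gen (br b c) x) (gen a x) = 0"
    if "a \<in> Lie G" "b \<in> Lie G" "c \<in> Lie G" for a b c x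
    using that by (simp add: exterior_derivative_def br)
  have cob: "mact a (canonical_cocycle G A act \<omega> c b) x - mact b (canonical_cocycle G A act \<omega> c a) x
      + mact c (canonical_cocycle G A act \<omega> b a) x - canonical_cocycle G A act \<omega> c (br a b) x
      + canonical_cocycle G A act \<omega> b (br a c) x - canonical_cocycle G A act \<omega> a (br b c) x = 0"
    if abc: "a \<in> Lie G" "b \<in> Lie G" "c \<in> Lie G" for a b c x
  proof -
    have sw: "\<omega> x (gen u x) (gen (br v w) x) = - \<omega> x (gen (br v w) x) (gen u x)"
      if "u \<in> Lie G" "v \<in> Lie G" "w \<in> Lie G" for u v w
      using that by (intro anti gT lie_bracket_closed)
    show ?thesis
      using d[OF abc, of x] abc
      by (simp add: canonical_cocycle_def[abs_def] module_action_apply gen_swap[of a b c] gen_swap[of b a c]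
          gen_swap[of c a b] sw)
  qed
  have s: "canonical_cocycle G A act \<omega> b a \<in> smooth_functions A" if "a \<in> Lie G" "b \<in> Lie G" for a b
    using smooth[OF that] by (simp add: canonical_cocycle_def[abs_def])
  have l: "canonical_cocycle G A act \<omega> (\<lambda>f. c * a f + a' f) b x =
      c * canonical_cocycle G A act \<omega> a b x + canonical_cocycle G A act \<omega> a' b x"
    "canonical_cocycle G A act \<omega> b (\<lambda>f. c * a f + a' f) x =
      c * canonical_cocycle G A act \<omega> b a x + canonical_cocycle G A act \<omega> b a' x"
    if "a \<in> Lie G" "a' \<in> Lie G" "b \<in> Lie G" for a a' b c x
    using that by (simp_all add: canonical_cocycle_def generator_linear lin gT)
  have z: "canonical_cocycle G A act \<omega> a a x = 0" if "a \<in> Lie G" for a x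
    using that by (simp add: canonical_cocycle_def alt gT)
  show ?thesis
    unfolding cocycle2_def by (intro conjI ballI allI; rule s l z cob; assumption)
qed

end

theorem proposition2:
  fixes G :: "('g::{t2_space,second_countable_topology}, 'd::euclidean_space) lie_group"
    and A :: "('m::{t2_space,second_countable_topology}, 'e::euclidean_space) chart set"
    and act :: "'g \<Rightarrow> 'm \<Rightarrow> 'm"
    and \<omega> \<omega>\<^sub>i \<Delta>\<omega> :: "'m form2"
    and J :: "'g tvec \<Rightarrow> 'm \<Rightarrow> real"
    and \<Delta>X :: "'g tvec \<Rightarrow> 'm \<Rightarrow> 'm tvec"
  assumes manifold: "smooth_atlas A"
    and symplectic: "symplectic_form A \<omega>"
    and lie_group: "is_lie_group G"
    and action: "smooth_action G A act"
    and decomposition: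
      "\<forall>x. \<forall>u\<in>tangent_space A x. \<forall>v\<in>tangent_space A x. \<omega> x u v = \<omega>\<^sub>i x u v + \<Delta>\<omega> x u v"
    and invariant_part: "symplectic_form A \<omega>\<^sub>i" "invariant_form G A act \<omega>\<^sub>i"
    and perturbation: "two_form A \<Delta>\<omega>" "closed_form A \<Delta>\<omega>"
    and lie_derivatives:
      "\<forall>a\<in>Lie G. \<forall>Y Z. smooth_vector_field A Y \<longrightarrow> smooth_vector_field A Z \<longrightarrow>
         (\<forall>x. lie_derivative_form A (generator G A act a) \<omega> Y Z x =
              lie_derivative_form A (generator G A act a) \<Delta>\<omega> Y Z x)"
    and momentum_smooth: "\<forall>a\<in>Lie G. J a \<in> smooth_functions A"
    and momentum_linear:
      "\<forall>a\<in>Lie G. \<forall>b\<in>Lie G. \<forall>c x. J (\<lambda>f. c * a f + b f) x = c * J a x + J b x"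
    and momentum:
      "\<forall>a\<in>Lie G. \<forall>x. \<forall>v\<in>tangent_space A x.
         differential (J a) x v = \<omega>\<^sub>i x (generator G A act a x) v"
    and \<Delta>X: "\<forall>a\<in>Lie G. \<forall>x.
         \<Delta>X a x = (\<lambda>f. generator G A act a x f - hamiltonian_vf A \<omega> (J a) x f)"
    and isotropic: "\<forall>a\<in>Lie G. \<forall>b\<in>Lie G. \<forall>x. \<omega> x (\<Delta>X a x) (\<Delta>X b x) = 0"
  shows "cohomologous G A act 2
           (\<lambda>as x. poisson_bracket A \<omega> (J (as ! 0)) (J (as ! 1)) x
                     - J (lie_bracket G (as ! 0) (as ! 1)) x)
           (\<lambda>as. canonical_cocycle G A act \<omega> (as ! 1) (as ! 0))"
proof -
  interpret smooth_lie_action G A act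
    using lie_group manifold action by unfold_locales
  have tf: "two_form A \<omega>" and cf: "closed_form A \<omega>" and nd: "nondegenerate A \<omega>"
    using symplectic by (auto simp: symplectic_form_def)
  let ?P = "\<lambda>a b x. poisson_bracket A \<omega> (J a) (J b) x - J (br a b) x"
  let ?\<Omega> = "canonical_cocycle G A act \<omega>"
  let ?dJ = "\<lambda>a b x. mact a (J b) x - mact b (J a) x - J (br a b) x"
  have P: "?P a b = (\<lambda>x. ?\<Omega> b a x + ?dJ a b x)" if a: "a \<in> Lie G" and b: "b \<in> Lie G" for a b
  proof
    fix x
    let ?X = "\<lambda>a. generator G A act a x" and ?H = "\<lambda>a. hamiltonian_vf A \<omega> (J a) x"
    note lin = two_form_linear[OF tf] and anti = two_form_antisym[OF tf]
    have X: "?X c \<in> tangent_space A x" if "c \<in> Lie G" for c by (rule generator_tangent[OF that])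
    have H: "?H c \<in> tangent_space A x" if "c \<in> Lie G" for c
      using hamiltonian_vf(1)[OF manifold tf nd] momentum_smooth that by blast
    have HJ: "\<omega> x (?H c) v = v (J c)" if "c \<in> Lie G" "v \<in> tangent_space A x" for c v
      using hamiltonian_vf(2)[OF manifold tf nd _ that(2)] momentum_smooth that(1) by blast
    note diff = tangent_space_linear[of _ A x _ "- 1"]
    have DX: "\<Delta>X c x = (\<lambda>h. - 1 * ?H c h + ?X c h)" if "c \<in> Lie G" for c
      using \<Delta>X that by simp
    \<comment> \<open>expand the isotropy condition by bilinearity\<close>
    have "0 = \<omega> x (\<lambda>h. - 1 * ?H a h + ?X a h) (\<lambda>h. - 1 * ?H b h + ?X b h)"
      using isotropic a b by (simp only: DX[symmetric])
    also have "\<dots> = \<omega> x (?H a) (?H b) - \<omega> x (?H a) (?X b) - \<omega> x (?X a) (?H b) + \<omega> x (?X a) (?X b)"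
      using lin(1)[OF H[OF a] X[OF a] diff[OF H[OF b] X[OF b]], of "- 1"]
        lin(2)[OF H[OF b] X[OF b] H[OF a], of "- 1"] lin(2)[OF H[OF b] X[OF b] X[OF a], of "- 1"] by simp
    finally have "\<omega> x (?H a) (?H b) = \<omega> x (?H a) (?X b) + \<omega> x (?X a) (?H b) - \<omega> x (?X a) (?X b)"
      by simp
    also have "\<dots> = ?X b (J a) - ?X a (J b) + \<omega> x (?X b) (?X a)"
      using HJ[OF a X[OF b]] HJ[OF b X[OF a]] anti[OF X[OF a] H[OF b]] anti[OF X[OF a] X[OF b]] by simp
    finally show "?P a b x = ?\<Omega> b a x + ?dJ a b x"
      by (simp add: poisson_bracket_def canonical_cocycle_def module_action_apply)
  qed
  have \<Omega>: "cocycle2 (\<lambda>a b. ?\<Omega> b a)" by (rule cocycle2_canonical[OF tf cf])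
  have "cocycle2 ?dJ"
    using momentum_smooth momentum_linear by (intro cocycle2_coboundary) auto
  from cocycle2_add[OF \<Omega> this] have "cocycle2 ?P"
    by (rule cocycle2_cong) (simp only: P)
  from cocycle2_imp_cocycle[OF this] cocycle2_imp_cocycle[OF \<Omega>]
  have "cocycle G A act 2 (\<lambda>as. ?P (as ! 0) (as ! 1))" "cocycle G A act 2 (\<lambda>as. ?\<Omega> (as ! 1) (as ! 0))" .
  moreover have "cochain G A (2 - 1) (\<lambda>as. J (as ! 0))"
    unfolding cochain_def using momentum_smooth momentum_linear
    by (auto simp: arguments_def length_Suc_conv fun_eq_iff)
  moreover have "(\<lambda>x. ?P (as ! 0) (as ! 1) x - ?\<Omega> (as ! 1) (as ! 0) x) = coboundary G A act (\<lambda>as. J (as ! 0)) as"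
    if as: "as \<in> arguments G 2" for as
  proof -
    obtain a b where ab: "as = [a, b]" "a \<in> Lie G" "b \<in> Lie G"
      using as by (auto simp: arguments_def numeral_2_eq_2 length_Suc_conv)
    show ?thesis
      using fun_cong[OF P[OF ab(2,3)]] by (auto simp: ab(1) coboundary_pair)
  qed
  ultimately show ?thesis unfolding cohomologous_def by blast
qed

end
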